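(* Let $G\in\mathcal{S}$ be a $2$-connected graph. Then $G\in\mathcal{F}$ if and only if $\chi'_o(G)=4$.
   Context: Graphs are finite and may have loops and parallel edges; degrees count loops twice. A $d$-vertex is a vertex of degree $d$. A graph is odd if all degrees are odd. $\mathcal{S}$ is the class of graphs obtainable from an odd graph by subdividing edges (replacing edges by paths). $2$-connected means connected, of order at least $3$, and without a cut-vertex. An odd edge-coloring of $G$ is a coloring of the edges such that for every color $c$ and every vertex $v$ incident with an edge of color $c$, the number of edges of color $c$ at $v$ (loops counted twice) is odd; $\chi'_o(G)$ is the minimum number of colors of such a coloring. The bouquet between $x,y$ is the set of $x$-$y$ edges. A Shannon triangle is a loopless graph on three pairwise adjacent vertices; it has type $(2,1,1)$ if exactly one bouquet has even size and the other two odd size. Gluing: for disjoint $G',G''$ where $G''$ has a unique $2$-vertex $c$ with neighbors $p,q$, and an edge $xy$ of $G'$, the gluing is obtained from $(G'-xy)\cup(G''-c)$ by adding edges $xp$ and $yq$. $\mathcal{F}$ is the smallest family such that: (a) every Shannon triangle of type $(2,1,1)$ with minimum degree $2$ is in $\mathcal{F}$; (b) every graph obtained from a $2$-connected bipartite cubic graph by subdividing a single edge once is in $\mathcal{F}$; (c) every gluing of two disjoint members of $\mathcal{F}$ is in $\mathcal{F}$. *)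

theory Defs
  imports Main "HOL-Library.Uprod" "HOL-Library.Extended_Nat"
begin

section \<open>Finite graphs with loops and parallel edges\<close>

text \<open>An edge \<open>e\<close> with \<open>ends G e = Upair x x\<close> is a loop at \<open>x\<close>. The value of \<open>ends G\<close> outside
  \<open>edges G\<close> is irrelevant, so graphs are compared by \<open>isomorphic\<close> and never by equality.\<close>

record ('v, 'e) mgraph =
  verts :: "'v set"
  edges :: "'e set"
  ends :: "'e \<Rightarrow> 'v uprod"

definition multigraph :: "('v, 'e) mgraph \<Rightarrow> bool" where
  "multigraph G \<longleftrightarrow> finite (verts G) \<and> finite (edges G) \<and>
     (\<forall>e\<in>edges G. set_uprod (ends G e) \<subseteq> verts G)"

definition isomorphic :: "('v, 'e) mgraph \<Rightarrow> ('w, 'f) mgraph \<Rightarrow> bool" where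
  "isomorphic G H \<longleftrightarrow> (\<exists>f g. bij_betw f (verts G) (verts H) \<and> bij_betw g (edges G) (edges H) \<and>
     (\<forall>e\<in>edges G. ends H (g e) = map_uprod f (ends G e)))"

definition loopless :: "('v, 'e) mgraph \<Rightarrow> bool" where
  "loopless G \<longleftrightarrow> (\<forall>e\<in>edges G. \<forall>v. ends G e \<noteq> Upair v v)"

text \<open>Number of edges of \<open>F\<close> at \<open>v\<close>, where the second summand counts each loop once more.\<close>

definition degree_on :: "('v, 'e) mgraph \<Rightarrow> 'e set \<Rightarrow> 'v \<Rightarrow> nat" where
  "degree_on G F v = card {e\<in>F. v \<in> set_uprod (ends G e)} + card {e\<in>F. ends G e = Upair v v}"

definition degree :: "('v, 'e) mgraph \<Rightarrow> 'v \<Rightarrow> nat" where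
  "degree G v = degree_on G (edges G) v"

definition min_degree :: "('v, 'e) mgraph \<Rightarrow> nat" where
  "min_degree G = Min (degree G ` verts G)"

definition odd_graph :: "('v, 'e) mgraph \<Rightarrow> bool" where
  "odd_graph G \<longleftrightarrow> (\<forall>v\<in>verts G. odd (degree G v))"

definition cubic :: "('v, 'e) mgraph \<Rightarrow> bool" where
  "cubic G \<longleftrightarrow> (\<forall>v\<in>verts G. degree G v = 3)"

definition bipartite :: "('v, 'e) mgraph \<Rightarrow> bool" where
  "bipartite G \<longleftrightarrow> (\<exists>A B. A \<union> B = verts G \<and> A \<inter> B = {} \<and>
     (\<forall>e\<in>edges G. \<exists>a\<in>A. \<exists>b\<in>B. ends G e = Upair a b))"

definition bouquet :: "('v, 'e) mgraph \<Rightarrow> 'v \<Rightarrow> 'v \<Rightarrow> 'e set" where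
  "bouquet G x y = {e\<in>edges G. ends G e = Upair x y}"

section \<open>Graph operations\<close>

definition del_edge :: "('v, 'e) mgraph \<Rightarrow> 'e \<Rightarrow> ('v, 'e) mgraph" where
  "del_edge G e = \<lparr>verts = verts G, edges = edges G - {e}, ends = ends G\<rparr>"

definition del_vert :: "('v, 'e) mgraph \<Rightarrow> 'v \<Rightarrow> ('v, 'e) mgraph" where
  "del_vert G v = \<lparr>verts = verts G - {v},
     edges = {e\<in>edges G. v \<notin> set_uprod (ends G e)}, ends = ends G\<rparr>"

text \<open>New edges and vertices are named \<open>None\<close>.\<close>

definition add_edge :: "('v, 'e) mgraph \<Rightarrow> 'v \<Rightarrow> 'v \<Rightarrow> ('v, 'e option) mgraph" where
  "add_edge G x y = \<lparr>verts = verts G, edges = insert None (Some ` edges G),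
     ends = case_option (Upair x y) (ends G)\<rparr>"

definition add_vert :: "('v, 'e) mgraph \<Rightarrow> ('v option, 'e) mgraph" where
  "add_vert G = \<lparr>verts = insert None (Some ` verts G), edges = edges G,
     ends = (\<lambda>e. map_uprod Some (ends G e))\<rparr>"

definition disjoint_union :: "('v, 'e) mgraph \<Rightarrow> ('w, 'f) mgraph \<Rightarrow> ('v + 'w, 'e + 'f) mgraph" where
  "disjoint_union G H = \<lparr>verts = verts G <+> verts H, edges = edges G <+> edges H,
     ends = case_sum (\<lambda>e. map_uprod Inl (ends G e)) (\<lambda>e. map_uprod Inr (ends H e))\<rparr>"

text \<open>Here \<open>x\<close> and \<open>y\<close> are meant to be the ends of the edge \<open>e\<close>; this is required wherever
  \<open>subdivide\<close> is used.\<close>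

definition subdivide ::
    "('v, 'e) mgraph \<Rightarrow> 'e \<Rightarrow> 'v \<Rightarrow> 'v \<Rightarrow> ('v option, 'e option option) mgraph" where
  "subdivide G e x y = add_edge (add_edge (add_vert (del_edge G e)) (Some x) None) None (Some y)"

text \<open>In the inductive definitions below all graphs have the same type. This is no restriction,
  since the graphs in the premises are never larger than the one in the conclusion, and every
  construction step is taken up to isomorphism. Replacing an edge by a path is the
  same as repeatedly subdividing an edge once.\<close>

inductive subdivision_of :: "('v, 'e) mgraph \<Rightarrow> ('v, 'e) mgraph \<Rightarrow> bool" for H where
  base: "isomorphic H G \<Longrightarrow> subdivision_of H G"
| step: "\<lbrakk>subdivision_of H K; e \<in> edges K; ends K e = Upair x y; isomorphic (subdivide K e x y) G\<rbrakk>
     \<Longrightarrow> subdivision_of H G"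

definition class_S :: "('v, 'e) mgraph set" where
  "class_S = {G. \<exists>H. multigraph H \<and> odd_graph H \<and> subdivision_of H G}"

section \<open>Connectivity\<close>

definition adj_rel :: "('v, 'e) mgraph \<Rightarrow> ('v \<times> 'v) set" where
  "adj_rel G = {(x, y). \<exists>e\<in>edges G. ends G e = Upair x y}"

definition connected :: "('v, 'e) mgraph \<Rightarrow> bool" where
  "connected G \<longleftrightarrow> verts G \<noteq> {} \<and> (\<forall>u\<in>verts G. \<forall>v\<in>verts G. (u, v) \<in> (adj_rel G)\<^sup>*)"

text \<open>The usual definition of a cut-vertex for graphs that may have loops (Bondy and Murty, Graph
  Theory with Applications): the edge set splits into two nonempty parts whose only common vertex
  is \<open>v\<close>. In a connected loopless graph this says that deleting \<open>v\<close> disconnects the graph, see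
  \<open>cut_vertex_iff_del_vert\<close> below. A loop together with any further edge at its vertex
  makes that vertex a cut-vertex, so 2-connected graphs are loopless, see
  \<open>two_connected_loopless\<close>.\<close>

definition cut_vertex :: "('v, 'e) mgraph \<Rightarrow> 'v \<Rightarrow> bool" where
  "cut_vertex G v \<longleftrightarrow> (\<exists>E1 E2. E1 \<union> E2 = edges G \<and> E1 \<inter> E2 = {} \<and> E1 \<noteq> {} \<and> E2 \<noteq> {} \<and>
     (\<Union>e\<in>E1. set_uprod (ends G e)) \<inter> (\<Union>e\<in>E2. set_uprod (ends G e)) = {v})"

definition two_connected :: "('v, 'e) mgraph \<Rightarrow> bool" where
  "two_connected G \<longleftrightarrow> connected G \<and> card (verts G) \<ge> 3 \<and> \<not> (\<exists>v. cut_vertex G v)"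

section \<open>Odd edge-colorings\<close>

definition odd_edge_coloring :: "('v, 'e) mgraph \<Rightarrow> ('e \<Rightarrow> nat) \<Rightarrow> bool" where
  "odd_edge_coloring G col \<longleftrightarrow> (\<forall>c. \<forall>v\<in>verts G.
     (\<exists>e\<in>edges G. col e = c \<and> v \<in> set_uprod (ends G e)) \<longrightarrow>
     odd (degree_on G {e\<in>edges G. col e = c} v))"

text \<open>The infimum is a minimum whenever an odd edge-coloring exists, and \<open>\<infinity>\<close> otherwise.\<close>

definition odd_chromatic_index :: "('v, 'e) mgraph \<Rightarrow> enat" where
  "odd_chromatic_index G = (INF col\<in>{col. odd_edge_coloring G col}. enat (card (col ` edges G)))"

section \<open>The family of exceptional graphs\<close>

definition shannon_triangle :: "('v, 'e) mgraph \<Rightarrow> bool" where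
  "shannon_triangle G \<longleftrightarrow> multigraph G \<and> loopless G \<and> card (verts G) = 3 \<and>
     (\<forall>x\<in>verts G. \<forall>y\<in>verts G. x \<noteq> y \<longrightarrow> bouquet G x y \<noteq> {})"

definition type_211 :: "('v, 'e) mgraph \<Rightarrow> bool" where
  "type_211 G \<longleftrightarrow> (\<exists>x y z. verts G = {x, y, z} \<and> distinct [x, y, z] \<and>
     even (card (bouquet G x y)) \<and> odd (card (bouquet G y z)) \<and> odd (card (bouquet G x z)))"

text \<open>\<open>gluing G' G'' G\<close> means that \<open>G\<close> is a gluing of (disjoint copies of) \<open>G'\<close> and \<open>G''\<close>. The
  distinct edges \<open>f\<close> and \<open>g\<close> are the two edges at the unique 2-vertex \<open>c\<close> of \<open>G''\<close>.\<close>

definition gluing :: "('u, 'd) mgraph \<Rightarrow> ('v, 'e) mgraph \<Rightarrow> ('w, 'f) mgraph \<Rightarrow> bool" where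
  "gluing G' G'' G \<longleftrightarrow> (\<exists>e x y c f p g q.
     e \<in> edges G' \<and> ends G' e = Upair x y \<and>
     {v\<in>verts G''. degree G'' v = 2} = {c} \<and>
     f \<in> edges G'' \<and> g \<in> edges G'' \<and> f \<noteq> g \<and>
     ends G'' f = Upair c p \<and> ends G'' g = Upair c q \<and>
     isomorphic
       (add_edge
         (add_edge (disjoint_union (del_edge G' e) (del_vert G'' c)) (Inl x) (Inr p))
         (Inl y) (Inr q)) G)"

inductive_set family_F :: "('v, 'e) mgraph set" where
  triangle: "\<lbrakk>shannon_triangle G; type_211 G; min_degree G = 2\<rbrakk> \<Longrightarrow> G \<in> family_F"
| cubic: "\<lbrakk>multigraph (H :: ('v, 'e) mgraph); two_connected H; bipartite H; cubic H; e \<in> edges H; ends H e = Upair x y;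
     isomorphic (subdivide H e x y) G\<rbrakk> \<Longrightarrow> G \<in> family_F"
| glue: "\<lbrakk>G' \<in> family_F; G'' \<in> family_F; gluing G' G'' G\<rbrakk> \<Longrightarrow> G \<in> family_F"

section \<open>Cut-vertices and loops\<close>

lemma uprod_ends: obtains x y where "ends G e = Upair x y"
  by (metis uprod_exhaust)

lemma rtrancl_edge_leaving:
  assumes "(a, b) \<in> r\<^sup>*" "a \<in> A" "b \<notin> A"
  obtains x y where "(x, y) \<in> r" "x \<in> A" "y \<notin> A"
  using assms by (induction rule: rtrancl_induct) blast+

lemma edge_incidence:
  assumes "connected G" "v \<in> verts G" "card (verts G) \<ge> 2"
  shows "\<exists>e\<in>edges G. \<exists>w. w \<noteq> v \<and> ends G e = Upair v w"
proof -
  have "verts G \<noteq> {v}" using assms by auto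
  then obtain u where u: "u \<in> verts G" "u \<noteq> v" using assms by auto
  have "(v, u) \<in> (adj_rel G)\<^sup>*" using assms u by (auto simp: connected_def)
  then obtain x y where "(x, y) \<in> adj_rel G" "x \<in> {v}" "y \<notin> {v}"
    by (rule rtrancl_edge_leaving) (use u in auto)
  then show ?thesis by (auto simp: adj_rel_def)
qed

lemma two_connected_loopless:
  assumes "multigraph G" "two_connected G"
  shows "loopless G"
  unfolding loopless_def
proof (intro ballI allI notI)
  fix e v assume e: "e \<in> edges G" "ends G e = Upair v v"
  have v: "v \<in> verts G" using assms(1) e by (auto simp: multigraph_def)
  then obtain e' w where e': "e' \<in> edges G" "w \<noteq> v" "ends G e' = Upair v w"
    using edge_incidence[of G v] assms(2) by (auto simp: two_connected_def)
  have "e' \<noteq> e" using e e' by auto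
  moreover have "v \<in> set_uprod (ends G e')" using e' by auto
  ultimately have "cut_vertex G v"
    unfolding cut_vertex_def using e e'(1)
    by (intro exI[of _ "{e}"] exI[of _ "edges G - {e}"]) auto
  then show False using assms(2) by (auto simp: two_connected_def)
qed

lemma cut_vertex_iff_del_vert:
  assumes G: "multigraph G" "connected G" "card (verts G) \<ge> 2" "loopless G" and v: "v \<in> verts G"
  shows "cut_vertex G v \<longleftrightarrow> \<not> connected (del_vert G v)"
proof
  let ?D = "del_vert G v"
  assume "cut_vertex G v"
  then obtain E1 E2 where E: "E1 \<union> E2 = edges G" "E1 \<inter> E2 = {}" "E1 \<noteq> {}" "E2 \<noteq> {}"
    "(\<Union>e\<in>E1. set_uprod (ends G e)) \<inter> (\<Union>e\<in>E2. set_uprod (ends G e)) = {v}"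
    unfolding cut_vertex_def by blast
  have other: "\<exists>u. u \<noteq> v \<and> u \<in> verts G \<and> u \<in> set_uprod (ends G e)" if "e \<in> edges G" for e
  proof -
    obtain x y where xy: "ends G e = Upair x y" by (rule uprod_ends)
    then have "x \<noteq> y" using G(4) that by (auto simp: loopless_def)
    moreover have "x \<in> verts G" "y \<in> verts G" using xy G(1) that by (auto simp: multigraph_def)
    ultimately show ?thesis using xy by (cases "x = v") auto
  qed
  let ?A = "(\<Union>e\<in>E1. set_uprod (ends G e)) - {v}"
  obtain e1 e2 where e12: "e1 \<in> E1" "e2 \<in> E2" using E by blast
  obtain a where a: "a \<noteq> v" "a \<in> verts G" "a \<in> set_uprod (ends G e1)"
    using other[of e1] e12 E(1) by blast
  obtain b where b: "b \<noteq> v" "b \<in> verts G" "b \<in> set_uprod (ends G e2)"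
    using other[of e2] e12 E(1) by blast
  have "b \<notin> ?A" using b e12 E(5) by blast
  have "a \<in> ?A" using a e12 by blast
  show "\<not> connected ?D"
  proof
    assume "connected ?D"
    then have "(a, b) \<in> (adj_rel ?D)\<^sup>*" using a b by (auto simp: connected_def del_vert_def)
    then obtain x y where xy: "(x, y) \<in> adj_rel ?D" "x \<in> ?A" "y \<notin> ?A"
      using \<open>a \<in> ?A\<close> \<open>b \<notin> ?A\<close> by (rule rtrancl_edge_leaving)
    then obtain e where e: "e \<in> edges G" "v \<notin> set_uprod (ends G e)" "ends G e = Upair x y"
      by (auto simp: adj_rel_def del_vert_def)
    then have xe: "x \<in> set_uprod (ends G e)" "y \<in> set_uprod (ends G e)" "y \<noteq> v" "x \<noteq> v" by auto
    have "e \<notin> E1" using xe xy(3) by blast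
    then have "e \<in> E2" using e E(1) by blast
    then have "x \<in> {v}" using xe xy(2) E(5) by blast
    then show False using xe by simp
  qed
next
  let ?D = "del_vert G v"
  assume nc: "\<not> connected ?D"
  have "verts G \<noteq> {v}" using G(3) by auto
  then have "verts ?D \<noteq> {}" using v by (auto simp: del_vert_def)
  then obtain a b where ab: "a \<in> verts G" "a \<noteq> v" "b \<in> verts G" "b \<noteq> v" "(a, b) \<notin> (adj_rel ?D)\<^sup>*"
    using nc by (auto simp: connected_def del_vert_def)
  define A where "A = {u. (a, u) \<in> (adj_rel ?D)\<^sup>*}"
  have closed: "y \<in> A" if "x \<in> A" "e \<in> edges G" "ends G e = Upair x y" "x \<noteq> v" "y \<noteq> v" for x y e
  proof -
    have "(x, y) \<in> adj_rel ?D" using that by (auto simp: adj_rel_def del_vert_def)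
    then show ?thesis using that(1) unfolding A_def by (auto intro: rtrancl_into_rtrancl)
  qed
  have vA: "v \<notin> A"
  proof
    assume "v \<in> A"
    then have "(a, v) \<in> (adj_rel ?D)\<^sup>*" by (simp add: A_def)
    moreover have "(u, v) \<notin> adj_rel ?D" for u by (auto simp: adj_rel_def del_vert_def)
    ultimately show False using ab(2) by (auto elim: rtranclE)
  qed
  have aA: "a \<in> A" and bA: "b \<notin> A" using ab by (auto simp: A_def)
  define E1 where "E1 = {e\<in>edges G. set_uprod (ends G e) \<inter> A \<noteq> {}}"
  define E2 where "E2 = edges G - E1"
  have leave: "x = v \<or> y = v" if "e \<in> edges G" "ends G e = Upair x y" "x \<in> A" "y \<notin> A" for e x y
    using closed[of x e y] that by blast
  have sub1: "set_uprod (ends G e) \<subseteq> insert v A" if "e \<in> E1" for e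
  proof -
    obtain x y where xy: "ends G e = Upair x y" by (rule uprod_ends)
    have yx: "ends G e = Upair y x" using xy by auto
    have e: "e \<in> edges G" and "x \<in> A \<or> y \<in> A" using that xy by (auto simp: E1_def)
    then have "x \<in> insert v A" "y \<in> insert v A"
      using leave[OF e xy] leave[OF e yx] vA by blast+
    then show ?thesis using xy by auto
  qed
  have v1: "\<exists>e\<in>E1. v \<in> set_uprod (ends G e)"
  proof -
    have "(a, v) \<in> (adj_rel G)\<^sup>*" using G(2) ab v by (auto simp: connected_def)
    then obtain x y where xy: "(x, y) \<in> adj_rel G" "x \<in> A" "y \<notin> A"
      using aA vA by (rule rtrancl_edge_leaving)
    then obtain e where e: "e \<in> edges G" "ends G e = Upair x y" by (auto simp: adj_rel_def)
    have "y = v" using leave[OF e xy(2,3)] xy vA by auto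
    then show ?thesis using e xy by (intro bexI[of _ e]) (auto simp: E1_def)
  qed
  have v2: "\<exists>e\<in>E2. v \<in> set_uprod (ends G e)"
  proof -
    let ?B = "- insert v A"
    have "(b, v) \<in> (adj_rel G)\<^sup>*" using G(2) ab v by (auto simp: connected_def)
    moreover have "b \<in> ?B" "v \<notin> ?B" using ab bA by auto
    ultimately obtain x y where xy: "(x, y) \<in> adj_rel G" "x \<in> ?B" "y \<notin> ?B"
      by (rule rtrancl_edge_leaving)
    then obtain e where e: "e \<in> edges G" "ends G e = Upair x y" by (auto simp: adj_rel_def)
    have eyx: "ends G e = Upair y x" using e by auto
    have "y = v" using leave[OF e(1) eyx] xy by auto
    then show ?thesis using e xy vA by (intro bexI[of _ e]) (auto simp: E1_def E2_def)
  qed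
  have "E1 \<union> E2 = edges G" "E1 \<inter> E2 = {}" "E1 \<noteq> {}" "E2 \<noteq> {}"
    using v1 v2 by (auto simp: E1_def E2_def)
  moreover have "(\<Union>e\<in>E1. set_uprod (ends G e)) \<inter> (\<Union>e\<in>E2. set_uprod (ends G e)) = {v}"
  proof
    show "{v} \<subseteq> (\<Union>e\<in>E1. set_uprod (ends G e)) \<inter> (\<Union>e\<in>E2. set_uprod (ends G e))"
      using v1 v2 by blast
    have "set_uprod (ends G e) \<inter> A = {}" if "e \<in> E2" for e
      using that by (auto simp: E1_def E2_def)
    then show "(\<Union>e\<in>E1. set_uprod (ends G e)) \<inter> (\<Union>e\<in>E2. set_uprod (ends G e)) \<subseteq> {v}"
      using sub1 by blast
  qed
  ultimately show "cut_vertex G v" unfolding cut_vertex_def by blast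
qed

end

theory Submission
  imports Defs
begin

text \<open>A 3-coloring is built as a base color, used at every vertex of odd degree that is not
  monochromatic, together with two disjoint edge sets \<open>A\<close> and \<open>B\<close>. If the number of 2-vertices is not
  one, then suitable sets are found by splitting a join of the 2-vertices, after removing two edges at
  one of them with the help of an st-ordering if their number is odd. So let \<open>c\<close> be the only 2-vertex,
  with neighbors \<open>p\<close> and \<open>q\<close>. Then four colors suffice. An st-ordering starting in \<open>c\<close> yields either an
  even cycle through \<open>c\<close>, hence a 3-coloring, or a bipartition of \<open>G - c + pq\<close>. If three colors do not
  suffice, then a 2-edge cut exhibits \<open>G\<close> as a gluing of two smaller such graphs. Without 2-edge cuts
  \<open>G - c + pq\<close> is cubic: contracting the sides of a nontrivial 3-edge cut gives two smaller graphs without a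
  3-coloring; if there are no such cuts, then a vertex of degree at least five and a cubic vertex
  lead to a 3-coloring by means of a flow between them, and if the only vertices that may be cubic are \<open>p\<close> and \<open>q\<close>, a
  path from \<open>p\<close> to \<open>q\<close> and its complement do. Conversely, counting the edges of each color modulo 3
  on both sides of the bipartition shows that three colors are not enough for the basic cubic members
  of the family, and gluing preserves this.\<close>

section \<open>Degrees, cuts and connected sets\<close>

text \<open>The base color carries no condition of its own: at a vertex of odd degree, two odd
  colors force the third to be odd. So a 3-coloring amounts to a set \<open>L\<close> with even
  degree at such vertices, split into two parts that are both odd at every vertex they reach. A
  split is a join inside each component of \<open>L\<close>, and its only obstruction is parity: the
  number of vertices asking for odd degree must be even. A 2-vertex at which \<open>L\<close> has
  degree one may give its edge to either part and thus removes the obstruction. With a single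
  2-vertex \<open>c\<close>, an \<open>L\<close> with even degrees everywhere has no such free
  vertex, and the order of its component around \<open>c\<close> decides. Hence the role of even
  cycles and bipartitions, and hence the later search for an \<open>L\<close> that ends in
  \<open>c\<close> and meets its second odd place at something exceptional, such as a monochromatic
  vertex or an edge of a cut. Degree three is special because its patterns 3+0+0 and 1+1+1 both
  consist of three numbers that agree modulo 3; degree five already allows 3+1+1 and escapes the
  count.\<close>

text \<open>Loops are counted once here, so this agrees with \<open>degree_on\<close> on loopless graphs only.\<close>

definition dg :: "('v, 'e) mgraph \<Rightarrow> 'e set \<Rightarrow> 'v \<Rightarrow> nat" where
  "dg G F v = card {e\<in>F. v \<in> set_uprod (ends G e)}"

definition adj :: "('v, 'e) mgraph \<Rightarrow> 'e set \<Rightarrow> 'v set \<Rightarrow> ('v \<times> 'v) set" where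
  "adj G F S = {(x, y). x \<in> S \<and> y \<in> S \<and> (\<exists>e\<in>F. ends G e = Upair x y)}"

definition conn :: "('v, 'e) mgraph \<Rightarrow> 'e set \<Rightarrow> 'v set \<Rightarrow> bool" where
  "conn G F S \<longleftrightarrow> (\<forall>x\<in>S. \<forall>y\<in>S. (x, y) \<in> (adj G F S)\<^sup>*)"

definition cut :: "('v, 'e) mgraph \<Rightarrow> 'e set \<Rightarrow> 'v set \<Rightarrow> 'e set" where
  "cut G F S = {e\<in>F. set_uprod (ends G e) \<inter> S \<noteq> {} \<and> \<not> set_uprod (ends G e) \<subseteq> S}"

definition inner :: "('v, 'e) mgraph \<Rightarrow> 'e set \<Rightarrow> 'v set \<Rightarrow> 'e set" where
  "inner G F S = {e\<in>F. set_uprod (ends G e) \<subseteq> S}"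

definition zero_or_odd :: "nat \<Rightarrow> bool" where
  "zero_or_odd n \<longleftrightarrow> n = 0 \<or> odd n"

text \<open>Colors are bounded rather than counted, so that a color class may be empty;
  \<open>colorable_iff_card\<close> makes the connection to the number of colors used.\<close>

definition colorable :: "nat \<Rightarrow> ('v, 'e) mgraph \<Rightarrow> bool" where
  "colorable k G \<longleftrightarrow> (\<exists>col :: 'e \<Rightarrow> nat. (\<forall>e\<in>edges G. col e < k) \<and>
     (\<forall>v\<in>verts G. \<forall>i. zero_or_odd (dg G {e\<in>edges G. col e = i} v)))"

lemma adj_mono: "F \<subseteq> F' \<Longrightarrow> S \<subseteq> S' \<Longrightarrow> adj G F S \<subseteq> adj G F' S'"
  by (auto simp: adj_def)

lemma adj_rtrancl_mono: "(x, y) \<in> (adj G F S)\<^sup>* \<Longrightarrow> F \<subseteq> F' \<Longrightarrow> S \<subseteq> S' \<Longrightarrow> (x, y) \<in> (adj G F' S')\<^sup>*"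
  using rtrancl_mono[OF adj_mono] by blast

lemma sym_adj: "sym (adj G F S)"
  by (auto simp: adj_def sym_def) (metis Upair_inject)+

lemma adj_rtrancl_sym: "(x, y) \<in> (adj G F S)\<^sup>* \<Longrightarrow> (y, x) \<in> (adj G F S)\<^sup>*"
  by (meson sym_adj sym_rtrancl symD)

lemma adj_rtrancl_in: "(x, y) \<in> (adj G F S)\<^sup>* \<Longrightarrow> x \<in> S \<Longrightarrow> y \<in> S"
  by (induction rule: rtrancl_induct) (auto simp: adj_def)

lemma adjI: "e \<in> F \<Longrightarrow> ends G e = Upair x y \<Longrightarrow> x \<in> S \<Longrightarrow> y \<in> S \<Longrightarrow> (x, y) \<in> adj G F S"
  by (auto simp: adj_def)

lemma adjI': "e \<in> F \<Longrightarrow> ends G e = Upair y x \<Longrightarrow> x \<in> S \<Longrightarrow> y \<in> S \<Longrightarrow> (x, y) \<in> adj G F S"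
  by (metis adjI sym_adj symD)

lemma conn_rootI: "r \<in> S \<Longrightarrow> (\<And>x. x \<in> S \<Longrightarrow> (x, r) \<in> (adj G F S)\<^sup>*) \<Longrightarrow> conn G F S"
  unfolding conn_def by (meson adj_rtrancl_sym rtrancl_trans)

lemma conn_mono: "conn G F S \<Longrightarrow> F \<subseteq> F' \<Longrightarrow> conn G F' S"
  unfolding conn_def by (meson adj_rtrancl_mono order_refl)

lemma conn_insert:
  assumes "conn G F S" "x \<in> S" "e \<in> F" "ends G e = Upair x y"
  shows "conn G F (insert y S)"
proof (rule conn_rootI[of x])
  show "x \<in> insert y S" using assms by simp
  fix z assume "z \<in> insert y S"
  moreover have "(y, x) \<in> adj G F (insert y S)"
    using assms by (auto simp: adj_def) (metis Upair_inject)
  moreover have "(z, x) \<in> (adj G F (insert y S))\<^sup>*" if "z \<in> S"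
    using assms(1,2) that adj_rtrancl_mono[of z x G F S F "insert y S"] unfolding conn_def by blast
  ultimately show "(z, x) \<in> (adj G F (insert y S))\<^sup>*" by blast
qed

lemma conn_singleton: "conn G F {x}"
  by (auto simp: conn_def)

lemma conn_Un:
  assumes "conn G F S" "conn G F S'" "x \<in> S" "x \<in> S'"
  shows "conn G F (S \<union> S')"
proof (rule conn_rootI[of x])
  show "x \<in> S \<union> S'" using assms by simp
  fix z assume "z \<in> S \<union> S'"
  then have "(z, x) \<in> (adj G F S)\<^sup>* \<or> (z, x) \<in> (adj G F S')\<^sup>*"
    using assms unfolding conn_def by blast
  then show "(z, x) \<in> (adj G F (S \<union> S'))\<^sup>*"
    using adj_rtrancl_mono[of z x G F _ F "S \<union> S'"] by blast
qed

lemma conn_Un_edge: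
  assumes "conn G F S" "conn G F S'" "x \<in> S" "y \<in> S'" "e \<in> F" "ends G e = Upair x y"
  shows "conn G F (S \<union> S')"
proof -
  have "conn G F (insert y S)" using conn_insert[OF assms(1,3,5,6)] .
  then have "conn G F (insert y S \<union> S')" using assms by (intro conn_Un[of _ _ _ _ y]) auto
  then show ?thesis using assms by (simp add: insert_absorb)
qed

lemma reach_conn: "conn G F {x. (r, x) \<in> (adj G F S)\<^sup>*}"
proof (rule conn_rootI[of r])
  let ?K = "{x. (r, x) \<in> (adj G F S)\<^sup>*}"
  show "r \<in> ?K" by simp
  fix x assume "x \<in> ?K"
  then have "(r, x) \<in> (adj G F S)\<^sup>*" by simp
  then have "(r, x) \<in> (adj G F ?K)\<^sup>*"
  proof (induction rule: rtrancl_induct)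
    case (step y z)
    then have "(y, z) \<in> adj G F ?K" unfolding adj_def
      using rtrancl_into_rtrancl[OF step(1,2)] by (auto simp: adj_def)
    then show ?case using step by simp
  qed simp
  then show "(x, r) \<in> (adj G F ?K)\<^sup>*" by (rule adj_rtrancl_sym)
qed

text \<open>The vertices of \<open>S'\<close> need not be images; each only has to be linked to one.\<close>

lemma conn_image:
  assumes "conn G F S"
    and step: "\<And>x y e. x \<in> S \<Longrightarrow> y \<in> S \<Longrightarrow> e \<in> F \<Longrightarrow> ends G e = Upair x y \<Longrightarrow> (h x, h y) \<in> (adj G' F' S')\<^sup>*"
    and img: "\<And>z. z \<in> S' \<Longrightarrow> \<exists>x\<in>S. (z, h x) \<in> (adj G' F' S')\<^sup>*"
  shows "conn G' F' S'"
proof -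
  have *: "(h x, h y) \<in> (adj G' F' S')\<^sup>*" if "(x, y) \<in> (adj G F S)\<^sup>*" for x y
    using that
  proof (induction rule: rtrancl_induct)
    case (step y z)
    then show ?case using assms(2)[of y z] by (auto simp: adj_def intro: rtrancl_trans)
  qed simp
  show ?thesis unfolding conn_def
  proof (intro ballI)
    fix z w assume "z \<in> S'" "w \<in> S'"
    then obtain x y where "x \<in> S" "(z, h x) \<in> (adj G' F' S')\<^sup>*" "y \<in> S" "(w, h y) \<in> (adj G' F' S')\<^sup>*"
      using img by blast
    moreover have "(h x, h y) \<in> (adj G' F' S')\<^sup>*" using * assms(1) calculation unfolding conn_def by blast
    ultimately show "(z, w) \<in> (adj G' F' S')\<^sup>*" by (meson adj_rtrancl_sym rtrancl_trans)
  qed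
qed

lemma rtrancl_leaves:
  assumes "(x, y) \<in> (adj G F S)\<^sup>*" "x \<in> K" "y \<notin> K"
  obtains e a b where "e \<in> F" "ends G e = Upair a b" "a \<in> K" "b \<notin> K" "a \<in> S" "b \<in> S"
  using rtrancl_edge_leaving[OF assms] unfolding adj_def by blast

lemma cut_iff: "ends G e = Upair x y \<Longrightarrow> e \<in> cut G F S \<longleftrightarrow> e \<in> F \<and> (x \<in> S) \<noteq> (y \<in> S)"
  by (auto simp: cut_def)

lemma cutE:
  assumes "e \<in> cut G F S"
  obtains x y where "e \<in> F" "ends G e = Upair x y" "x \<in> S" "y \<notin> S"
proof -
  obtain x y where xy: "ends G e = Upair x y" by (rule uprod_ends)
  then have yx: "ends G e = Upair y x" by auto
  have "e \<in> F" "(x \<in> S) \<noteq> (y \<in> S)" using assms cut_iff[OF xy] by auto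
  then show ?thesis using that xy yx by (cases "x \<in> S") auto
qed

lemma conn_cut:
  assumes "conn G F S" "K \<subseteq> S" "K \<noteq> {}" "K \<noteq> S"
  obtains e x y where "e \<in> F" "ends G e = Upair x y" "x \<in> K" "y \<in> S - K"
proof -
  obtain a b where "a \<in> K" "b \<in> S" "b \<notin> K" using assms by blast
  then have "(a, b) \<in> (adj G F S)\<^sup>*" using assms unfolding conn_def by blast
  then show ?thesis using \<open>a \<in> K\<close> \<open>b \<notin> K\<close> by (rule rtrancl_leaves) (use that in blast)
qed

section \<open>Degrees, handshaking and joins in loopless graphs\<close>

locale lgraph =
  fixes G :: "('v, 'e) mgraph"
  assumes multigraph: "multigraph G" and loopless: "loopless G"
begin

abbreviation "V \<equiv> verts G"
abbreviation "E \<equiv> edges G"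

lemma finite_V [simp]: "finite V" and finite_E [simp]: "finite E"
  using multigraph by (auto simp: multigraph_def)

lemma finite_sub [intro]: "F \<subseteq> E \<Longrightarrow> finite F"
  using finite_E finite_subset by blast

lemma ends_cases:
  assumes "e \<in> E"
  obtains x y where "ends G e = Upair x y" "x \<noteq> y" "x \<in> V" "y \<in> V"
proof -
  obtain x y where xy: "ends G e = Upair x y" by (rule uprod_ends)
  moreover have "x \<noteq> y" using xy loopless assms unfolding loopless_def by blast
  moreover have "x \<in> V" "y \<in> V" using xy multigraph assms by (auto simp: multigraph_def)
  ultimately show ?thesis using that by blast
qed

lemma ends_in_V: "e \<in> E \<Longrightarrow> ends G e = Upair x y \<Longrightarrow> x \<in> V \<and> y \<in> V \<and> x \<noteq> y"
  by (erule ends_cases) auto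

lemma dg_empty [simp]: "dg G {} v = 0" by (simp add: dg_def)

lemma dg_Un: "A \<subseteq> E \<Longrightarrow> B \<subseteq> E \<Longrightarrow> A \<inter> B = {} \<Longrightarrow> dg G (A \<union> B) v = dg G A v + dg G B v"
proof -
  assume A: "A \<subseteq> E" "B \<subseteq> E" "A \<inter> B = {}"
  have "{e\<in>A \<union> B. v \<in> set_uprod (ends G e)} = {e\<in>A. v \<in> set_uprod (ends G e)} \<union> {e\<in>B. v \<in> set_uprod (ends G e)}" by auto
  moreover have "finite A" "finite B" using A by auto
  ultimately show ?thesis unfolding dg_def using A by (subst card_Un_disjoint[symmetric]) auto
qed

lemma dg_insert: "A \<subseteq> E \<Longrightarrow> e \<in> E \<Longrightarrow> e \<notin> A \<Longrightarrow> 
  dg G (insert e A) v = dg G A v + of_bool (v \<in> set_uprod (ends G e))"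
proof -
  assume A: "A \<subseteq> E" "e \<in> E" "e \<notin> A"
  have "dg G ({e} \<union> A) v = dg G {e} v + dg G A v" using A by (intro dg_Un) auto
  moreover have "dg G {e} v = of_bool (v \<in> set_uprod (ends G e))"
  proof -
    have "{e' \<in> {e}. v \<in> set_uprod (ends G e')} = (if v \<in> set_uprod (ends G e) then {e} else {})" by auto
    then show ?thesis by (simp add: dg_def)
  qed
  ultimately show ?thesis by simp
qed

lemma dg_Diff: "A \<subseteq> F \<Longrightarrow> F \<subseteq> E \<Longrightarrow> dg G F v = dg G (F - A) v + dg G A v"
proof -
  assume A: "A \<subseteq> F" "F \<subseteq> E"
  then have "(F - A) \<union> A = F" by blast
  then show ?thesis using dg_Un[of "F - A" A v] A by auto
qed

lemma dg_mono: "A \<subseteq> F \<Longrightarrow> F \<subseteq> E \<Longrightarrow> dg G A v \<le> dg G F v"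
  using dg_Diff by (metis le_add2)

lemma dg_zero_iff: "F \<subseteq> E \<Longrightarrow> dg G F v = 0 \<longleftrightarrow> (\<forall>e\<in>F. v \<notin> set_uprod (ends G e))"
  unfolding dg_def using finite_sub[of F] by auto

lemma dg_inner: "v \<notin> S \<Longrightarrow> dg G (inner G F S) v = 0"
proof -
  assume "v \<notin> S"
  then have *: "{e\<in>inner G F S. v \<in> set_uprod (ends G e)} = {}" by (auto simp: inner_def)
  show ?thesis unfolding dg_def * by simp
qed

lemma dg_sym_diff:
  assumes "A \<subseteq> E" "B \<subseteq> E"
  shows "even (dg G ((A - B) \<union> (B - A)) v) \<longleftrightarrow> (even (dg G A v) \<longleftrightarrow> even (dg G B v))"
proof -
  have "dg G ((A - B) \<union> (B - A)) v = dg G (A - B) v + dg G (B - A) v"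
    using assms by (intro dg_Un) auto
  moreover have "dg G A v = dg G (A - B) v + dg G (A \<inter> B) v"
  proof -
    have "(A - B) \<union> (A \<inter> B) = A" by blast
    then show ?thesis using dg_Un[of "A - B" "A \<inter> B" v] assms by auto
  qed
  moreover have "dg G B v = dg G (B - A) v + dg G (A \<inter> B) v"
  proof -
    have "(B - A) \<union> (A \<inter> B) = B" by blast
    then show ?thesis using dg_Un[of "B - A" "A \<inter> B" v] assms by auto
  qed
  ultimately show ?thesis by auto
qed

lemma degree_eq_dg: "degree G v = dg G E v"
proof -
  have "{e\<in>E. ends G e = Upair v v} = {}" using loopless by (auto simp: loopless_def)
  then show ?thesis unfolding degree_def degree_on_def dg_def by simp
qed

text \<open>An edge inside \<open>S\<close> contributes two to the sum and an edge of the cut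
  contributes one.\<close>

lemma handshake:
  assumes "F \<subseteq> E" "finite S"
  shows "even (\<Sum>v\<in>S. dg G F v) \<longleftrightarrow> even (card (cut G F S))"
proof -
  have "finite F" using assms by auto
  then show ?thesis using assms(1)
  proof (induction F rule: finite_induct)
    case empty
    then show ?case by (simp add: cut_def)
  next
    case (insert e F)
    then have "e \<in> E" by simp
    then obtain x y where xy: "ends G e = Upair x y" "x \<noteq> y" by (rule ends_cases)
    have s: "(\<Sum>v\<in>S. dg G (insert e F) v) = (\<Sum>v\<in>S. dg G F v) + (\<Sum>v\<in>S. of_bool (v \<in> set_uprod (ends G e)))"
      using insert by (simp add: dg_insert sum.distrib)
    have "(\<Sum>v\<in>S. of_bool (v \<in> set_uprod (ends G e)) :: nat) = card (S \<inter> {x, y})"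
      using assms(2) xy by (simp add: sum.If_cases of_bool_def Int_def)
    also have "\<dots> = of_bool (x \<in> S) + of_bool (y \<in> S)" using xy by (auto simp: Int_insert_right)
    finally have s2: "(\<Sum>v\<in>S. of_bool (v \<in> set_uprod (ends G e)) :: nat) = of_bool (x \<in> S) + of_bool (y \<in> S)" .
    have "cut G (insert e F) S = (if (x \<in> S) \<noteq> (y \<in> S) then insert e (cut G F S) else cut G F S)"
      using xy by (auto simp: cut_def)
    moreover have "e \<notin> cut G F S" "finite (cut G F S)" using insert by (auto simp: cut_def)
    ultimately have "card (cut G (insert e F) S) = card (cut G F S) + of_bool ((x \<in> S) \<noteq> (y \<in> S))" by simp
    then show ?case using s s2 insert by auto
  qed
qed

lemma handshake_all: "F \<subseteq> E \<Longrightarrow> finite S \<Longrightarrow> \<forall>e\<in>F. set_uprod (ends G e) \<subseteq> S \<Longrightarrow> even (\<Sum>v\<in>S. dg G F v)"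
proof -
  assume a: "F \<subseteq> E" "finite S" "\<forall>e\<in>F. set_uprod (ends G e) \<subseteq> S"
  then have "cut G F S = {}" by (fastforce simp: cut_def)
  then show ?thesis using handshake[OF a(1,2)] by simp
qed

text \<open>The edges of a walk are toggled one after the other, so an edge passed twice drops out
  again and only the two ends change parity.\<close>

lemma path_join:
  assumes "(x, y) \<in> (adj G F S)\<^sup>*" "F \<subseteq> E"
  shows "\<exists>A\<subseteq>inner G F S. \<forall>v. odd (dg G A v) \<longleftrightarrow> ((v = x) \<noteq> (v = y))"
  using assms(1)
proof (induction rule: rtrancl_induct)
  case base
  then show ?case by (intro exI[of _ "{}"]) auto
next
  case (step y z)
  then obtain A where A: "A \<subseteq> inner G F S" "\<forall>v. odd (dg G A v) \<longleftrightarrow> ((v = x) \<noteq> (v = y))" by blast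
  obtain e where e: "e \<in> F" "ends G e = Upair y z" "y \<in> S" "z \<in> S" using step(2) by (auto simp: adj_def)
  have yz: "y \<noteq> z" using ends_in_V[of e y z] e assms by auto
  let ?B = "(A - {e}) \<union> ({e} - A)"
  have AE: "A \<subseteq> E" "{e} \<subseteq> E" using A assms e by (auto simp: inner_def)
  have "dg G {e} v = of_bool (v = y \<or> v = z)" for v
    using dg_insert[of "{}" e v] e assms by auto
  then have "odd (dg G ?B v) \<longleftrightarrow> ((v = x) \<noteq> (v = z))" for v
    using dg_sym_diff[OF AE, of v] A(2) yz by auto
  moreover have "?B \<subseteq> inner G F S" using A e by (auto simp: inner_def)
  ultimately show ?case by blast
qed

text \<open>Each vertex of \<open>\<tau>\<close> is toggled along a walk to \<open>Fr\<close>.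
  Parities on \<open>Fr\<close> are left open, so no condition on the size of \<open>\<tau>\<close>
  arises; this is how a 2-vertex met by only one edge absorbs the parity.\<close>

lemma join_free:
  assumes "finite \<tau>" "\<forall>v\<in>\<tau>. \<exists>x\<in>Fr. (v, x) \<in> (adj G F S)\<^sup>*" "\<tau> \<inter> Fr = {}" "F \<subseteq> E"
  shows "\<exists>A\<subseteq>inner G F S. \<forall>v. v \<notin> Fr \<longrightarrow> (odd (dg G A v) \<longleftrightarrow> v \<in> \<tau>)"
  using assms(1,2,3)
proof (induction \<tau> rule: finite_induct)
  case empty
  then show ?case by (intro exI[of _ "{}"]) auto
next
  case (insert t \<tau>)
  then obtain A where A: "A \<subseteq> inner G F S" "\<forall>v. v \<notin> Fr \<longrightarrow> (odd (dg G A v) \<longleftrightarrow> v \<in> \<tau>)" by auto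
  obtain x where x: "x \<in> Fr" "(t, x) \<in> (adj G F S)\<^sup>*" using insert by auto
  obtain B where B: "B \<subseteq> inner G F S" "\<forall>v. odd (dg G B v) \<longleftrightarrow> ((v = t) \<noteq> (v = x))"
    using path_join[OF x(2) assms(4)] by blast
  have "inner G F S \<subseteq> E" using assms(4) by (auto simp: inner_def)
  then have AB: "A \<subseteq> E" "B \<subseteq> E" using A B by auto
  have "odd (dg G ((A - B) \<union> (B - A)) v) \<longleftrightarrow> v \<in> insert t \<tau>" if "v \<notin> Fr" for v
    using dg_sym_diff[OF AB, of v] A(2) B(2) that insert(2) x(1) by auto
  moreover have "(A - B) \<union> (B - A) \<subseteq> inner G F S" using A B by blast
  ultimately show ?case by blast
qed

text \<open>The component of \<open>x\<close> in \<open>L\<close> has no boundary, so by handshaking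
  it contains an even number of vertices of odd \<open>L\<close>-degree.\<close>

lemma comp_meets:
  assumes "L \<subseteq> E" "odd (dg G L x)" "x \<in> V"
  shows "\<exists>y. y \<noteq> x \<and> odd (dg G L y) \<and> (x, y) \<in> (adj G L V)\<^sup>*"
proof (rule ccontr)
  assume n: "\<not> ?thesis"
  define K where "K = {y. (x, y) \<in> (adj G L V)\<^sup>*}"
  have K: "K \<subseteq> V" using adj_rtrancl_in[of x _ G L V] assms(3) by (auto simp: K_def)
  then have fK: "finite K" by (rule finite_subset) simp
  have "cut G L K = {}"
  proof -
    have "b \<in> K" if "e \<in> L" "ends G e = Upair a b" "a \<in> K" for e a b
    proof -
      have "(a, b) \<in> adj G L V" using that assms(1) ends_in_V[of e a b] by (auto simp: adj_def)
      then show ?thesis using that(3) by (auto simp: K_def)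
    qed
    then show ?thesis by (metis cutE equals0I)
  qed
  then have "even (\<Sum>v\<in>K. dg G L v)" using handshake[OF assms(1) fK] by simp
  moreover have "x \<in> K" by (simp add: K_def)
  moreover have "(\<Sum>v\<in>K. dg G L v) = dg G L x + (\<Sum>v\<in>K - {x}. dg G L v)"
    using fK \<open>x \<in> K\<close> by (rule sum.remove)
  moreover have "even (\<Sum>v\<in>K - {x}. dg G L v)"
    using n by (intro dvd_sum) (auto simp: K_def)
  ultimately show False using assms(2) by simp
qed

lemma even_sum_odd_card:
  assumes "finite S" "\<forall>v\<in>S. odd (f v)"
  shows "even (\<Sum>v\<in>S. f v :: nat) \<longleftrightarrow> even (card S)"
  using assms by (induction S rule: finite_induct) auto

lemma colorableI:
  assumes "A \<subseteq> E" "B \<subseteq> E" "A \<inter> B = {}"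
    and "\<And>v. v \<in> V \<Longrightarrow> zero_or_odd (dg G A v) \<and> zero_or_odd (dg G B v) \<and> zero_or_odd (dg G (E - A - B) v)"
  shows "colorable 3 G"
proof -
  define col where "col e = (if e \<in> A then 0 else if e \<in> B then 1 else 2 :: nat)" for e
  have "{e\<in>E. col e = i} = (if i = 0 then A else if i = 1 then B else if i = 2 then E - A - B else {})" for i
    using assms(1-3) by (auto simp: col_def)
  then have "\<forall>v\<in>V. \<forall>i. zero_or_odd (dg G {e\<in>E. col e = i} v)"
    using assms(4) by (simp add: zero_or_odd_def)
  moreover have "\<forall>e\<in>E. col e < 3" by (simp add: col_def)
  ultimately show ?thesis unfolding colorable_def by blast
qed

text \<open>The base color takes \<open>E - A - B\<close>; a vertex without this color must be monochromatic.\<close>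

lemma colorable_base:
  assumes "A \<subseteq> E" "B \<subseteq> E" "A \<inter> B = {}"
    and "\<And>v. v \<in> V \<Longrightarrow> (odd (dg G E v) \<and> dg G A v = 0 \<and> dg G B v = 0) \<or>
       (odd (dg G E v) \<and> odd (dg G A v) \<and> odd (dg G B v)) \<or>
       (odd (dg G E v) \<and> dg G A v = dg G E v) \<or>
       (dg G E v = 2 \<and> dg G A v + dg G B v = 1) \<or>
       (dg G E v = 2 \<and> odd (dg G A v) \<and> odd (dg G B v))"
  shows "colorable 3 G"
proof (rule colorableI[OF assms(1-3)])
  fix v assume v: "v \<in> V"
  have "A \<union> B \<subseteq> E" using assms by auto
  then have "dg G E v = dg G (E - (A \<union> B)) v + dg G (A \<union> B) v" by (intro dg_Diff) auto
  moreover have "dg G (A \<union> B) v = dg G A v + dg G B v" using assms by (intro dg_Un)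
  moreover have "E - (A \<union> B) = E - A - B" by auto
  ultimately have d: "dg G E v = dg G (E - A - B) v + dg G A v + dg G B v" by simp
  show "zero_or_odd (dg G A v) \<and> zero_or_odd (dg G B v) \<and> zero_or_odd (dg G (E - A - B) v)"
    using assms(4)[OF v]
  proof (elim disjE conjE)
    assume "dg G E v = 2" "dg G A v + dg G B v = 1"
    then have "dg G (E - A - B) v = 1" "dg G A v \<le> 1" "dg G B v \<le> 1" using d by auto
    then show ?thesis by (auto simp: zero_or_odd_def le_Suc_eq)
  next
    assume "dg G E v = 2" "odd (dg G A v)" "odd (dg G B v)"
    then have "dg G A v \<ge> 1" "dg G B v \<ge> 1" by (auto intro: Suc_leI odd_pos)
    then have "dg G (E - A - B) v = 0" using d \<open>dg G E v = 2\<close> by linarith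
    then show ?thesis using \<open>odd (dg G A v)\<close> \<open>odd (dg G B v)\<close> by (simp add: zero_or_odd_def)
  next
    assume "odd (dg G E v)" "dg G A v = 0" "dg G B v = 0"
    then show ?thesis using d by (simp add: zero_or_odd_def)
  next
    assume o: "odd (dg G E v)" "odd (dg G A v)" "odd (dg G B v)"
    then have "odd (dg G (E - A - B) v)" unfolding d by simp
    then show ?thesis using o by (simp add: zero_or_odd_def)
  next
    assume o: "odd (dg G E v)" "dg G A v = dg G E v"
    then have "dg G (E - A - B) v = 0" "dg G B v = 0" using d by linarith+
    then show ?thesis using o by (simp add: zero_or_odd_def)
  qed
qed

end

section \<open>Paths, joins and st-orderings\<close>

text \<open>Only the vertices are recorded, so parallel edges need no choice;
  \<open>pth_edges\<close> picks the edges when degrees matter.\<close>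

definition pth :: "('v, 'e) mgraph \<Rightarrow> 'e set \<Rightarrow> 'v set \<Rightarrow> 'v list \<Rightarrow> bool" where
  "pth G F S xs \<longleftrightarrow> xs \<noteq> [] \<and> distinct xs \<and> set xs \<subseteq> S \<and>
     successively (\<lambda>x y. \<exists>e\<in>F. ends G e = Upair x y) xs"

lemma pth_mono: "pth G F S xs \<Longrightarrow> F \<subseteq> F' \<Longrightarrow> set xs \<subseteq> S' \<Longrightarrow> pth G F' S' xs"
  unfolding pth_def by (auto elim!: successively_mono)

lemma pth_take: "pth G F S (xs @ y # ys) \<Longrightarrow> pth G F S (xs @ [y])"
  unfolding pth_def by (auto simp: successively_append_iff)

lemma pth_drop: "pth G F S (xs @ y # ys) \<Longrightarrow> pth G F S (y # ys)"
  unfolding pth_def by (auto simp: successively_append_iff)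

lemma pth_append:
  assumes "pth G F S xs" "pth G F S ys" "set xs \<inter> set ys = {}"
    "e \<in> F" "ends G e = Upair (last xs) (hd ys)"
  shows "pth G F S (xs @ ys)"
  using assms unfolding pth_def by (auto simp: successively_append_iff)

lemma rtrancl_distinct_path:
  assumes "(x, y) \<in> r\<^sup>*"
  shows "\<exists>xs. xs \<noteq> [] \<and> distinct xs \<and> hd xs = x \<and> last xs = y \<and> successively (\<lambda>a b. (a, b) \<in> r) xs"
  using assms
proof (induction rule: rtrancl_induct)
  case base
  then show ?case by (intro exI[of _ "[x]"]) auto
next
  case (step y z)
  then obtain xs where xs: "xs \<noteq> []" "distinct xs" "hd xs = x" "last xs = y" "successively (\<lambda>a b. (a, b) \<in> r) xs" by blast
  show ?case
  proof (cases "z \<in> set xs")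
    case True
    then obtain as bs where s: "xs = as @ z # bs" by (meson split_list)
    have "hd (as @ [z]) = x" using s xs(3) by (cases as) auto
    moreover have "distinct (as @ [z])" "successively (\<lambda>a b. (a, b) \<in> r) (as @ [z])"
      using xs s by (auto simp: successively_append_iff)
    ultimately show ?thesis by (intro exI[of _ "as @ [z]"]) auto
  next
    case False
    then show ?thesis using xs step(2) by (intro exI[of _ "xs @ [z]"]) (auto simp: successively_append_iff)
  qed
qed

lemma ex_pth:
  assumes "(x, y) \<in> (adj G F S)\<^sup>*" "x \<in> S"
  shows "\<exists>xs. pth G F S xs \<and> hd xs = x \<and> last xs = y"
proof -
  obtain xs where xs: "xs \<noteq> []" "distinct xs" "hd xs = x" "last xs = y" "successively (\<lambda>a b. (a, b) \<in> adj G F S) xs"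
    using rtrancl_distinct_path[OF assms(1)] by blast
  have "set ys \<subseteq> S" if "successively (\<lambda>a b. (a, b) \<in> adj G F S) ys" "ys \<noteq> []" "hd ys \<in> S" for ys
    using that by (induction ys rule: induct_list012) (auto simp: adj_def)
  moreover have "successively (\<lambda>a b. \<exists>e\<in>F. ends G e = Upair a b) xs"
    using xs(5) by (rule successively_mono) (auto simp: adj_def)
  ultimately have "pth G F S xs" using xs assms(2) by (simp add: pth_def)
  then show ?thesis using xs(3,4) by blast
qed

lemma conn_pth: "conn G F S \<Longrightarrow> x \<in> S \<Longrightarrow> y \<in> S \<Longrightarrow> \<exists>xs. pth G F S xs \<and> hd xs = x \<and> last xs = y"
  using ex_pth unfolding conn_def by metis

lemma even_sum_iff_card: "finite S \<Longrightarrow> even (\<Sum>v\<in>S. f v :: nat) \<longleftrightarrow> even (card {v\<in>S. odd (f v)})"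
proof (induction S rule: finite_induct)
  case (insert x S)
  have "{v \<in> insert x S. odd (f v)} = (if odd (f x) then insert x {v\<in>S. odd (f v)} else {v\<in>S. odd (f v)})" by auto
  moreover have "x \<notin> {v\<in>S. odd (f v)}" using insert by auto
  ultimately show ?case using insert by (auto simp: card_insert_if)
qed simp

context lgraph
begin

text \<open>The degrees are given by one equation without subtraction, which also covers a path with
  a single vertex: there both ends coincide and \<open>P\<close> is empty.\<close>

lemma pth_edges:
  assumes "pth G F S xs" "F \<subseteq> E"
  shows "\<exists>P\<subseteq>inner G F (set xs). conn G P (set xs) \<and>
    (\<forall>v. dg G P v + of_bool (v = hd xs) + of_bool (v = last xs) = 2 * of_bool (v \<in> set xs))"
  using assms(1)
proof (induction xs rule: induct_list012)
  case 1
  then show ?case by (simp add: pth_def)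
next
  case (2 x)
  show ?case by (intro exI[of _ "{}"]) (auto simp: conn_singleton)
next
  case (3 x y zs)
  have p: "pth G F S (y # zs)" using 3 pth_drop[of G F S "[x]" y zs] by simp
  obtain P where P: "P \<subseteq> inner G F (set (y # zs))" "conn G P (set (y # zs))"
    "\<And>v. dg G P v + of_bool (v = y) + of_bool (v = last (y # zs)) = 2 * of_bool (v \<in> set (y # zs))"
    using 3(2)[OF p] by auto
  obtain e where e: "e \<in> F" "ends G e = Upair x y" "x \<notin> set (y # zs)" using 3 by (auto simp: pth_def)
  have eP: "e \<notin> P" using P(1) e by (auto simp: inner_def)
  have PE: "P \<subseteq> E" "e \<in> E" using P(1) e assms by (auto simp: inner_def)
  have "dg G (insert e P) v + of_bool (v = hd (x # y # zs)) + of_bool (v = last (x # y # zs))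
    = 2 * of_bool (v \<in> set (x # y # zs))" for v
    unfolding dg_insert[OF PE eP] using P(3)[of v] e by (auto simp del: last.simps simp: last_ConsR)
  moreover have "conn G (insert e P) (set (x # y # zs))"
    using conn_insert[of G "insert e P" "set (y # zs)" y e x] P(2) e conn_mono[of G P "set (y # zs)" "insert e P"]
    by (auto simp: insert_commute Upair_inject)
  moreover have "insert e P \<subseteq> inner G F (set (x # y # zs))" using P(1) e by (auto simp: inner_def)
  ultimately show ?case by blast
qed

text \<open>One vertex \<open>r\<close> of \<open>T\<close> is declared free and all others are
  served by \<open>join_free\<close>; the parity at \<open>r\<close> is then forced, since
  \<open>S\<close> contains an even number of vertices of odd degree.\<close>

lemma tjoin:
  assumes "conn G F S" "F \<subseteq> E" "S \<subseteq> V" "T \<subseteq> S" "even (card T)"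
  shows "\<exists>A\<subseteq>inner G F S. \<forall>v. odd (dg G A v) \<longleftrightarrow> v \<in> T"
proof (cases "T = {}")
  case True
  then show ?thesis by (intro exI[of _ "{}"]) auto
next
  case False
  then obtain r where r: "r \<in> T" by blast
  have fS: "finite S" using assms(3) finite_V by (rule finite_subset)
  then have fT: "finite T" using assms(4) finite_subset by auto
  have "\<exists>A\<subseteq>inner G F S. \<forall>v. v \<notin> {r} \<longrightarrow> (odd (dg G A v) \<longleftrightarrow> v \<in> T - {r})"
  proof (intro join_free)
    show "\<forall>v\<in>T - {r}. \<exists>x\<in>{r}. (v, x) \<in> (adj G F S)\<^sup>*"
      using assms(1,4) r unfolding conn_def by blast
  qed (use fT assms(2) in auto)
  then obtain A where A: "A \<subseteq> inner G F S" "\<And>v. v \<noteq> r \<Longrightarrow> odd (dg G A v) \<longleftrightarrow> v \<in> T - {r}" by auto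
  have AE: "A \<subseteq> E" using A(1) assms(2) by (auto simp: inner_def)
  have "\<forall>e\<in>A. set_uprod (ends G e) \<subseteq> S" using A(1) by (auto simp: inner_def)
  then have ev: "even (card {v\<in>S. odd (dg G A v)})"
    using handshake_all[OF AE fS] even_sum_iff_card[OF fS] by blast
  have "odd (dg G A r)"
  proof (rule ccontr)
    assume "\<not> odd (dg G A r)"
    then have "odd (dg G A v) \<longleftrightarrow> v \<in> T - {r}" for v using A(2)[of v] by (cases "v = r") auto
    then have "{v\<in>S. odd (dg G A v)} = T - {r}" using assms(4) by auto
    moreover have "odd (card (T - {r}))" using assms(5) card_Suc_Diff1[OF fT r] by (metis even_Suc)
    ultimately show False using ev by simp
  qed
  then show ?thesis using A r by (metis DiffD1 DiffI singletonD)
qed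

end

text \<open>2-connectedness in the form in which it is used; \<open>tgraph_iff\<close> shows that it
  agrees with \<open>two_connected\<close>. Connectedness of the whole graph follows because any two
  vertices avoid some third one.\<close>

locale tgraph = lgraph +
  assumes card_V: "card V \<ge> 3" and del_conn: "v \<in> V \<Longrightarrow> conn G E (V - {v})"
begin

lemma other_vertex: "\<exists>v\<in>V. v \<noteq> x \<and> v \<noteq> y"
proof (rule ccontr)
  assume "\<not> ?thesis"
  then have "V \<subseteq> {x, y}" by blast
  then have "card V \<le> card {x, y}" by (intro card_mono) auto
  also have "\<dots> \<le> 2" by (auto simp: card_insert_if)
  finally show False using card_V by simp
qed

lemma conn_V: "conn G E V"
  unfolding conn_def
proof (intro ballI)
  fix x y assume "x \<in> V" "y \<in> V"
  obtain v where "v \<in> V" "v \<noteq> x" "v \<noteq> y" using other_vertex[of x y] by blast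
  then have "(x, y) \<in> (adj G E (V - {v}))\<^sup>*" using del_conn \<open>x \<in> V\<close> \<open>y \<in> V\<close> unfolding conn_def by blast
  then show "(x, y) \<in> (adj G E V)\<^sup>*" by (rule adj_rtrancl_mono) auto
qed

text \<open>Among the vertices next to \<open>X\<close>, the one whose removal leaves the largest component around
  \<open>t\<close> leaves nothing else: another component would contain a better choice.\<close>

lemma grow:
  assumes X: "X \<subseteq> V" "X \<noteq> {}" and t: "t \<in> V - X" and Y: "conn G E (V - X)" "V - X \<noteq> {t}"
  shows "\<exists>v\<in>V - X - {t}. (\<exists>e\<in>E. \<exists>x\<in>X. ends G e = Upair x v) \<and> conn G E (V - X - {v})"
proof -
  let ?Y = "V - X"
  define cand where "cand v \<longleftrightarrow> v \<in> ?Y - {t} \<and> (\<exists>e\<in>E. \<exists>x\<in>X. ends G e = Upair x v)" for v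
  define K where "K v = {z. (t, z) \<in> (adj G E (?Y - {v}))\<^sup>*}" for v
  have KY: "K v \<subseteq> ?Y - {v}" if "cand v" for v
    using adj_rtrancl_in[of t _ G E "?Y - {v}"] that t unfolding K_def cand_def by blast
  have "conn G E (V - {t})" using t del_conn by auto
  moreover have "X \<subseteq> V - {t}" "X \<noteq> {}" "X \<noteq> V - {t}" using X t Y by auto
  ultimately obtain e x y where "e \<in> E" "ends G e = Upair x y" "x \<in> X" "y \<in> V - {t} - X"
    by (rule conn_cut)
  then have "cand y" by (auto simp: cand_def)
  moreover have "card (K v) < Suc (card V)" if "cand v" for v
  proof -
    have "K v \<subseteq> V" using KY[OF that] by blast
    then show ?thesis using card_mono[of V "K v"] by simp
  qed
  ultimately obtain v where v: "cand v" "\<And>w. cand w \<Longrightarrow> card (K w) \<le> card (K v)"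
    using ex_has_greatest_nat[of cand y "\<lambda>v. card (K v)" "Suc (card V)"] by (auto simp: less_Suc_eq_le)
  have vY: "v \<in> ?Y" "v \<noteq> t" using v(1) by (auto simp: cand_def)
  have tK: "t \<in> K v" by (simp add: K_def)
  have closed: "b \<in> K v" if "e \<in> E" "ends G e = Upair a b" "a \<in> K v" "b \<in> ?Y - {v}" for e a b
  proof -
    have "(a, b) \<in> adj G E (?Y - {v})" using that KY[OF v(1)] by (auto simp: adj_def)
    then show ?thesis using that(3) by (auto simp: K_def)
  qed
  have "K v = ?Y - {v}"
  proof (rule ccontr)
    assume ne: "K v \<noteq> ?Y - {v}"
    define D where "D = ?Y - {v} - K v"
    have "conn G E (V - {v})" using vY del_conn by auto
    moreover have "D \<subseteq> V - {v}" "D \<noteq> {}" "D \<noteq> V - {v}" using ne KY[OF v(1)] t vY tK by (auto simp: D_def)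
    ultimately obtain e x y where e: "e \<in> E" "ends G e = Upair x y" "x \<in> D" "y \<in> V - {v} - D"
      by (rule conn_cut)
    have e': "ends G e = Upair y x" using e by auto
    have "y \<notin> K v" using closed[OF e(1) e'] e(3) by (auto simp: D_def)
    then have "y \<in> X" using e(4) by (auto simp: D_def)
    then have "cand x" using e e' tK by (auto simp: cand_def D_def)
    have "K v \<subseteq> ?Y - {x}" using KY[OF v(1)] e(3) by (auto simp: D_def)
    have sub: "K v \<subseteq> K x"
    proof
      fix z assume "z \<in> K v"
      then have "(t, z) \<in> (adj G E (K v))\<^sup>*" using reach_conn[of G E t "?Y - {v}"] tK unfolding K_def conn_def by blast
      then show "z \<in> K x" unfolding K_def[of x] using adj_rtrancl_mono[OF _ order_refl \<open>K v \<subseteq> ?Y - {x}\<close>] by blast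
    qed
    \<comment> \<open>\<open>?Y\<close> itself is connected, so some edge leaves the component
      within \<open>?Y\<close>, and its far end can only be \<open>v\<close>. Hence \<open>v\<close>
      joins the component once \<open>x\<close> is removed instead.\<close>
    have "K v \<subseteq> ?Y" "K v \<noteq> {}" "K v \<noteq> ?Y" using KY[OF v(1)] tK vY by auto
    with Y(1) obtain f a b where f: "f \<in> E" "ends G f = Upair a b" "a \<in> K v" "b \<in> ?Y - K v" by (rule conn_cut)
    have "b = v" using closed[OF f(1-3)] f(4) by blast
    have "v \<noteq> x" using e(3) by (auto simp: D_def)
    then have "(a, v) \<in> adj G E (?Y - {x})" using f \<open>b = v\<close> \<open>K v \<subseteq> ?Y - {x}\<close> vY by (auto simp: adj_def)
    moreover have "(t, a) \<in> (adj G E (?Y - {x}))\<^sup>*" using sub f(3) by (auto simp: K_def)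
    ultimately have "v \<in> K x" by (auto simp: K_def)
    moreover have "v \<notin> K v" using KY[OF v(1)] by auto
    ultimately have "K v \<subset> K x" using sub by blast
    moreover have "finite (K x)" using KY[OF \<open>cand x\<close>] finite_subset[of "K x" V] by auto
    ultimately have "card (K v) < card (K x)" by (intro psubset_card_mono)
    then show False using v(2)[OF \<open>cand x\<close>] by simp
  qed
  then have "conn G E (?Y - {v})" using reach_conn[of G E t "?Y - {v}"] by (simp add: K_def)
  then show ?thesis using v(1) by (auto simp: cand_def)
qed

text \<open>The ordered set \<open>X\<close> grows by one vertex, chosen by \<open>grow\<close> so
  that the rest stays connected. The new vertex has an earlier neighbor by choice, and a neighbor in
  the rest that will receive a larger number; the alternative \<open>u \<notin> X\<close> records
  this promise.\<close>

lemma st_order_partial: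
  assumes "s \<in> V" "t \<in> V" "s \<noteq> t" "Suc k < card V"
  shows "\<exists>X \<rho>. card X = Suc k \<and> X \<subseteq> V - {t} \<and> s \<in> X \<and> conn G E (V - X) \<and> \<rho> s = 0 \<and>
    inj_on \<rho> X \<and> \<rho> ` X \<subseteq> {..k} \<and>
    (\<forall>v\<in>X - {s}. (\<exists>e\<in>E. \<exists>u\<in>X. ends G e = Upair u v \<and> \<rho> u < \<rho> v) \<and>
       (\<exists>e\<in>E. \<exists>u\<in>V. ends G e = Upair v u \<and> (u \<notin> X \<or> \<rho> v < (\<rho> u :: nat))))"
  using assms(4)
proof (induction k)
  case 0
  have "conn G E (V - {s})" using assms del_conn by simp
  then show ?case using assms by (intro exI[of _ "{s}"] exI[of _ "\<lambda>_. 0"]) auto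
next
  case (Suc k)
  then obtain X \<rho> where X: "card X = Suc k" "X \<subseteq> V - {t}" "s \<in> X" "conn G E (V - X)" "\<rho> s = 0"
    "inj_on \<rho> X" "\<rho> ` X \<subseteq> {..k}"
    "\<forall>v\<in>X - {s}. (\<exists>e\<in>E. \<exists>u\<in>X. ends G e = Upair u v \<and> \<rho> u < \<rho> v) \<and>
       (\<exists>e\<in>E. \<exists>u\<in>V. ends G e = Upair v u \<and> (u \<notin> X \<or> \<rho> v < \<rho> u))"
    by (metis Suc_lessD)
  have fX: "finite X" using X(2) finite_subset[of X V] by auto
  have "V - X \<noteq> {t}"
  proof
    assume "V - X = {t}"
    then have "card (V - X) = 1" by simp
    then show False using X(1,2) Suc(2) fX by (subst (asm) card_Diff_subset) auto
  qed
  then obtain v e x where v: "v \<in> V - X - {t}" "e \<in> E" "x \<in> X" "ends G e = Upair x v" "conn G E (V - X - {v})"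
    using grow[of X t] X assms by blast
  have "V - X - {v} \<noteq> {}" "t \<in> V - X" using v(1) X assms by auto
  then have "{v} \<subseteq> V - X" "{v} \<noteq> {}" "{v} \<noteq> V - X" using v(1) by auto
  with X(4) obtain f a b where f: "f \<in> E" "ends G f = Upair a b" "a \<in> {v}" "b \<in> V - X - {v}" by (rule conn_cut)
  define \<rho>' where "\<rho>' = \<rho>(v := Suc k)"
  have le: "\<rho> u \<le> k" if "u \<in> X" for u using X(7) that by auto
  have eq: "\<rho>' u = \<rho> u" if "u \<in> X" for u using that v by (auto simp: \<rho>'_def)
  have eqv: "\<rho>' v = Suc k" by (simp add: \<rho>'_def)
  have main: "(\<exists>e\<in>E. \<exists>u\<in>insert v X. ends G e = Upair u w \<and> \<rho>' u < \<rho>' w) \<and>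
       (\<exists>e\<in>E. \<exists>u\<in>V. ends G e = Upair w u \<and> (u \<notin> insert v X \<or> \<rho>' w < \<rho>' u))" if w: "w \<in> insert v X - {s}" for w
  proof (cases "w = v")
    case True
    have "\<rho>' x < \<rho>' v" using eq[OF v(3)] le[OF v(3)] eqv by simp
    then show ?thesis using True v f by blast
  next
    case False
    then have wX: "w \<in> X - {s}" using w by auto
    obtain e1 u1 where 1: "e1 \<in> E" "u1 \<in> X" "ends G e1 = Upair u1 w" "\<rho> u1 < \<rho> w" using X(8) wX by blast
    obtain e2 u2 where 2: "e2 \<in> E" "u2 \<in> V" "ends G e2 = Upair w u2" "u2 \<notin> X \<or> \<rho> w < \<rho> u2" using X(8) wX by blast
    have "u2 \<notin> insert v X \<or> \<rho>' w < \<rho>' u2"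
    proof (cases "u2 = v")
      case True then show ?thesis using eqv eq[of w] le[of w] wX by auto
    next
      case False then show ?thesis using 2(4) eq[of w] eq[of u2] wX by (cases "u2 \<in> X") auto
    qed
    moreover have "\<rho>' u1 < \<rho>' w" using 1 eq[of w] eq[of u1] wX by auto
    ultimately show ?thesis using 1 2 by blast
  qed
  have "inj_on \<rho>' (insert v X)"
    unfolding inj_on_insert
  proof
    show "inj_on \<rho>' X" using X(6) eq by (auto simp: inj_on_def)
    show "\<rho>' v \<notin> \<rho>' ` (X - {v})" using eqv eq le by force
  qed
  moreover have "\<rho>' ` insert v X \<subseteq> {..Suc k}" using eqv eq le by force
  moreover have "V - insert v X = V - X - {v}" by auto
  moreover have "card (insert v X) = Suc (Suc k)" using v(1) X(1) fX by auto
  moreover have "\<rho>' s = 0" using eq[OF X(3)] X(5) by simp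
  ultimately show ?case
    using main v(1,5) X(2,3) by (intro exI[of _ "insert v X"] exI[of _ \<rho>']) auto
qed

lemma st_order:
  assumes "s \<in> V" "t \<in> V" "s \<noteq> t"
  obtains \<rho> :: "'a \<Rightarrow> nat" where "inj_on \<rho> V" "\<And>v. v \<in> V \<Longrightarrow> v \<noteq> s \<Longrightarrow> \<rho> s < \<rho> v" "\<And>v. v \<in> V \<Longrightarrow> v \<noteq> t \<Longrightarrow> \<rho> v < \<rho> t"
    "\<And>v. v \<in> V \<Longrightarrow> v \<noteq> s \<Longrightarrow> v \<noteq> t \<Longrightarrow> \<exists>e\<in>E. \<exists>u\<in>V. ends G e = Upair u v \<and> \<rho> u < \<rho> v"
    "\<And>v. v \<in> V \<Longrightarrow> v \<noteq> s \<Longrightarrow> v \<noteq> t \<Longrightarrow> \<exists>e\<in>E. \<exists>u\<in>V. ends G e = Upair v u \<and> \<rho> v < \<rho> u"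
proof -
  \<comment> \<open>\<open>X\<close> then has \<open>card V - 1\<close> elements, all vertices but
    \<open>t\<close>, which is placed last. Being outside \<open>X\<close>, it keeps every open
    promise of a later neighbor.\<close>
  define k where "k = card V - 2"
  have k: "Suc k < card V" "Suc (Suc k) = card V" using card_V by (auto simp: k_def)
  obtain X \<rho> where X: "card X = Suc k" "X \<subseteq> V - {t}" "s \<in> X" "\<rho> s = 0"
    "inj_on \<rho> X" "\<rho> ` X \<subseteq> {..k}"
    "\<forall>v\<in>X - {s}. (\<exists>e\<in>E. \<exists>u\<in>X. ends G e = Upair u v \<and> \<rho> u < \<rho> v) \<and>
       (\<exists>e\<in>E. \<exists>u\<in>V. ends G e = Upair v u \<and> (u \<notin> X \<or> \<rho> v < (\<rho> u :: nat)))"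
    using st_order_partial[OF assms k(1)] by blast
  have "card (V - {t}) = Suc k" using assms k by simp
  then have XV: "X = V - {t}" using X(1,2) card_subset_eq[of "V - {t}" X] by auto
  define \<rho>' where "\<rho>' = \<rho>(t := Suc k)"
  have le: "\<rho> u \<le> k" if "u \<in> X" for u using X(6) that by auto
  have eq: "\<rho>' u = \<rho> u" if "u \<in> X" for u using that XV by (auto simp: \<rho>'_def)
  have eqt: "\<rho>' t = Suc k" by (simp add: \<rho>'_def)
  have lt: "\<rho>' v < \<rho>' t" if "v \<in> V" "v \<noteq> t" for v using that eqt eq[of v] le[of v] XV by auto
  have "V = insert t X" using XV assms by auto
  have "inj_on \<rho>' V"
    unfolding \<open>V = insert t X\<close> inj_on_insert
  proof
    show "inj_on \<rho>' X" using X(5) eq by (auto simp: inj_on_def)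
    show "\<rho>' t \<notin> \<rho>' ` (X - {t})" using eqt eq le by force
  qed
  moreover have "\<rho>' s < \<rho>' v" if "v \<in> V" "v \<noteq> s" for v
  proof (cases "v = t")
    case True then show ?thesis using lt assms by auto
  next
    case False
    then have "v \<in> X" using that XV by auto
    then have "\<rho> v \<noteq> \<rho> s" using X(3,5) that(2) by (auto simp: inj_on_def)
    then show ?thesis using eq[of v] eq[of s] X(3,4) \<open>v \<in> X\<close> by auto
  qed
  moreover have "\<exists>e\<in>E. \<exists>u\<in>V. ends G e = Upair u v \<and> \<rho>' u < \<rho>' v" if "v \<in> V" "v \<noteq> s" "v \<noteq> t" for v
  proof -
    have "v \<in> X - {s}" using that XV by auto
    then obtain e u where "e \<in> E" "u \<in> X" "ends G e = Upair u v" "\<rho> u < \<rho> v" using X(7) by blast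
    then show ?thesis using eq[of u] eq[of v] XV \<open>v \<in> X - {s}\<close> by (intro bexI[of _ e] bexI[of _ u]) auto
  qed
  moreover have "\<exists>e\<in>E. \<exists>u\<in>V. ends G e = Upair v u \<and> \<rho>' v < \<rho>' u" if "v \<in> V" "v \<noteq> s" "v \<noteq> t" for v
  proof -
    have vX: "v \<in> X - {s}" using that XV by auto
    then obtain e u where e: "e \<in> E" "u \<in> V" "ends G e = Upair v u" "u \<notin> X \<or> \<rho> v < \<rho> u" using X(7) by blast
    have "\<rho>' v < \<rho>' u"
    proof (cases "u = t")
      case True then show ?thesis using lt that by simp
    next
      case False then show ?thesis using e XV eq[of u] eq[of v] vX by auto
    qed
    then show ?thesis using e by blast
  qed
  ultimately show ?thesis using that lt by blast
qed

lemma no_isolated: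
  assumes "v \<in> V" "w \<in> V" "v \<noteq> w"
  shows "\<exists>e\<in>E. \<exists>u\<in>V. u \<noteq> w \<and> ends G e = Upair u v"
proof -
  have "{v} \<subseteq> V - {w}" "{v} \<noteq> {}" "{v} \<noteq> V - {w}" using assms other_vertex[of v w] by auto
  with del_conn[OF assms(2)] obtain e x y where "e \<in> E" "ends G e = Upair x y" "x \<in> {v}" "y \<in> V - {w} - {v}"
    by (rule conn_cut)
  then show ?thesis by (intro bexI[of _ e] bexI[of _ y]) auto
qed

text \<open>On the components of \<open>L\<close> that meet \<open>T'\<close>, the vertices of
  \<open>T'\<close> have \<open>L\<close>-degree one and are free, so \<open>L\<close> splits into
  two parts that are odd at all other vertices. Components that miss \<open>T'\<close> may have odd
  order; they are dropped, and their vertices, which have odd degree by \<open>reach\<close>, see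
  the base color only.\<close>

lemma colorable_join:
  assumes deg: "\<And>v. v \<in> V \<Longrightarrow> odd (dg G E v) \<or> dg G E v = 2"
    and L: "L \<subseteq> E" "T' \<subseteq> V" "\<And>v. v \<in> T' \<Longrightarrow> dg G E v = 2" "\<And>v. odd (dg G L v) \<longleftrightarrow> v \<in> T'"
    and reach: "\<And>v. v \<in> V \<Longrightarrow> dg G E v = 2 \<Longrightarrow> \<exists>x\<in>T'. (v, x) \<in> (adj G L V)\<^sup>*"
    and pos: "\<And>v. v \<in> V \<Longrightarrow> dg G E v = 2 \<Longrightarrow> dg G L v > 0"
  shows "colorable 3 G"
proof -
  define U where "U = {v\<in>V. \<exists>x\<in>T'. (v, x) \<in> (adj G L V)\<^sup>*}"
  have TU: "T' \<subseteq> U" using L(2) by (auto simp: U_def)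
  have fU: "finite U" by (simp add: U_def)
  have closed: "b \<in> U" if "e \<in> L" "ends G e = Upair a b" "a \<in> U" for e a b
  proof -
    have "(b, a) \<in> adj G L V" using that L(1) ends_in_V[of e a b] by (intro adjI') auto
    then show ?thesis using that ends_in_V[of e a b] L(1) unfolding U_def by (auto intro: converse_rtrancl_into_rtrancl)
  qed
  have edge_in: "set_uprod (ends G e) \<subseteq> U" if "e \<in> L" "set_uprod (ends G e) \<inter> U \<noteq> {}" for e
  proof -
    obtain x y where xy: "ends G e = Upair x y" by (rule uprod_ends)
    then have "ends G e = Upair y x" by auto
    then show ?thesis using closed[OF that(1)] xy that(2) by auto
  qed
  define L1 where "L1 = inner G L U"
  have L1: "L1 \<subseteq> E" "L1 \<subseteq> L" using L(1) by (auto simp: L1_def inner_def)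
  have dgU: "dg G (F \<inter> L1) v = dg G F v" if "v \<in> U" "F \<subseteq> L" for F v
  proof -
    have "{e\<in>F \<inter> L1. v \<in> set_uprod (ends G e)} = {e\<in>F. v \<in> set_uprod (ends G e)}"
      using that edge_in by (auto simp: L1_def inner_def)
    then show ?thesis by (simp add: dg_def)
  qed
  have dgU0: "dg G F v = 0" if "v \<notin> U" "F \<subseteq> L1" for F v
  proof -
    have "F \<subseteq> E" using that L1 by blast
    then show ?thesis using that by (subst dg_zero_iff) (auto simp: L1_def inner_def)
  qed
  have "\<exists>A\<subseteq>inner G L V. \<forall>v. v \<notin> T' \<longrightarrow> (odd (dg G A v) \<longleftrightarrow> v \<in> U - T')"
    by (intro join_free) (use fU L(1) in \<open>auto simp: U_def\<close>)
  then obtain A0 where A0: "A0 \<subseteq> L" "\<And>v. v \<notin> T' \<Longrightarrow> odd (dg G A0 v) \<longleftrightarrow> v \<in> U - T'"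
    by (auto simp: inner_def)
  define A where "A = A0 \<inter> L1"
  define B where "B = L1 - A"
  have AL: "A \<subseteq> L1" by (auto simp: A_def)
  have sum: "dg G A v + dg G B v = dg G L1 v" for v
    using dg_Diff[OF AL L1(1)] by (simp add: B_def)
  show ?thesis
  proof (rule colorable_base[of A B])
    show "A \<subseteq> E" "B \<subseteq> E" "A \<inter> B = {}" using L1 by (auto simp: A_def B_def)
    fix v assume v: "v \<in> V"
    show "(odd (dg G E v) \<and> dg G A v = 0 \<and> dg G B v = 0) \<or>
       (odd (dg G E v) \<and> odd (dg G A v) \<and> odd (dg G B v)) \<or>
       (odd (dg G E v) \<and> dg G A v = dg G E v) \<or>
       (dg G E v = 2 \<and> dg G A v + dg G B v = 1) \<or>
       (dg G E v = 2 \<and> odd (dg G A v) \<and> odd (dg G B v))"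
    proof (cases "v \<in> U")
      case False
      then have "dg G E v \<noteq> 2" using reach[OF v] v by (auto simp: U_def)
      then show ?thesis using deg[OF v] dgU0[OF False, of A] dgU0[OF False, of B] AL by (auto simp: B_def)
    next
      case True
      have d: "dg G A v + dg G B v = dg G L v" using sum dgU[OF True, of L] L1(2) by (simp add: Int_absorb1)
      show ?thesis
      proof (cases "v \<in> T'")
        case True
        then have "dg G E v = 2" "odd (dg G L v)" using L by auto
        moreover have "dg G L v \<le> 2" using dg_mono[OF L(1) order_refl, of v] calculation by simp
        ultimately have "dg G L v = 1" by (auto simp: le_Suc_eq numeral_2_eq_2)
        then show ?thesis using d \<open>dg G E v = 2\<close> by simp
      next
        case False
        then have "odd (dg G A v)" using A0 dgU[OF True, of A0] True by (auto simp: A_def)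
        moreover have "even (dg G L v)" using L(4) False by blast
        ultimately have "odd (dg G B v)" using d by (metis even_add)
        then show ?thesis using \<open>odd (dg G A v)\<close> deg[OF v] by blast
      qed
    qed
  qed
qed

text \<open>An even number of 2-vertices has a join, and all of them are free in it.\<close>

lemma colorable_even:
  assumes deg: "\<And>v. v \<in> V \<Longrightarrow> odd (dg G E v) \<or> dg G E v = 2"
    and ev: "even (card {v\<in>V. dg G E v = 2})"
  shows "colorable 3 G"
proof (cases "{v\<in>V. dg G E v = 2} = {}")
  case True
  then show ?thesis using deg by (intro colorable_base[of "{}" "{}"]) auto
next
  case False
  let ?T = "{v\<in>V. dg G E v = 2}"
  have "\<exists>L\<subseteq>inner G E V. \<forall>v. odd (dg G L v) \<longleftrightarrow> v \<in> ?T"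
    using conn_V ev by (intro tjoin) auto
  then obtain L where L: "L \<subseteq> E" "\<And>v. odd (dg G L v) \<longleftrightarrow> v \<in> ?T" by (auto simp: inner_def)
  show ?thesis
  proof (rule colorable_join[OF deg L(1) _ _ L(2)])
    show "\<exists>x\<in>?T. (v, x) \<in> (adj G L V)\<^sup>*" if "v \<in> V" "dg G E v = 2" for v using that by blast
    show "dg G L v > 0" if "v \<in> V" "dg G E v = 2" for v using that L(2)[of v] by (auto intro: odd_pos)
  qed auto
qed

text \<open>\<open>L\<close> has to pass through one 2-vertex \<open>c\<close> with both edges and
  to end at all others. The danger is a component of \<open>c\<close> without a free vertex. An
  st-ordering between two other 2-vertices separates the two edges at \<open>c\<close>, so that the
  part of \<open>L\<close> below \<open>c\<close> is forced to connect \<open>c\<close> with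
  \<open>s\<close>.\<close>

lemma colorable_odd:
  assumes deg: "\<And>v. v \<in> V \<Longrightarrow> odd (dg G E v) \<or> dg G E v = 2"
    and od: "odd (card {v\<in>V. dg G E v = 2})" "card {v\<in>V. dg G E v = 2} \<noteq> 1"
  shows "colorable 3 G"
proof -
  let ?T = "{v\<in>V. dg G E v = 2}"
  have "card ?T \<noteq> 0" "card ?T \<noteq> 2" using od by (metis even_zero, metis even_numeral)
  then have "card ?T \<ge> 3" using od(2) by linarith
  then have "\<exists>s t. s \<in> ?T \<and> t \<in> ?T \<and> s \<noteq> t \<and> ?T - {s, t} \<noteq> {}"
    by (auto simp: card_le_Suc_iff numeral_3_eq_3)
  then obtain s t where st: "s \<in> ?T" "t \<in> ?T" "s \<noteq> t" "?T - {s, t} \<noteq> {}" by blast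
  obtain \<rho> :: "'a \<Rightarrow> nat" where \<rho>: "inj_on \<rho> V" "\<And>v. v \<in> V \<Longrightarrow> v \<noteq> s \<Longrightarrow> \<rho> s < \<rho> v"
    "\<And>v. v \<in> V \<Longrightarrow> v \<noteq> t \<Longrightarrow> \<rho> v < \<rho> t"
    "\<And>v. v \<in> V \<Longrightarrow> v \<noteq> s \<Longrightarrow> v \<noteq> t \<Longrightarrow> \<exists>e\<in>E. \<exists>u\<in>V. ends G e = Upair u v \<and> \<rho> u < \<rho> v"
    "\<And>v. v \<in> V \<Longrightarrow> v \<noteq> s \<Longrightarrow> v \<noteq> t \<Longrightarrow> \<exists>e\<in>E. \<exists>u\<in>V. ends G e = Upair v u \<and> \<rho> v < \<rho> u"
    using st_order[of s t] st by auto
  \<comment> \<open>As \<open>c\<close> is the lowest 2-vertex apart from \<open>s\<close>, the only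
    2-vertex below it is \<open>s\<close>.\<close>
  obtain c where c: "c \<in> ?T - {s}" "\<And>v. v \<in> ?T - {s} \<Longrightarrow> \<rho> c \<le> \<rho> v"
    using ex_has_least_nat[of "\<lambda>v. v \<in> ?T - {s}" t \<rho>] st by blast
  have ct: "c \<noteq> t"
  proof
    assume "c = t"
    obtain w where "w \<in> ?T - {s, t}" using st(4) by blast
    then have "\<rho> w < \<rho> t" "\<rho> c \<le> \<rho> w" using \<rho>(3)[of w] c(2)[of w] by auto
    then show False using \<open>c = t\<close> by simp
  qed
  define X where "X = {v\<in>V. \<rho> v < \<rho> c}"
  define Y where "Y = {v\<in>V. \<rho> c < \<rho> v}"
  have cV: "c \<in> V" "c \<noteq> s" "dg G E c = 2" using c(1) by auto
  have sX: "s \<in> X" "t \<in> Y" using \<rho>(2)[of c] \<rho>(3)[of c] cV ct st by (auto simp: X_def Y_def)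
  have VXY: "v = c \<or> v \<in> X \<or> v \<in> Y" if "v \<in> V" for v
  proof -
    have "\<rho> v < \<rho> c \<or> \<rho> c < \<rho> v \<or> v = c"
      using inj_onD[OF \<rho>(1) _ that cV(1)] by linarith
    then show ?thesis using that by (auto simp: X_def Y_def)
  qed
  have disj: "X \<inter> Y = {}" "c \<notin> X" "c \<notin> Y" by (auto simp: X_def Y_def)
  have XT: "X \<inter> ?T = {s}"
  proof -
    have "v = s" if "v \<in> X" "v \<in> ?T" for v
    proof (rule ccontr)
      assume "v \<noteq> s"
      then have "\<rho> c \<le> \<rho> v" using c(2)[of v] that by blast
      then show False using that by (auto simp: X_def)
    qed
    then show ?thesis using sX st(1) by blast
  qed
  \<comment> \<open>Initial and final segments of an st-ordering are connected: every vertex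
    descends to \<open>s\<close> and ascends to \<open>t\<close> along the ordering.\<close>
  have "conn G E X"
  proof (rule conn_rootI[OF sX(1)])
    fix x assume "x \<in> X"
    then show "(x, s) \<in> (adj G E X)\<^sup>*"
    proof (induction "\<rho> x" arbitrary: x rule: less_induct)
      case less
      show ?case
      proof (cases "x = s")
        case False
        have "x \<noteq> t" using \<open>x \<in> X\<close> sX disj by auto
        then obtain e u where e: "e \<in> E" "u \<in> V" "ends G e = Upair u x" "\<rho> u < \<rho> x"
          using \<rho>(4)[of x] False less(2) by (auto simp: X_def)
        then have "u \<in> X" using less(2) by (auto simp: X_def)
        then have "(x, u) \<in> adj G E X" using less(2) e by (intro adjI'[OF e(1,3)])
        then show ?thesis using less(1)[OF e(4) \<open>u \<in> X\<close>] by (meson converse_rtrancl_into_rtrancl)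
      qed simp
    qed
  qed
  have "conn G E Y"
  proof (rule conn_rootI[OF sX(2)])
    fix x assume "x \<in> Y"
    then show "(x, t) \<in> (adj G E Y)\<^sup>*"
    proof (induction "\<rho> t - \<rho> x" arbitrary: x rule: less_induct)
      case less
      show ?case
      proof (cases "x = t")
        case False
        have "x \<noteq> s" using \<open>x \<in> Y\<close> sX disj by auto
        then obtain e u where e: "e \<in> E" "u \<in> V" "ends G e = Upair x u" "\<rho> x < \<rho> u"
          using \<rho>(5)[of x] False less(2) by (auto simp: Y_def)
        then have u: "u \<in> Y" "(x, u) \<in> adj G E Y" using less(2) by (auto simp: Y_def adj_def)
        moreover have "\<rho> x < \<rho> t" using \<rho>(3)[of x] False less(2) by (auto simp: Y_def)
        then have "\<rho> t - \<rho> u < \<rho> t - \<rho> x" using e(4) by linarith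
        ultimately show ?thesis using less(1) by (meson converse_rtrancl_into_rtrancl)
      qed simp
    qed
  qed
  obtain e1 u1 where e1: "e1 \<in> E" "u1 \<in> X" "ends G e1 = Upair u1 c" using \<rho>(4)[of c] cV ct by (auto simp: X_def)
  obtain e2 u2 where e2: "e2 \<in> E" "u2 \<in> Y" "ends G e2 = Upair c u2" using \<rho>(5)[of c] cV ct by (auto simp: Y_def)
  have e12: "e1 \<noteq> e2" using e1 e2 disj by auto
  have XYV: "X \<subseteq> V" "Y \<subseteq> V" "finite X" "finite Y" by (auto simp: X_def Y_def)
  \<comment> \<open>The parity at \<open>u1\<close> is switched because the edge \<open>e1\<close>
    is added to the join afterwards; the symmetric difference also covers \<open>u1 = s\<close>. The
    same is done with \<open>u2\<close> and \<open>e2\<close> above \<open>c\<close>.\<close>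
  have TX: "even (card (({s} - {u1}) \<union> ({u1} - {s})))" by (cases "s = u1") auto
  have "\<exists>L\<subseteq>inner G E X. \<forall>v. odd (dg G L v) \<longleftrightarrow> v \<in> ({s} - {u1}) \<union> ({u1} - {s})"
    using \<open>conn G E X\<close> XYV sX e1 TX by (intro tjoin) auto
  then obtain L1 where L1: "L1 \<subseteq> inner G E X" "\<And>v. odd (dg G L1 v) \<longleftrightarrow> (v = s) \<noteq> (v = u1)" by auto
  define TY where "TY = ?T \<inter> Y"
  have "?T = insert s (insert c TY)"
  proof -
    have "v = s \<or> v = c \<or> v \<in> TY" if "v \<in> ?T" for v
    proof -
      have "v = c \<or> v \<in> X \<or> v \<in> Y" using VXY that by blast
      then show ?thesis using XT that unfolding TY_def by blast
    qed
    then show ?thesis using st(1) c(1) by (auto simp: TY_def)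
  qed
  moreover have "s \<notin> TY" "c \<notin> TY" "s \<noteq> c" "finite TY" using sX disj cV XYV by (auto simp: TY_def)
  ultimately have oTY: "odd (card TY)" using od(1) by simp
  have "even (card ((TY - {u2}) \<union> ({u2} - TY)))"
  proof (cases "u2 \<in> TY")
    case True
    then have "(TY - {u2}) \<union> ({u2} - TY) = TY - {u2}" by auto
    then show ?thesis using oTY card_Suc_Diff1[OF \<open>finite TY\<close> True] by (metis even_Suc)
  next
    case False
    then have "(TY - {u2}) \<union> ({u2} - TY) = insert u2 TY" by auto
    then show ?thesis using oTY False \<open>finite TY\<close> by simp
  qed
  then have "\<exists>L\<subseteq>inner G E Y. \<forall>v. odd (dg G L v) \<longleftrightarrow> v \<in> (TY - {u2}) \<union> ({u2} - TY)"
    using \<open>conn G E Y\<close> XYV e2 by (intro tjoin) (auto simp: TY_def)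
  then obtain L2 where L2: "L2 \<subseteq> inner G E Y" "\<And>v. odd (dg G L2 v) \<longleftrightarrow> (v \<in> TY) \<noteq> (v = u2)" by auto
  define M where "M = insert e1 L1"
  define L where "L = M \<union> insert e2 L2"
  have sub: "L1 \<subseteq> E" "L2 \<subseteq> E" using L1 L2 by (auto simp: inner_def)
  have nin: "e1 \<notin> L1" "e2 \<notin> L2" using L1(1) L2(1) e1 e2 disj by (auto simp: inner_def)
  have dM: "dg G M v = dg G L1 v + of_bool (v = u1 \<or> v = c)" for v
    unfolding M_def using dg_insert[OF sub(1) e1(1) nin(1)] e1 by auto
  have d2: "dg G (insert e2 L2) v = dg G L2 v + of_bool (v = u2 \<or> v = c)" for v
    using dg_insert[OF sub(2) e2(1) nin(2)] e2 by auto
  have "M \<inter> insert e2 L2 = {}"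
  proof -
    have "e1 \<notin> L2" "e2 \<notin> L1" using L1(1) L2(1) e1 e2 disj by (auto simp: inner_def)
    moreover have "L1 \<inter> L2 = {}"
    proof (rule ccontr)
      assume "L1 \<inter> L2 \<noteq> {}"
      then obtain e where e: "e \<in> L1" "e \<in> L2" by blast
      obtain x y where "ends G e = Upair x y" by (rule uprod_ends)
      moreover have "e \<in> inner G E X" "e \<in> inner G E Y" using e L1(1) L2(1) by blast+
      ultimately show False using disj by (auto simp: inner_def)
    qed
    ultimately show ?thesis using e12 by (auto simp: M_def)
  qed
  then have dL: "dg G L v = dg G M v + dg G (insert e2 L2) v" for v
    unfolding L_def using sub e1 e2 by (intro dg_Un) (auto simp: M_def)
  have z: "dg G L1 c = 0" "dg G L2 c = 0" using sub L1(1) L2(1) disj by (auto simp: dg_zero_iff inner_def)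
  have u: "u1 \<noteq> c" "u2 \<noteq> c" "u1 \<notin> Y" "u2 \<notin> X" using e1 e2 disj by auto
  have dMc: "dg G M c = 1" using dM[of c] z by simp
  have oM: "odd (dg G M v) \<longleftrightarrow> v = s \<or> v = c" for v
    using dM[of v] L1(2)[of v] u z cV by (cases "v = c"; cases "v = u1"; cases "v = s") auto
  have oN: "odd (dg G (insert e2 L2) v) \<longleftrightarrow> v \<in> TY \<or> v = c" for v
    using d2[of v] L2(2)[of v] u z disj by (cases "v = c"; cases "v = u2"; cases "v \<in> TY") (auto simp: TY_def)
  have oL: "odd (dg G L v) \<longleftrightarrow> v \<in> ?T - {c}" for v
    using oM[of v] oN[of v] dL[of v] \<open>?T = insert s (insert c TY)\<close> \<open>s \<notin> TY\<close> \<open>c \<notin> TY\<close> \<open>s \<noteq> c\<close> by auto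
  have LE: "L \<subseteq> E" "M \<subseteq> L" using sub e1 e2 by (auto simp: L_def M_def)
  \<comment> \<open>In \<open>M\<close> only \<open>s\<close> and \<open>c\<close> have odd degree,
    so they lie in one component of it.\<close>
  have "\<exists>y. y \<noteq> c \<and> odd (dg G M y) \<and> (c, y) \<in> (adj G M V)\<^sup>*"
    using LE cV oM by (intro comp_meets) auto
  then have "(c, s) \<in> (adj G M V)\<^sup>*" using oM by auto
  then have cs: "(c, s) \<in> (adj G L V)\<^sup>*" by (rule adj_rtrancl_mono) (use LE in auto)
  show ?thesis
  proof (rule colorable_join[OF deg LE(1) _ _ oL])
    show "\<exists>x\<in>?T - {c}. (v, x) \<in> (adj G L V)\<^sup>*" if "v \<in> V" "dg G E v = 2" for v
      using that cs st(1) cV by (cases "v = c") auto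
    show "dg G L v > 0" if "v \<in> V" "dg G E v = 2" for v
      using that oL[of v] dL[of c] dMc by (cases "v = c") (auto intro: odd_pos)
  qed auto
qed

end

section \<open>Graphs with a single 2-vertex\<close>

text \<open>The 2-vertex comes with names for its edges and neighbors because the induction changes
  them: a contraction renames \<open>p\<close> or \<open>q\<close>, and the graphs built from small
  cuts have 2-vertices with other edges.\<close>

locale near_odd = tgraph +
  fixes c ep eq p q
  assumes c: "c \<in> V" and ep: "ep \<in> E" "ends G ep = Upair c p" and eq: "eq \<in> E" "ends G eq = Upair c q"
    and ep_eq: "ep \<noteq> eq" and c_only: "\<And>e. e \<in> E \<Longrightarrow> c \<in> set_uprod (ends G e) \<Longrightarrow> e = ep \<or> e = eq"
    and odd_deg: "\<And>v. v \<in> V \<Longrightarrow> v \<noteq> c \<Longrightarrow> odd (dg G E v)"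
begin

lemma pq: "p \<in> V" "q \<in> V" "p \<noteq> c" "q \<noteq> c" "c \<noteq> p" "c \<noteq> q"
  using ends_in_V[OF ep] ends_in_V[OF eq] by auto

lemma p_neq_q: "p \<noteq> q"
proof
  assume "p = q"
  obtain e u where "e \<in> E" "u \<noteq> p" "ends G e = Upair u c" using no_isolated[of c p] c pq by blast
  then show False using c_only[of e] ep eq \<open>p = q\<close> by auto
qed

lemma inc_c: "{e\<in>E. c \<in> set_uprod (ends G e)} = {ep, eq}"
  using c_only ep eq by auto

lemma dg_c: "dg G E c = 2"
  unfolding dg_def inc_c using ep_eq by simp

lemma deg_cases: "v \<in> V \<Longrightarrow> odd (dg G E v) \<or> dg G E v = 2"
  using odd_deg dg_c by blast

lemma dg_c_sub: "F \<subseteq> E \<Longrightarrow> dg G F c = of_bool (ep \<in> F) + of_bool (eq \<in> F)"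
proof -
  assume "F \<subseteq> E"
  then have "{e\<in>F. c \<in> set_uprod (ends G e)} = {e\<in>{ep, eq}. e \<in> F}" using inc_c by blast
  also have "\<dots> = (if ep \<in> F then {ep} else {}) \<union> (if eq \<in> F then {eq} else {})" by auto
  finally show ?thesis unfolding dg_def using ep_eq by auto
qed

lemma card_even: "even (card (V - {c}))"
proof -
  have "even (\<Sum>v\<in>V. dg G E v)"
    using multigraph by (intro handshake_all) (auto simp: multigraph_def)
  moreover have "(\<Sum>v\<in>V. dg G E v) = dg G E c + (\<Sum>v\<in>V - {c}. dg G E v)" using c by (intro sum.remove) auto
  moreover have "even (\<Sum>v\<in>V - {c}. dg G E v) \<longleftrightarrow> even (card (V - {c}))"
    using odd_deg by (intro even_sum_odd_card) auto
  ultimately show ?thesis using dg_c by simp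
qed

text \<open>Here no vertex is free: \<open>c\<close> needs one edge in each part, like every other
  vertex of \<open>U\<close> needs odd degree in both. The split is a join of all of
  \<open>U\<close>, which is why \<open>card U\<close> must be even.\<close>

lemma colorable_closed:
  assumes "L \<subseteq> E" "U \<subseteq> V" "c \<in> U" "conn G L U" "\<And>e. e \<in> L \<Longrightarrow> set_uprod (ends G e) \<subseteq> U"
    "\<And>v. even (dg G L v)" "even (card U)"
  shows "colorable 3 G"
proof -
  have "\<exists>A\<subseteq>inner G L U. \<forall>v. odd (dg G A v) \<longleftrightarrow> v \<in> U" using assms by (intro tjoin) auto
  then obtain A where A: "A \<subseteq> L" "\<And>v. odd (dg G A v) \<longleftrightarrow> v \<in> U" by (auto simp: inner_def)
  have d: "dg G L v = dg G (L - A) v + dg G A v" for v using A assms(1) by (intro dg_Diff)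
  have B: "odd (dg G (L - A) v) \<longleftrightarrow> v \<in> U" for v using d[of v] A(2)[of v] assms(6)[of v] by (metis even_add)
  have LA: "A \<subseteq> E" "L - A \<subseteq> E" using A assms by auto
  show ?thesis
  proof (rule colorable_base[OF LA])
    fix v assume v: "v \<in> V"
    have "dg G A v = 0 \<and> dg G (L - A) v = 0" if "v \<notin> U"
      using that assms(5) A(1) LA by (auto simp: dg_zero_iff)
    then show "(odd (dg G E v) \<and> dg G A v = 0 \<and> dg G (L - A) v = 0) \<or>
       (odd (dg G E v) \<and> odd (dg G A v) \<and> odd (dg G (L - A) v)) \<or>
       (odd (dg G E v) \<and> dg G A v = dg G E v) \<or>
       (dg G E v = 2 \<and> dg G A v + dg G (L - A) v = 1) \<or>
       (dg G E v = 2 \<and> odd (dg G A v) \<and> odd (dg G (L - A) v))"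
      using A(2)[of v] B[of v] deg_cases[OF v] odd_deg[OF v] assms(3) by (cases "v \<in> U") auto
  qed auto
qed

text \<open>A cycle through \<open>c\<close> is properly colored with three colors, the fourth one goes to all
  other edges.\<close>

lemma colorable_4: "colorable 4 G"
proof -
  obtain xs where xs: "pth G E (V - {c}) xs" "hd xs = q" "last xs = p"
    using conn_pth[OF del_conn[OF c], of q p] pq by blast
  obtain P where P: "P \<subseteq> inner G E (set xs)" "conn G P (set xs)"
    "\<And>v. dg G P v + of_bool (v = q) + of_bool (v = p) = 2 * of_bool (v \<in> set xs)"
    using pth_edges[OF xs(1)] xs by auto
  have xsV: "set xs \<subseteq> V - {c}" "q \<in> set xs" "p \<in> set xs" using xs by (auto simp: pth_def)
  define L where "L = insert eq P"
  have PE: "P \<subseteq> E" using P(1) by (auto simp: inner_def)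
  have cP: "dg G P c = 0" using P(3)[of c] xsV pq by auto
  have nP: "eq \<notin> P" "ep \<notin> P" using cP ep eq by (auto simp: dg_zero_iff[OF PE])
  have LE: "L \<subseteq> E" using PE eq by (auto simp: L_def)
  have dL: "dg G L v = dg G P v + of_bool (v = c \<or> v = q)" for v
    unfolding L_def using dg_insert[OF PE eq(1) nP(1)] eq by auto
  have dL': "dg G L v = (if v = p \<or> v = c then 1 else if v \<in> set xs then 2 else 0)" for v
    using dL[of v] P(3)[of v] pq p_neq_q xsV cP by (auto split: if_splits)
  \<comment> \<open>Only \<open>p\<close> is free. The path alternates between the two classes, with
    the edge of \<open>P\<close> at \<open>q\<close> in \<open>A\<close>, so that \<open>eq\<close>
    falls to \<open>B\<close>. The edge \<open>ep\<close> that closes the cycle has a color of its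
    own, whatever the parity of the cycle.\<close>
  have "\<exists>A\<subseteq>inner G L (set xs). \<forall>v. v \<notin> {p} \<longrightarrow> (odd (dg G A v) \<longleftrightarrow> v \<in> set xs - {p})"
  proof (intro join_free)
    have "conn G L (set xs)" using P(2) by (rule conn_mono) (auto simp: L_def)
    then show "\<forall>v\<in>set xs - {p}. \<exists>x\<in>{p}. (v, x) \<in> (adj G L (set xs))\<^sup>*"
      using xsV unfolding conn_def by blast
  qed (use LE in auto)
  then obtain A where A: "A \<subseteq> L" "\<And>v. v \<noteq> p \<Longrightarrow> odd (dg G A v) \<longleftrightarrow> v \<in> set xs"
    by (auto simp: inner_def)
  define B where "B = L - A"
  define R where "R = E - insert ep L"
  have epL: "ep \<notin> L" using nP ep_eq by (auto simp: L_def)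
  have AB: "dg G L v = dg G B v + dg G A v" for v unfolding B_def using A LE by (intro dg_Diff)
  have dep: "dg G {ep} v = of_bool (v = c \<or> v = p)" for v using dg_insert[of "{}" ep v] ep by auto
  have "dg G E v = dg G R v + dg G (insert ep L) v" for v unfolding R_def using LE ep by (intro dg_Diff) auto
  moreover have "dg G (insert ep L) v = dg G L v + of_bool (v = c \<or> v = p)" for v
    using dg_insert[OF LE ep(1) epL] ep by auto
  ultimately have dR: "dg G E v = dg G R v + dg G L v + of_bool (v = c \<or> v = p)" for v by simp
  define col where "col e = (if e \<in> A then 0 else if e \<in> L then 1 else if e = ep then 2 else 3 :: nat)" for e
  have classes: "{e\<in>E. col e = i} = (if i = 0 then A else if i = 1 then B else if i = 2 then {ep} else if i = 3 then R else {})" for i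
    using A(1) LE ep epL by (auto simp: col_def B_def R_def)
  have "zero_or_odd (dg G A v) \<and> zero_or_odd (dg G B v) \<and> zero_or_odd (dg G {ep} v) \<and> zero_or_odd (dg G R v)"
    if v: "v \<in> V" for v
  proof (cases "v = p \<or> v = c")
    case True
    then have "dg G B v + dg G A v = 1" using AB[of v] dL'[of v] by simp
    then have "dg G A v = 0 \<and> dg G B v = 1 \<or> dg G A v = 1 \<and> dg G B v = 0" by linarith
    moreover have "zero_or_odd (dg G R v)"
    proof (cases "v = c")
      case True then show ?thesis using dR[of v] dL'[of v] dg_c by (auto simp: zero_or_odd_def)
    next
      case False
      then have "dg G E v = dg G R v + 2" "odd (dg G E v)" using dR[of v] dL'[of v] True odd_deg[OF v] by auto
      then show ?thesis by (simp add: zero_or_odd_def)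
    qed
    ultimately show ?thesis using dep True by (auto simp: zero_or_odd_def)
  next
    case False
    show ?thesis
    proof (cases "v \<in> set xs")
      case True
      have "odd (dg G A v)" using A(2) False True by auto
      moreover have "dg G L v = 2" using dL' True False by auto
      ultimately have "odd (dg G B v)" using AB[of v] by (metis even_add even_numeral)
      moreover have "dg G E v = dg G R v + 2" "odd (dg G E v)" using dR[of v] dL'[of v] True False odd_deg[OF v] by auto
      then have "odd (dg G R v)" by simp
      ultimately show ?thesis using \<open>odd (dg G A v)\<close> False dep by (auto simp: zero_or_odd_def)
    next
      case False2: False
      then have "dg G A v = 0" "dg G B v = 0" using AB[of v] dL' False by auto
      moreover have "dg G R v = dg G E v" using dR[of v] dL'[of v] False False2 by auto
      ultimately show ?thesis using False dep odd_deg[OF v] by (auto simp: zero_or_odd_def)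
    qed
  qed
  then have "\<forall>v\<in>V. \<forall>i. zero_or_odd (dg G {e\<in>E. col e = i} v)"
    unfolding classes by (auto simp: zero_or_odd_def)
  moreover have "\<forall>e\<in>E. col e < 4" by (simp add: col_def)
  ultimately show ?thesis unfolding colorable_def by blast
qed

text \<open>In an st-ordering from \<open>c\<close> to \<open>p\<close> every increasing path extends to an increasing path ending
  in \<open>p\<close>, which closes up to a cycle through \<open>ep\<close>. Without even such cycles the parity of an
  increasing path from \<open>c\<close> depends on its end only.\<close>

lemma bipartition:
  assumes n: "\<not> colorable 3 G"
  obtains \<phi> :: "'a \<Rightarrow> bool" where "\<phi> p \<noteq> \<phi> q"
    "\<And>e x y. e \<in> E \<Longrightarrow> c \<notin> set_uprod (ends G e) \<Longrightarrow> ends G e = Upair x y \<Longrightarrow> \<phi> x \<noteq> \<phi> y"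
proof -
  obtain \<rho> :: "'a \<Rightarrow> nat" where \<rho>: "inj_on \<rho> V" "\<And>v. v \<in> V \<Longrightarrow> v \<noteq> c \<Longrightarrow> \<rho> c < \<rho> v"
    "\<And>v. v \<in> V \<Longrightarrow> v \<noteq> p \<Longrightarrow> \<rho> v < \<rho> p"
    "\<And>v. v \<in> V \<Longrightarrow> v \<noteq> c \<Longrightarrow> v \<noteq> p \<Longrightarrow> \<exists>e\<in>E. \<exists>u\<in>V. ends G e = Upair u v \<and> \<rho> u < \<rho> v"
    "\<And>v. v \<in> V \<Longrightarrow> v \<noteq> c \<Longrightarrow> v \<noteq> p \<Longrightarrow> \<exists>e\<in>E. \<exists>u\<in>V. ends G e = Upair v u \<and> \<rho> v < \<rho> u"
    using st_order[of c p] c pq by auto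
  let ?F = "E - {ep}"
  \<comment> \<open>\<open>b\<close> is the parity of the number of vertices, so the path consisting
    of \<open>c\<close> alone counts as odd.\<close>
  define par where "par v b \<longleftrightarrow> (\<exists>xs. pth G ?F V xs \<and> hd xs = c \<and> last xs = v \<and>
     sorted_wrt (\<lambda>x y. \<rho> x < \<rho> y) xs \<and> odd (length xs) = b)" for v b
  have par_c: "par c True"
    unfolding par_def using c by (intro exI[of _ "[c]"]) (auto simp: pth_def)
  have par_step: "par v (\<not> b)" if "par u b" "e \<in> ?F" "ends G e = Upair u v" "\<rho> u < \<rho> v" for u v b e
  proof -
    from \<open>par u b\<close> obtain xs where *: "pth G ?F V xs \<and> hd xs = c \<and> last xs = u \<and>
      sorted_wrt (\<lambda>x y. \<rho> x < \<rho> y) xs \<and> odd (length xs) = b" unfolding par_def ..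
    then have xs: "pth G ?F V xs" "hd xs = c" "last xs = u" "sorted_wrt (\<lambda>x y. \<rho> x < \<rho> y) xs" "odd (length xs) = b"
      by simp_all
    have lt: "\<rho> x < \<rho> v" if "x \<in> set xs" for x
    proof -
      obtain ys where ys: "xs = ys @ [u]" using append_butlast_last_id[of xs] xs(1,3) by (metis pth_def)
      have "sorted_wrt (\<lambda>x y. \<rho> x < \<rho> y) (ys @ [u])" "x \<in> set (ys @ [u])" using xs(4) \<open>x \<in> set xs\<close> ys by simp_all
      then have "\<rho> x \<le> \<rho> u" by (auto simp: sorted_wrt_append)
      then show ?thesis using \<open>\<rho> u < \<rho> v\<close> by simp
    qed
    have "v \<in> V" using that(2,3) ends_in_V by blast
    then have "pth G ?F V (xs @ [v])"
      using xs lt that by (intro pth_append[of _ _ _ _ _ e]) (auto simp: pth_def)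
    moreover have "hd (xs @ [v]) = c" using xs by (auto simp: pth_def)
    moreover have "sorted_wrt (\<lambda>x y. \<rho> x < \<rho> y) (xs @ [v])" using xs lt by (simp add: sorted_wrt_append)
    ultimately show ?thesis unfolding par_def using xs(5) by (intro exI[of _ "xs @ [v]"]) auto
  qed
  have noep: "e \<in> ?F" if "e \<in> E" "ends G e = Upair x y" "x \<noteq> c" "y \<noteq> c" for e x y
    using that ep by auto
  have ex_par: "\<exists>b. par v b" if "v \<in> V" for v
    using that
  proof (induction "\<rho> v" arbitrary: v rule: less_induct)
    case less
    have "\<exists>e\<in>?F. \<exists>u\<in>V. ends G e = Upair u v \<and> \<rho> u < \<rho> v" if "v \<noteq> c"
    proof (cases "v = p")
      case True
      then obtain e u where e: "e \<in> E" "u \<in> V" "u \<noteq> c" "ends G e = Upair u p" using no_isolated[of p c] c pq by blast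
      have "u \<noteq> p" using ends_in_V[OF e(1,4)] by simp
      then show ?thesis using e \<rho>(3)[of u] noep[OF e(1,4)] pq True by blast
    next
      case False
      then obtain e u where e: "e \<in> E" "u \<in> V" "ends G e = Upair u v" "\<rho> u < \<rho> v" using \<rho>(4)[OF less(2) \<open>v \<noteq> c\<close> False] by blast
      moreover have "e \<noteq> ep" using e(3) ep that False by auto
      ultimately show ?thesis by blast
    qed
    show ?case
    proof (cases "v = c")
      case True then show ?thesis using par_c by (intro exI[of _ True]) simp
    next
      case False
      then obtain e u where e: "e \<in> ?F" "u \<in> V" "ends G e = Upair u v" "\<rho> u < \<rho> v"
        using \<open>v \<noteq> c \<Longrightarrow> \<exists>e\<in>?F. \<exists>u\<in>V. ends G e = Upair u v \<and> \<rho> u < \<rho> v\<close> by blast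
      obtain b where "par u b" using less(1)[OF e(4,2)] ..
      from par_step[OF this e(1,3,4)] show ?thesis ..
    qed
  qed
  \<comment> \<open>\<open>k\<close> is the parity of the number of edges of one fixed increasing
    path from \<open>v\<close> to \<open>p\<close>, which can be appended to any increasing path
    ending in \<open>v\<close>.\<close>
  have up: "\<exists>k. \<forall>b. par v b \<longrightarrow> par p (b \<noteq> k)" if "v \<in> V" for v
    using that
  proof (induction "\<rho> p - \<rho> v" arbitrary: v rule: less_induct)
    case less
    show ?case
    proof (cases "v = p")
      case True then show ?thesis by (intro exI[of _ False]) auto
    next
      case False
      have "\<exists>e\<in>?F. \<exists>u\<in>V. ends G e = Upair v u \<and> \<rho> v < \<rho> u"
      proof (cases "v = c")
        case True
        then show ?thesis using eq ep_eq pq \<rho>(2)[of q] by blast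
      next
        case False2: False
        then obtain e u where e: "e \<in> E" "u \<in> V" "ends G e = Upair v u" "\<rho> v < \<rho> u" using \<rho>(5)[OF less(2) False2 False] by blast
        moreover have "e \<noteq> ep" using e(3) ep False False2 by auto
        ultimately show ?thesis by blast
      qed
      then obtain e u where e: "e \<in> ?F" "u \<in> V" "ends G e = Upair v u" "\<rho> v < \<rho> u" by blast
      have "\<rho> p - \<rho> u < \<rho> p - \<rho> v" using e(4) \<rho>(3)[OF less(2) False] by linarith
      then obtain k where k: "\<forall>b. par u b \<longrightarrow> par p (b \<noteq> k)" using less(1)[OF _ e(2)] by blast
      have "par p (b \<noteq> (\<not> k))" if "par v b" for b
      proof -
        have "par u (\<not> b)" using par_step[OF that e(1,3,4)] .
        then have "par p ((\<not> b) \<noteq> k)" using k by blast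
        moreover have "((\<not> b) \<noteq> k) = (b \<noteq> (\<not> k))" by blast
        ultimately show ?thesis by simp
      qed
      then show ?thesis by blast
    qed
  qed
  \<comment> \<open>Together with \<open>ep\<close>, such a path would be a cycle of even order
    through \<open>c\<close>.\<close>
  have pF: "\<not> par p False"
  proof
    assume "par p False"
    then obtain xs where xs: "pth G ?F V xs" "hd xs = c" "last xs = p" "even (length xs)" by (auto simp: par_def)
    obtain P where P: "P \<subseteq> inner G ?F (set xs)" "conn G P (set xs)"
      "\<And>v. dg G P v + of_bool (v = c) + of_bool (v = p) = 2 * of_bool (v \<in> set xs)"
      using pth_edges[OF xs(1)] xs by auto
    have PE: "P \<subseteq> E" "ep \<notin> P" using P(1) by (auto simp: inner_def)
    have xsV: "set xs \<subseteq> V" "c \<in> set xs" "p \<in> set xs" using xs by (auto simp: pth_def)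
    have d: "dg G (insert ep P) v = dg G P v + of_bool (v = c \<or> v = p)" for v
      using dg_insert[OF PE(1) ep(1) PE(2)] ep by auto
    have "colorable 3 G"
    proof (rule colorable_closed[of "insert ep P" "set xs"])
      show "conn G (insert ep P) (set xs)" using P(2) by (rule conn_mono) auto
      show "even (dg G (insert ep P) v)" for v
      proof -
        have "dg G (insert ep P) v = 2 * of_bool (v \<in> set xs)" using d[of v] P(3)[of v] pq xsV by auto
        then show ?thesis by simp
      qed
      show "even (card (set xs))" using xs by (simp add: pth_def distinct_card)
      show "set_uprod (ends G e) \<subseteq> set xs" if "e \<in> insert ep P" for e
        using that P(1) ep xsV by (auto simp: inner_def)
    qed (use PE ep xsV in auto)
    then show False using n by simp
  qed
  have uniq: "b = b'" if "v \<in> V" "par v b" "par v b'" for v b b'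
  proof -
    obtain k where k: "\<forall>b. par v b \<longrightarrow> par p (b \<noteq> k)" using up[OF \<open>v \<in> V\<close>] by blast
    then have "par p (b \<noteq> k)" "par p (b' \<noteq> k)" using that by blast+
    then have "b \<noteq> k" "b' \<noteq> k" using pF by (metis (full_types))+
    then show ?thesis by blast
  qed
  \<comment> \<open>These are the classes of \<open>G\<close> without \<open>ep\<close>. By
    \<open>pF\<close> the vertex \<open>p\<close> is in the class of \<open>c\<close>, while
    \<open>q\<close> is in the other one, so an edge \<open>pq\<close> fits the bipartition.\<close>
  define \<phi> where "\<phi> v \<longleftrightarrow> par v True" for v
  have \<phi>_iff: "\<phi> v = b" if "v \<in> V" "par v b" for v b
    using uniq[OF that] that unfolding \<phi>_def by (cases b) auto
  have proper: "\<phi> x \<noteq> \<phi> y" if e: "e \<in> ?F" "ends G e = Upair x y" for e x y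
  proof -
    have xy: "x \<in> V" "y \<in> V" "x \<noteq> y" using ends_in_V[of e x y] e by auto
    then have "\<rho> x \<noteq> \<rho> y" using inj_onD[OF \<rho>(1)] by blast
    have e': "ends G e = Upair y x" using e by auto
    obtain b where b: "par x b" using ex_par xy by blast
    obtain b' where b': "par y b'" using ex_par xy by blast
    show ?thesis
    proof (cases "\<rho> x < \<rho> y")
      case True
      show ?thesis using \<phi>_iff[OF xy(2) par_step[OF b e True]] \<phi>_iff[OF xy(1) b] by simp
    next
      case False
      then have "\<rho> y < \<rho> x" using \<open>\<rho> x \<noteq> \<rho> y\<close> by linarith
      from \<phi>_iff[OF xy(1) par_step[OF b' e(1) e' this]] \<phi>_iff[OF xy(2) b'] show ?thesis by simp
    qed
  qed
  obtain b where b: "par p b" using ex_par pq by blast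
  have "\<phi> p" using \<phi>_iff[OF pq(1) b] b pF by (cases b) auto
  moreover have "\<not> \<phi> q" using proper[of eq c q] eq ep_eq \<phi>_iff[OF c par_c] by auto
  moreover have "\<phi> x \<noteq> \<phi> y" if "e \<in> E" "c \<notin> set_uprod (ends G e)" "ends G e = Upair x y" for e x y
  proof -
    have "e \<noteq> ep" using that(2) ep by auto
    then show ?thesis using proper[of e x y] that by blast
  qed
  ultimately show ?thesis using that[of \<phi>] by blast
qed

end

section \<open>Contractions\<close>

definition good_at :: "('v, 'e) mgraph \<Rightarrow> ('e \<Rightarrow> nat) \<Rightarrow> 'v \<Rightarrow> bool" where
  "good_at G col v \<longleftrightarrow> (\<forall>i. zero_or_odd (dg G {e\<in>edges G. col e = i} v))"

lemma colorable_iff: "colorable k G \<longleftrightarrow> (\<exists>col. (\<forall>e\<in>edges G. col e < k) \<and> (\<forall>v\<in>verts G. good_at G col v))"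
  by (simp add: colorable_def good_at_def)

lemma dg_cong: "(\<And>e. v \<in> set_uprod (ends G e) \<Longrightarrow> e \<in> A \<longleftrightarrow> e \<in> B) \<Longrightarrow> dg G A v = dg G B v"
  unfolding dg_def by (rule arg_cong[where f = card]) auto

text \<open>\<open>m\<close> is meant to be a vertex of \<open>M\<close>, so that the type of
  vertices stays the same. Edges keep their names, and a coloring of the contraction is at once a
  partial coloring of \<open>G\<close>.\<close>

definition contract :: "('v, 'e) mgraph \<Rightarrow> 'v set \<Rightarrow> 'v \<Rightarrow> ('v, 'e) mgraph" where
  "contract G M m = \<lparr>verts = insert m (verts G - M), edges = edges G - inner G (edges G) M,
     ends = \<lambda>e. map_uprod (\<lambda>v. if v \<in> M then m else v) (ends G e)\<rparr>"

context lgraph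
begin

lemma good_mono:
  assumes "odd (dg G E v)" "\<And>e. e \<in> E \<Longrightarrow> v \<in> set_uprod (ends G e) \<Longrightarrow> col e = a"
  shows "good_at G col v"
  unfolding good_at_def
proof
  fix i
  have "dg G {e\<in>E. col e = i} v = dg G (if i = a then E else {}) v"
    by (rule dg_cong) (auto simp: assms(2))
  then show "zero_or_odd (dg G {e\<in>E. col e = i} v)" using assms(1) by (simp add: zero_or_odd_def)
qed

lemma good_3:
  assumes "E = A \<union> B \<union> C" "A \<inter> B = {}" "A \<inter> C = {}" "B \<inter> C = {}"
    "\<And>e. e \<in> A \<Longrightarrow> col e = a" "\<And>e. e \<in> B \<Longrightarrow> col e = b" "\<And>e. e \<in> C \<Longrightarrow> col e = d"
    "a \<noteq> b" "a \<noteq> d" "b \<noteq> d"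
    "zero_or_odd (dg G A v)" "zero_or_odd (dg G B v)" "zero_or_odd (dg G C v)"
  shows "good_at G col v"
  unfolding good_at_def
proof
  fix i
  have "{e\<in>E. col e = i} = (if i = a then A else if i = b then B else if i = d then C else {})"
    using assms(1-10) by (auto split: if_splits)
  then show "zero_or_odd (dg G {e\<in>E. col e = i} v)" using assms(11-13) by (simp add: zero_or_odd_def)
qed

text \<open>A set without boundary in \<open>L\<close> is a union of components, so that a coloring
  can be changed there without affecting the rest of \<open>L\<close>.\<close>

lemma dg_component:
  assumes "L \<subseteq> E" "cut G L U = {}" "F \<subseteq> L"
  shows "dg G (inner G F U) v = (if v \<in> U then dg G F v else 0)"
proof (cases "v \<in> U")
  case True
  have "dg G (inner G F U) v = dg G F v"
  proof (rule dg_cong)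
    fix e assume v: "v \<in> set_uprod (ends G e)"
    have "e \<notin> cut G L U" using assms(2) by simp
    then show "e \<in> inner G F U \<longleftrightarrow> e \<in> F" using v True assms(3) by (auto simp: cut_def inner_def)
  qed
  then show ?thesis using True by simp
qed (use dg_inner in auto)

lemma reach_cut:
  assumes "L \<subseteq> E"
  shows "cut G L {v. (r, v) \<in> (adj G L V)\<^sup>*} = {}"
proof (rule equals0I)
  fix e assume "e \<in> cut G L {v. (r, v) \<in> (adj G L V)\<^sup>*}"
  then obtain x y where e: "e \<in> L" "ends G e = Upair x y" "(r, x) \<in> (adj G L V)\<^sup>*" "(r, y) \<notin> (adj G L V)\<^sup>*"
    by (elim cutE) auto
  have "(x, y) \<in> adj G L V" using e assms ends_in_V[of e x y] by (intro adjI[OF e(1,2)]) auto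
  then show False using e by (meson rtrancl_into_rtrancl)
qed

lemma cut_compl: "cut G E (V - S) = cut G E S"
proof -
  have "e \<in> cut G E (V - S) \<longleftrightarrow> e \<in> cut G E S" if "e \<in> E" for e
  proof -
    obtain x y where xy: "ends G e = Upair x y" "x \<in> V" "y \<in> V" using \<open>e \<in> E\<close> by (rule ends_cases)
    show ?thesis unfolding cut_iff[OF xy(1)] using xy by auto
  qed
  then show ?thesis by (auto simp: cut_def)
qed

lemma odd_cut:
  assumes "S \<subseteq> V" "\<And>v. v \<in> S \<Longrightarrow> odd (dg G E v)"
  shows "odd (card (cut G E S)) \<longleftrightarrow> odd (card S)"
proof -
  have f: "finite S" using assms(1) finite_V by (rule finite_subset)
  then show ?thesis using handshake[of E S] even_sum_odd_card[of S "dg G E"] assms(2) by auto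
qed

end

context near_odd
begin

text \<open>The part of a coloring on a connected set around \<open>c\<close>: base color \<open>b\<close>, and colors \<open>a\<close> and
  \<open>z\<close> along a path from \<open>f\<close> to \<open>c\<close>.\<close>

lemma color_around_c:
  assumes Y: "Y \<subseteq> V" "c \<in> Y" "conn G E Y" and f: "f \<in> cut G E Y"
    and abz: "a \<noteq> b" "a \<noteq> z" "b \<noteq> z"
  shows "\<exists>col. col f = a \<and> (\<forall>e\<in>cut G E Y - {f}. col e = b) \<and> (\<forall>e. col e \<in> {a, b, z}) \<and> (\<forall>v\<in>Y. good_at G col v)"
proof -
  obtain u u' where u: "f \<in> E" "ends G f = Upair u u'" "u \<in> Y" "u' \<notin> Y" using f by (rule cutE)
  have finc: "v \<in> set_uprod (ends G f) \<longleftrightarrow> v = u" if "v \<in> Y" for v using that u by auto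
  show ?thesis
  proof (cases "u = c")
    case True
    \<comment> \<open>If \<open>f\<close> ends in \<open>c\<close>, the path is trivial: the other
      edge at \<open>c\<close> already has color \<open>b\<close>.\<close>
    define col where "col e = (if e = f then a else b)" for e
    have "good_at G col v" if v: "v \<in> Y" for v
    proof (cases "v = c")
      case False
      then have "col e = b" if "v \<in> set_uprod (ends G e)" for e using that finc[OF v] True by (auto simp: col_def)
      then show ?thesis using odd_deg[of v] v Y(1) False by (intro good_mono) auto
    next
      case vc: True
      have fe: "f = ep \<or> f = eq" using c_only[OF u(1)] u(2) True by auto
      have "dg G {f} v = 1" "dg G (E - {f}) v = 1"
        using dg_c_sub[of "{f}"] dg_c_sub[of "E - {f}"] fe ep_eq u(1) ep(1) eq(1) vc by auto
      then have *: "zero_or_odd (dg G {f} v)" "zero_or_odd (dg G (E - {f}) v)" by (simp_all add: zero_or_odd_def)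
      show ?thesis
      proof (rule good_3[of "{f}" "E - {f}" "{}" _ a b z])
        show "zero_or_odd (dg G {f} v)" "zero_or_odd (dg G (E - {f}) v)" by (fact *)+
      qed (use u abz in \<open>auto simp: col_def zero_or_odd_def\<close>)
    qed
    moreover have "\<forall>e\<in>cut G E Y - {f}. col e = b" by (auto simp: col_def)
    ultimately show ?thesis by (intro exI[of _ col]) (auto simp: col_def)
  next
    case False
    have "(u, c) \<in> (adj G E Y)\<^sup>*" using Y u unfolding conn_def by blast
    from path_join[OF this order_refl]
    obtain L where L: "L \<subseteq> inner G E Y" "\<And>v. odd (dg G L v) \<longleftrightarrow> (v = u) \<noteq> (v = c)"
      by auto
    have LE: "L \<subseteq> E" using L(1) by (auto simp: inner_def)
    have Lc: "dg G L c = 1"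
    proof -
      have "odd (dg G L c)" "dg G L c \<le> 2" using L(2)[of c] False dg_mono[OF LE order_refl, of c] dg_c by auto
      then show ?thesis by (auto simp: le_Suc_eq numeral_2_eq_2)
    qed
    define K where "K = {v. (c, v) \<in> (adj G L V)\<^sup>*}"
    have Kcut: "cut G L K = {}" unfolding K_def using LE by (rule reach_cut)
    have KV: "K \<subseteq> V" using adj_rtrancl_in[of c _ G L V] c by (auto simp: K_def)
    have cK: "c \<in> K" by (simp add: K_def)
    obtain y where "y \<noteq> c" "odd (dg G L y)" "(c, y) \<in> (adj G L V)\<^sup>*" using comp_meets[OF LE _ c] Lc by auto
    then have uK: "u \<in> K" using L(2)[of y] by (auto simp: K_def)
    \<comment> \<open>\<open>c\<close> has \<open>L\<close>-degree one and is free. The vertex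
      \<open>u\<close> is left out because \<open>f\<close> supplies an edge of color
      \<open>a\<close> there; all other vertices of the component get odd degree in both
      parts.\<close>
    have "\<exists>A\<subseteq>inner G L V. \<forall>v. v \<notin> {c} \<longrightarrow> (odd (dg G A v) \<longleftrightarrow> v \<in> K - {c, u})"
    proof (intro join_free)
      show "\<forall>v\<in>K - {c, u}. \<exists>x\<in>{c}. (v, x) \<in> (adj G L V)\<^sup>*" by (auto simp: K_def intro: adj_rtrancl_sym)
      show "finite (K - {c, u})" using KV finite_subset[of K V] by auto
    qed (use LE in auto)
    then obtain A0 where A0: "A0 \<subseteq> L" "\<And>v. v \<noteq> c \<Longrightarrow> odd (dg G A0 v) \<longleftrightarrow> v \<in> K - {c, u}" by (auto simp: inner_def)
    define L1 where "L1 = inner G L K"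
    define A where "A = inner G A0 K"
    define B where "B = L1 - A"
    have AL: "A \<subseteq> L1" "L1 \<subseteq> E" "B \<subseteq> E" "A \<subseteq> E" using A0(1) LE by (auto simp: A_def L1_def B_def inner_def)
    have dA: "dg G A v = (if v \<in> K then dg G A0 v else 0)" for v unfolding A_def using LE Kcut A0(1) by (rule dg_component)
    have dL1: "dg G L1 v = (if v \<in> K then dg G L v else 0)" for v unfolding L1_def using LE Kcut by (rule dg_component) simp
    have dAB: "dg G L1 v = dg G B v + dg G A v" for v unfolding B_def using AL by (intro dg_Diff)
    have fL: "f \<notin> L" using L(1) f by (auto simp: inner_def cut_def)
    then have fL1: "f \<notin> L1" "f \<notin> A" using AL by (auto simp: L1_def inner_def)
    have dfA: "dg G (insert f A) v = dg G A v + of_bool (v = u)" if "v \<in> Y" for v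
      using dg_insert[OF AL(4) u(1) fL1(2)] finc[OF that] by auto
    define C where "C = E - insert f L1"
    have dE: "dg G E v = dg G C v + dg G L1 v + of_bool (v = u)" if "v \<in> Y" for v
      using dg_insert[OF AL(2) u(1) fL1(1), of v] finc[OF that] dg_Diff[of "insert f L1" E v] AL u(1) by (auto simp: C_def)
    define col where "col e = (if e \<in> insert f A then a else if e \<in> B then z else b)" for e
    have "good_at G col v" if v: "v \<in> Y" for v
    proof (rule good_3[of "insert f A" B C _ a z b])
      show "E = insert f A \<union> B \<union> C" using AL u(1) by (auto simp: C_def B_def)
      show "zero_or_odd (dg G (insert f A) v)"
      proof (cases "v = c")
        case True
        then have "dg G A v \<le> 1" using dAB[of c] dL1[of c] Lc cK by auto
        then show ?thesis using dfA[OF v] True False by (auto simp: zero_or_odd_def le_Suc_eq)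
      next
        case vc: False
        show ?thesis using dfA[OF v] dA[of v] A0(2)[OF vc] uK by (cases "v = u"; cases "v \<in> K") (auto simp: zero_or_odd_def vc)
      qed
      show "zero_or_odd (dg G B v)"
      proof (cases "v = c")
        case True
        then have "dg G B v \<le> 1" using dAB[of c] dL1[of c] Lc cK by auto
        then show ?thesis by (auto simp: zero_or_odd_def le_Suc_eq)
      next
        case vc: False
        show ?thesis
        proof (cases "v \<in> K")
          case True
          then have "odd (dg G A v) \<longleftrightarrow> v \<noteq> u" "odd (dg G L1 v) \<longleftrightarrow> v = u" using dA[of v] dL1[of v] A0(2)[OF vc] L(2)[of v] vc by auto
          then have "odd (dg G B v)" using dAB[of v] by (metis even_add)
          then show ?thesis by (simp add: zero_or_odd_def)
        next
          case False
          then show ?thesis using dAB[of v] dL1[of v] by (simp add: zero_or_odd_def)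
        qed
      qed
      show "zero_or_odd (dg G C v)"
      proof (cases "v = c")
        case True
        then have "dg G C v = 1" using dE[OF v] dL1[of c] Lc cK dg_c False by auto
        then show ?thesis by (simp add: zero_or_odd_def)
      next
        case vc: False
        have "odd (dg G E v)" using odd_deg v Y vc by auto
        moreover have "even (dg G L1 v + of_bool (v = u))"
          using dL1[of v] L(2)[of v] vc uK by (cases "v = u"; cases "v \<in> K") auto
        ultimately show ?thesis using dE[OF v] by (auto simp: zero_or_odd_def)
      qed
    qed (use abz fL1 AL in \<open>auto simp: B_def C_def col_def\<close>)
    moreover have "e \<notin> L1" if "e \<in> cut G E Y" for e using that L(1) by (auto simp: L1_def inner_def cut_def)
    then have "\<forall>e\<in>cut G E Y - {f}. col e = b" using AL by (auto simp: col_def B_def)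
    ultimately show ?thesis by (intro exI[of _ col]) (auto simp: col_def)
  qed
qed

end

section \<open>Degrees, cuts and connectedness of contractions\<close>

lemma contract_simps [simp]:
  "verts (contract G M m) = insert m (verts G - M)"
  "edges (contract G M m) = edges G - inner G (edges G) M"
  "ends (contract G M m) e = map_uprod (\<lambda>v. if v \<in> M then m else v) (ends G e)"
  by (simp_all add: contract_def)

context lgraph
begin

lemma inner_iff: "ends G e = Upair x y \<Longrightarrow> e \<in> inner G F M \<longleftrightarrow> e \<in> F \<and> x \<in> M \<and> y \<in> M"
  by (auto simp: inner_def)

lemma contract_lgraph:
  assumes "M \<subseteq> V" "m \<in> M"
  shows "lgraph (contract G M m)"
proof
  show "Defs.multigraph (contract G M m)"
    using multigraph assms by (auto simp: multigraph_def uprod.set_map)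
  show "Defs.loopless (contract G M m)"
    unfolding loopless_def
  proof (intro ballI allI notI)
    fix e v assume e: "e \<in> edges (contract G M m)" "ends (contract G M m) e = Upair v v"
    then have "e \<in> E" by simp
    then obtain x y where xy: "ends G e = Upair x y" "x \<noteq> y" by (rule ends_cases)
    then have "\<not> (x \<in> M \<and> y \<in> M)" using e inner_iff[OF xy(1)] by auto
    then show False using e xy assms by (auto split: if_splits)
  qed
qed

lemma contract_dg:
  assumes "v \<notin> M" "m \<in> M"
  shows "dg (contract G M m) F v = dg G F v"
proof -
  have "v \<in> set_uprod (map_uprod (\<lambda>v. if v \<in> M then m else v) (ends G e)) \<longleftrightarrow> v \<in> set_uprod (ends G e)" for e
    using assms by (auto simp: uprod.set_map)
  then show ?thesis by (simp add: dg_def)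
qed

lemma contract_dg_m:
  assumes "M \<subseteq> V" "m \<in> M" "F \<subseteq> edges (contract G M m)"
  shows "dg (contract G M m) F m = card (F \<inter> cut G E M)"
proof -
  have "{e\<in>F. m \<in> set_uprod (ends (contract G M m) e)} = F \<inter> cut G E M"
    using assms by (auto simp: uprod.set_map inner_def cut_def split: if_splits)
  then show ?thesis by (simp add: dg_def)
qed

text \<open>The cuts of the contraction are the cuts of \<open>G\<close> that do not separate
  \<open>M\<close>, so lower bounds on cut sizes are inherited.\<close>

lemma contract_cut:
  assumes "M \<subseteq> V" "m \<in> M" "X \<subseteq> verts (contract G M m)"
  shows "cut (contract G M m) (edges (contract G M m)) X = cut G E (if m \<in> X then X \<union> M else X)"
    (is "?L = cut G E ?X")
proof -
  have "e \<in> ?L \<longleftrightarrow> e \<in> cut G E ?X" if "e \<in> E" for e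
  proof -
    obtain x y where xy: "ends G e = Upair x y" "x \<noteq> y" using \<open>e \<in> E\<close> by (rule ends_cases)
    have h: "(if v \<in> M then m else v) \<in> X \<longleftrightarrow> v \<in> ?X" for v using assms by auto
    have *: "ends (contract G M m) e = Upair (if x \<in> M then m else x) (if y \<in> M then m else y)" using xy by simp
    have "(x \<in> ?X) = (y \<in> ?X)" if "e \<in> inner G E M"
      using h[of x] h[of y] that inner_iff[OF xy(1)] by simp
    then show ?thesis unfolding cut_iff[OF *] cut_iff[OF xy(1)] h using that by auto
  qed
  moreover have "?L \<subseteq> E" "cut G E ?X \<subseteq> E" by (auto simp: cut_def)
  ultimately show ?thesis by blast
qed

end

context tgraph
begin

text \<open>Removing \<open>m\<close> leaves \<open>V - M\<close>, and removing any other vertex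
  \<open>v\<close> leaves the image of \<open>G - v\<close> under the contraction.\<close>

lemma contract_tgraph:
  assumes M: "M \<subseteq> V" "m \<in> M" "conn G E (V - M)" "card (V - M) \<ge> 2"
  shows "tgraph (contract G M m)"
proof -
  let ?G = "contract G M m"
  let ?h = "\<lambda>v. if v \<in> M then m else v"
  interpret G1: lgraph ?G using M by (intro contract_lgraph)
  show ?thesis
  proof
    have "card (verts ?G) = Suc (card (V - M))" using M by simp
    then show "card (verts ?G) \<ge> 3" using M(4) by simp
    fix v assume v: "v \<in> verts ?G"
    show "conn ?G (edges ?G) (verts ?G - {v})"
    proof (cases "v = m")
      case True
      show ?thesis
      proof (rule conn_image[OF M(3), where h = id])
        fix x y e assume "x \<in> V - M" "y \<in> V - M" "e \<in> E" "ends G e = Upair x y"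
        then have "(x, y) \<in> adj ?G (edges ?G) (verts ?G - {v})"
          using True M(2) by (intro adjI[of e]) (auto simp: inner_def)
        then show "(id x, id y) \<in> (adj ?G (edges ?G) (verts ?G - {v}))\<^sup>*" by auto
      qed (use True M in auto)
    next
      case False
      then have vM: "v \<in> V - M" using v by auto
      then have "conn G E (V - {v})" by (intro del_conn) auto
      then show ?thesis
      proof (rule conn_image[where h = ?h])
        fix x y e assume e: "x \<in> V - {v}" "y \<in> V - {v}" "e \<in> E" "ends G e = Upair x y"
        show "(?h x, ?h y) \<in> (adj ?G (edges ?G) (verts ?G - {v}))\<^sup>*"
        proof (cases "x \<in> M \<and> y \<in> M")
          case True then show ?thesis by simp
        next
          case False2: False
          then have "(?h x, ?h y) \<in> adj ?G (edges ?G) (verts ?G - {v})"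
            using e False vM M by (intro adjI[of e]) (auto simp: inner_def)
          then show ?thesis by blast
        qed
      next
        fix z assume "z \<in> verts ?G - {v}"
        then have "?h z = z" "z \<in> V - {v}" using M vM by auto
        then have "z \<in> V - {v} \<and> (z, ?h z) \<in> (adj ?G (edges ?G) (verts ?G - {v}))\<^sup>*" by simp
        then show "\<exists>x\<in>V - {v}. (z, ?h x) \<in> (adj ?G (edges ?G) (verts ?G - {v}))\<^sup>*" by blast
      qed
    qed
  qed
qed

end

section \<open>Contracting a set that avoids \<open>c\<close>, and undoing this along a 3-edge
  cut\<close>

context near_odd
begin

text \<open>The new vertex has the size of the cut as its degree, so an odd cut is what keeps
  \<open>c\<close> the only vertex of even degree.\<close>

lemma contract_near_odd:
  assumes M: "M \<subseteq> V" "m \<in> M" "conn G E (V - M)" "card (V - M) \<ge> 2" "c \<notin> M" "odd (card (cut G E M))"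
  shows "near_odd (contract G M m) c ep eq (if p \<in> M then m else p) (if q \<in> M then m else q)"
proof -
  let ?G = "contract G M m"
  interpret G1: tgraph ?G using M by (intro contract_tgraph)
  show ?thesis
  proof
    show "c \<in> verts ?G" using c M by simp
    show "ep \<in> edges ?G" "eq \<in> edges ?G" using ep eq M(5) by (auto simp: inner_def)
    show "ends ?G ep = Upair c (if p \<in> M then m else p)" "ends ?G eq = Upair c (if q \<in> M then m else q)"
      using ep eq M by auto
    show "e = ep \<or> e = eq" if "e \<in> edges ?G" "c \<in> set_uprod (ends ?G e)" for e
      using that c_only[of e] M by (auto simp: uprod.set_map split: if_splits)
    fix v assume v: "v \<in> verts ?G" "v \<noteq> c"
    show "odd (dg ?G (edges ?G) v)"
    proof (cases "v = m")
      case True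
      have "edges ?G \<inter> cut G E M = cut G E M" by (auto simp: cut_def inner_def)
      then show ?thesis using contract_dg_m[OF M(1,2), of "edges ?G"] M(6) True by simp
    next
      case False
      then have "v \<notin> M" "v \<in> V" using v by auto
      moreover have "dg G (edges ?G) v = dg G E v"
        using \<open>v \<notin> M\<close> by (intro dg_cong) (auto simp: inner_def)
      ultimately show ?thesis using contract_dg[OF _ M(2)] odd_deg v(2) by simp
    qed
  qed (rule ep_eq)
qed

text \<open>A bipartition of \<open>G - c + pq\<close>; the condition on \<open>p\<close> and
  \<open>q\<close> stands for the added edge.\<close>

definition proper2 :: "('a \<Rightarrow> bool) \<Rightarrow> bool" where
  "proper2 \<phi> \<longleftrightarrow> \<phi> p \<noteq> \<phi> q \<and>
     (\<forall>e\<in>E. \<forall>x y. c \<notin> set_uprod (ends G e) \<longrightarrow> ends G e = Upair x y \<longrightarrow> \<phi> x \<noteq> \<phi> y)"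

lemma ex_proper2: "\<not> colorable 3 G \<Longrightarrow> \<exists>\<phi>. proper2 \<phi>"
  using bipartition unfolding proper2_def by (metis (no_types, lifting))

lemma proper2_pth:
  assumes "proper2 \<phi>" "pth G E (V - {c}) xs"
  shows "(\<phi> (hd xs) = \<phi> (last xs)) \<longleftrightarrow> odd (length xs)"
  using assms(2)
proof (induction xs rule: induct_list012)
  case 1
  then show ?case by (simp add: pth_def)
next
  case (3 x y zs)
  have "pth G E (V - {c}) (y # zs)" using 3(3) pth_drop[of G E "V - {c}" "[x]" y zs] by simp
  then have IH: "(\<phi> y = \<phi> (last (y # zs))) \<longleftrightarrow> odd (length (y # zs))" using 3(2) by simp
  obtain e where e: "e \<in> E" "ends G e = Upair x y" "x \<noteq> c" "y \<noteq> c" using 3(3) by (auto simp: pth_def)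
  then have "c \<notin> set_uprod (ends G e)" by auto
  then have "\<phi> x \<noteq> \<phi> y" using assms(1) e unfolding proper2_def by blast
  then show ?case using IH by auto
qed simp

text \<open>The path closes up through \<open>c\<close> to a cycle, and a path through
  \<open>D\<close> gives a second closed walk that meets it in \<open>v\<close> only. As
  \<open>d1\<close> and \<open>d2\<close> are both neighbors of \<open>v\<close>, the bipartition
  makes the number of vertices used in \<open>D\<close> odd, while \<open>xs\<close> has even order;
  together with \<open>c\<close> the union has even order. Parallel edges with
  \<open>d1 = d2\<close> are included.\<close>

lemma colorable_two_edges:
  assumes \<phi>: "proper2 \<phi>" and xs: "pth G E (V - {c}) xs" "hd xs = p" "last xs = q"
    and D: "D \<subseteq> V - {c} - set xs" "conn G E D" and v: "v \<in> set xs"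
    and f: "f1 \<in> E" "f2 \<in> E" "f1 \<noteq> f2" "ends G f1 = Upair v d1" "ends G f2 = Upair v d2" "d1 \<in> D" "d2 \<in> D"
  shows "colorable 3 G"
proof -
  obtain ys where ys: "pth G E D ys" "hd ys = d1" "last ys = d2" using conn_pth[OF D(2) f(6,7)] by blast
  obtain P where P: "P \<subseteq> inner G E (set xs)" "conn G P (set xs)"
      "\<And>v. dg G P v + of_bool (v = p) + of_bool (v = q) = 2 * of_bool (v \<in> set xs)"
    using pth_edges[OF xs(1)] xs by auto
  obtain Q where Q: "Q \<subseteq> inner G E (set ys)" "conn G Q (set ys)"
      "\<And>v. dg G Q v + of_bool (v = d1) + of_bool (v = d2) = 2 * of_bool (v \<in> set ys)"
    using pth_edges[OF ys(1)] ys by auto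
  have xsV: "set xs \<subseteq> V - {c}" "p \<in> set xs" "q \<in> set xs" using xs by (auto simp: pth_def)
  have ysD: "set ys \<subseteq> D" "d1 \<in> set ys" "d2 \<in> set ys" using ys by (auto simp: pth_def)
  have disj: "set xs \<inter> set ys = {}" "c \<notin> set ys" "c \<notin> set xs" using xsV ysD D by auto
  have sub: "P \<subseteq> E" "Q \<subseteq> E" using P Q by (auto simp: inner_def)
  have vc: "v \<noteq> c" "v \<notin> set ys" using v disj by auto
  define L where "L = P \<union> Q"
  have "P \<inter> Q = {}"
  proof (rule equals0I)
    fix e assume "e \<in> P \<inter> Q"
    moreover obtain x y where "ends G e = Upair x y" by (rule uprod_ends)
    ultimately have "x \<in> set xs" "x \<in> set ys" using P(1) Q(1) by (auto simp: inner_def)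
    then show False using disj by blast
  qed
  then have dL: "dg G L w = dg G P w + dg G Q w" for w unfolding L_def using sub by (intro dg_Un)
  have LE: "L \<subseteq> E" using sub by (simp add: L_def)
  have inL: "set_uprod (ends G e) \<subseteq> set xs \<or> set_uprod (ends G e) \<subseteq> set ys" if "e \<in> L" for e
    using that P(1) Q(1) by (auto simp: L_def inner_def)
  have nL: "ep \<notin> L" "eq \<notin> L" "f1 \<notin> L" "f2 \<notin> L"
    using inL[of ep] inL[of eq] inL[of f1] inL[of f2] ep eq f disj ysD v by auto
  have nf: "ep \<noteq> f1" "ep \<noteq> f2" "eq \<noteq> f1" "eq \<noteq> f2" using ep eq f vc ysD D disj by auto
  define L' where "L' = insert ep (insert eq (insert f1 (insert f2 L)))"
  have d: "dg G L' w = dg G P w + dg G Q w + of_bool (w = c \<or> w = p) + of_bool (w = c \<or> w = q)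
     + of_bool (w = v \<or> w = d1) + of_bool (w = v \<or> w = d2)" for w
  proof -
    have "dg G (insert f2 L) w = dg G L w + of_bool (w = v \<or> w = d2)" using dg_insert[OF LE f(2) nL(4), of w] f by auto
    moreover have "dg G (insert f1 (insert f2 L)) w = dg G (insert f2 L) w + of_bool (w = v \<or> w = d1)"
      using dg_insert[of "insert f2 L" f1 w] LE f nL by auto
    moreover have "dg G (insert eq (insert f1 (insert f2 L))) w = dg G (insert f1 (insert f2 L)) w + of_bool (w = c \<or> w = q)"
      using dg_insert[of "insert f1 (insert f2 L)" eq w] LE f nL eq nf by auto
    moreover have "dg G L' w = dg G (insert eq (insert f1 (insert f2 L))) w + of_bool (w = c \<or> w = p)"
      unfolding L'_def using dg_insert[of "insert eq (insert f1 (insert f2 L))" ep w] LE f nL ep eq nf ep_eq by auto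
    ultimately show ?thesis using dL by simp
  qed
  define U where "U = insert c (set xs \<union> set ys)"
  have c1: "conn G L' (set xs)" "conn G L' (set ys)" using P(2) Q(2) by (auto elim!: conn_mono simp: L'_def L_def)
  have fL: "f1 \<in> L'" "ep \<in> L'" by (simp_all add: L'_def)
  have "ends G ep = Upair p c" using ep by auto
  from conn_insert[OF conn_Un_edge[OF c1 v ysD(2) fL(1) f(4)] _ fL(2) this] have "conn G L' U"
    unfolding U_def using xsV by simp
  moreover have "even (dg G L' w)" for w
  proof -
    have "v \<noteq> d1" "v \<noteq> d2" using vc ysD by auto
    then have "even (dg G L' w) \<longleftrightarrow> even (dg G P w + of_bool (w = p) + of_bool (w = q) + (dg G Q w + of_bool (w = d1) + of_bool (w = d2)))"
      using d[of w] pq by (cases "w = c"; cases "w = v") auto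
    then show ?thesis unfolding P(3) Q(3) by simp
  qed
  moreover have "even (card U)"
  proof -
    have "even (length xs)" using proper2_pth[OF \<phi> xs(1)] xs \<phi> by (auto simp: proper2_def)
    moreover have "odd (length ys)"
    proof -
      have "c \<notin> set_uprod (ends G f1)" "c \<notin> set_uprod (ends G f2)" using f vc D by auto
      then have "\<phi> d1 = \<phi> d2" using \<phi> f unfolding proper2_def by metis
      moreover have "pth G E (V - {c}) ys" using ys(1) by (rule pth_mono) (use ysD D in auto)
      ultimately show ?thesis using proper2_pth[OF \<phi>, of ys] ys by simp
    qed
    moreover have "card U = Suc (length xs + length ys)"
      unfolding U_def using disj xs(1) ys(1) by (simp add: card_Un_disjoint distinct_card pth_def)
    ultimately show ?thesis by simp
  qed
  moreover have "set_uprod (ends G e) \<subseteq> U" if "e \<in> L'" for e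
    using that P(1) Q(1) ep eq f xsV ysD v by (auto simp: L'_def L_def inner_def U_def)
  moreover have "L' \<subseteq> E" "U \<subseteq> V" "c \<in> U" using LE ep eq f xsV ysD D c by (auto simp: L'_def U_def)
  ultimately show ?thesis using colorable_closed[of L' U] by blast
qed

text \<open>A 3-edge cut is colored with one or with three colors by a coloring of the contraction. In
  the second case two of its edges have their ends in the contracted set in the same class of the
  bipartition; they are joined by a path of odd order, on which their colors alternate.\<close>

lemma colorable_uncontract:
  assumes \<phi>: "proper2 \<phi>" and M: "M \<subseteq> V" "m \<in> M" "conn G E M" "c \<notin> M" "card (cut G E M) = 3"
    and col: "colorable 3 (contract G M m)"
  shows "colorable 3 G"
proof -
  let ?G = "contract G M m"
  let ?I = "inner G E M"
  interpret G1: lgraph ?G using M by (intro contract_lgraph)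
  obtain \<kappa> where \<kappa>: "\<And>e. e \<in> edges ?G \<Longrightarrow> \<kappa> e < 3" "\<And>v. v \<in> verts ?G \<Longrightarrow> good_at ?G \<kappa> v"
    using col unfolding colorable_iff by blast
  have cutG: "cut G E M \<subseteq> edges ?G" "cut G E M \<inter> ?I = {}" "cut G E M \<subseteq> E" by (auto simp: cut_def inner_def)
  have at_M: "e \<in> ?I \<or> e \<in> cut G E M" if "e \<in> E" "v \<in> M" "v \<in> set_uprod (ends G e)" for e v
    using that by (auto simp: cut_def inner_def)
  have out: "good_at G col v" if v: "v \<in> V - M" and col: "\<And>e. e \<in> E - ?I \<Longrightarrow> col e = \<kappa> e" for v col
    unfolding good_at_def
  proof
    fix i
    have "dg G {e\<in>E. col e = i} v = dg G {e\<in>edges ?G. \<kappa> e = i} v"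
    proof (rule dg_cong)
      fix e assume "v \<in> set_uprod (ends G e)"
      then have "e \<notin> ?I" using v by (auto simp: inner_def)
      then show "e \<in> {e\<in>E. col e = i} \<longleftrightarrow> e \<in> {e\<in>edges ?G. \<kappa> e = i}" using col[of e] by auto
    qed
    also have "\<dots> = dg ?G {e\<in>edges ?G. \<kappa> e = i} v" using contract_dg[of v M m] v M(2) by simp
    finally show "zero_or_odd (dg G {e\<in>E. col e = i} v)" using \<kappa>(2)[of v] v unfolding good_at_def by auto
  qed
  have num: "zero_or_odd (card {e\<in>cut G E M. \<kappa> e = i})" for i
  proof -
    have "{e\<in>edges ?G. \<kappa> e = i} \<inter> cut G E M = {e\<in>cut G E M. \<kappa> e = i}" using cutG by auto
    moreover have "{e\<in>edges ?G. \<kappa> e = i} \<subseteq> edges ?G" by blast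
    ultimately have "dg ?G {e\<in>edges ?G. \<kappa> e = i} m = card {e\<in>cut G E M. \<kappa> e = i}"
      using contract_dg_m[OF M(1,2)] by metis
    moreover have "zero_or_odd (dg ?G {e\<in>edges ?G. \<kappa> e = i} m)"
      using \<kappa>(2)[of m] unfolding good_at_def by simp
    ultimately show ?thesis by simp
  qed
  obtain f1 f2 f3 where f: "cut G E M = {f1, f2, f3}" "f1 \<noteq> f2" "f1 \<noteq> f3" "f2 \<noteq> f3"
    using M(5) by (auto simp: card_3_iff)
  have oddM: "odd (dg G E v)" if "v \<in> M" for v using odd_deg[of v] that M by auto
  show ?thesis
  proof (cases "\<kappa> f1 = \<kappa> f2 \<and> \<kappa> f1 = \<kappa> f3")
    case True
    define col where "col e = (if e \<in> ?I then \<kappa> f1 else \<kappa> e)" for e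
    have "good_at G col v" if "v \<in> V" for v
    proof (cases "v \<in> M")
      case True2: True
      have "col e = \<kappa> f1" if "e \<in> E" "v \<in> set_uprod (ends G e)" for e
        using at_M[OF that(1) True2 that(2)] f(1) True by (auto simp: col_def)
      then show ?thesis using oddM[OF True2] by (intro good_mono) auto
    next
      case False
      then show ?thesis using that by (intro out) (auto simp: col_def)
    qed
    moreover have "col e < 3" if "e \<in> E" for e using that \<kappa>(1)[of e] \<kappa>(1)[of f1] cutG(1) f(1) by (auto simp: col_def)
    ultimately show ?thesis unfolding colorable_iff by blast
  next
    case False
    \<comment> \<open>Two edges of the same color at \<open>m\<close> without the third would be a
      positive even number, so the colors agree on all three edges or are all different.\<close>
    have dist: "\<kappa> f1 \<noteq> \<kappa> f2 \<and> \<kappa> f1 \<noteq> \<kappa> f3 \<and> \<kappa> f2 \<noteq> \<kappa> f3"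
    proof (rule ccontr)
      assume n: "\<not> ?thesis"
      have *: "False" if "\<kappa> a = \<kappa> b" "\<kappa> a \<noteq> \<kappa> d" "cut G E M = {a, b, d}" "a \<noteq> b" for a b d
      proof -
        have "{e\<in>cut G E M. \<kappa> e = \<kappa> a} = {a, b}" using that by auto
        then show False using num[of "\<kappa> a"] that(4) by (simp add: zero_or_odd_def)
      qed
      show False
        using n False *[of f1 f2 f3] *[of f1 f3 f2] *[of f2 f3 f1] f by (auto simp: insert_commute)
    qed
    have end_M: "\<exists>u\<in>M. \<exists>u'. u' \<notin> M \<and> ends G e = Upair u u'" if "e \<in> cut G E M" for e
      using that by (elim cutE) blast
    obtain u1 u2 u3 where u: "u1 \<in> M" "u2 \<in> M" "u3 \<in> M" "\<exists>u'. u' \<notin> M \<and> ends G f1 = Upair u1 u'"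
      "\<exists>u'. u' \<notin> M \<and> ends G f2 = Upair u2 u'" "\<exists>u'. u' \<notin> M \<and> ends G f3 = Upair u3 u'"
      using end_M f(1) by (metis insertCI)
    have main: "colorable 3 G" if g: "cut G E M = {g1, g2, g3}" "\<kappa> g1 \<noteq> \<kappa> g2" "\<kappa> g1 \<noteq> \<kappa> g3" "\<kappa> g2 \<noteq> \<kappa> g3"
      and w: "w1 \<in> M" "w2 \<in> M" "\<exists>u'. u' \<notin> M \<and> ends G g1 = Upair w1 u'" "\<exists>u'. u' \<notin> M \<and> ends G g2 = Upair w2 u'"
      and same: "\<phi> w1 = \<phi> w2" for g1 g2 g3 w1 w2
    proof -
      obtain xs where xs: "pth G E M xs" "hd xs = w1" "last xs = w2" using conn_pth[OF M(3) w(1,2)] by blast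
      have xsM: "set xs \<subseteq> M" "w1 \<in> set xs" "w2 \<in> set xs" using xs by (auto simp: pth_def)
      obtain P where P: "P \<subseteq> inner G E (set xs)" "conn G P (set xs)"
        "\<And>v. dg G P v + of_bool (v = w1) + of_bool (v = w2) = 2 * of_bool (v \<in> set xs)"
        using pth_edges[OF xs(1)] xs by auto
      have "pth G E (V - {c}) xs" using xs(1) by (rule pth_mono) (use xsM M in auto)
      then have "odd (length xs)" using proper2_pth[OF \<phi>, of xs] xs same by simp
      then have oc: "odd (card (set xs))" using xs(1) by (simp add: pth_def distinct_card)
      have PE: "P \<subseteq> E" "P \<subseteq> ?I" using P(1) xsM by (auto simp: inner_def)
      \<comment> \<open>\<open>g1\<close> already supplies its color at \<open>w1\<close>, so
        \<open>A\<close> must be odd at exactly the other vertices of the path, whose number is even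
        because the path has odd order. The complement \<open>B\<close> then fits with
        \<open>g2\<close> at \<open>w2\<close>.\<close>
      have "even (card (set xs - {w1}))" using oc xsM(2) card_Suc_Diff1[of "set xs" w1] by (metis List.finite_set even_Suc)
      then have "\<exists>A\<subseteq>inner G P (set xs). \<forall>v. odd (dg G A v) \<longleftrightarrow> v \<in> set xs - {w1}"
        using xsM M(1) PE P(2) by (intro tjoin) auto
      then obtain A where A: "A \<subseteq> P" "\<And>v. odd (dg G A v) \<longleftrightarrow> v \<in> set xs - {w1}" by (auto simp: inner_def)
      define B where "B = P - A"
      define C where "C = insert g3 (?I - P)"
      define col where "col e = (if e \<in> A then \<kappa> g1 else if e \<in> B then \<kappa> g2 else if e \<in> ?I then \<kappa> g3 else \<kappa> e)" for e
      have gE: "g1 \<in> E" "g2 \<in> E" "g3 \<in> E" "g1 \<notin> ?I" "g2 \<notin> ?I" "g3 \<notin> ?I" using g(1) cutG by auto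
      have gd: "g1 \<noteq> g2" "g1 \<noteq> g3" "g2 \<noteq> g3" using g by auto
      have in1: "v \<in> set_uprod (ends G g1) \<longleftrightarrow> v = w1" "v \<in> set_uprod (ends G g2) \<longleftrightarrow> v = w2" if "v \<in> M" for v
        using w that by auto
      have ABE: "A \<subseteq> E" "B \<subseteq> E" "g1 \<notin> A" "g2 \<notin> B" using A PE gE by (auto simp: B_def)
      have dB: "dg G P v = dg G B v + dg G A v" for v unfolding B_def using A PE by (intro dg_Diff)
      have "good_at G col v" if "v \<in> V" for v
      proof (cases "v \<in> M")
        case False
        then show ?thesis using that A PE by (intro out) (auto simp: col_def B_def)
      next
        case True
        have d1: "dg G (insert g1 A) v = dg G A v + of_bool (v = w1)" using dg_insert[OF ABE(1) gE(1) ABE(3)] in1[OF True] by auto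
        have d2: "dg G (insert g2 B) v = dg G B v + of_bool (v = w2)" using dg_insert[OF ABE(2) gE(2) ABE(4)] in1[OF True] by auto
        have "dg G E v = dg G (insert g1 A \<union> insert g2 B \<union> C) v"
          using at_M[OF _ True] g(1) gE A PE by (intro dg_cong) (auto simp: B_def C_def inner_def)
        also have "\<dots> = dg G (insert g1 A \<union> insert g2 B) v + dg G C v"
          using ABE gE gd A PE by (intro dg_Un) (auto simp: B_def C_def inner_def)
        also have "dg G (insert g1 A \<union> insert g2 B) v = dg G (insert g1 A) v + dg G (insert g2 B) v"
          using ABE gE gd A PE by (intro dg_Un) (auto simp: B_def)
        finally have dE: "dg G E v = dg G (insert g1 A) v + dg G (insert g2 B) v + dg G C v" .
        have "odd (dg G (insert g1 A) v) \<and> odd (dg G (insert g2 B) v) \<or> dg G (insert g1 A) v = 0 \<and> dg G (insert g2 B) v = 0"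
        proof (cases "v \<in> set xs")
          case True
          have o1: "odd (dg G (insert g1 A) v)" using d1 A(2)[of v] True by auto
          have "dg G (insert g2 B) v + dg G (insert g1 A) v = 2" using d1 d2 dB[of v] P(3)[of v] True by simp
          then have "odd (dg G (insert g2 B) v)" using o1 by (metis even_add even_numeral)
          then show ?thesis using o1 by blast
        next
          case False
          then have "dg G P v = 0" "v \<noteq> w1" "v \<noteq> w2" using P(3)[of v] xsM by auto
          then show ?thesis using d1 d2 dB[of v] by simp
        qed
        then have z: "zero_or_odd (dg G (insert g1 A) v)" "zero_or_odd (dg G (insert g2 B) v)" "zero_or_odd (dg G C v)"
          using dE oddM[OF True] by (auto simp: zero_or_odd_def)
        show ?thesis unfolding good_at_def
        proof
          fix i
          have "dg G {e\<in>E. col e = i} v = dg G (if i = \<kappa> g1 then insert g1 A else if i = \<kappa> g2 then insert g2 B else if i = \<kappa> g3 then C else {}) v"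
          proof (rule dg_cong)
            fix e assume ve: "v \<in> set_uprod (ends G e)"
            have gP: "g1 \<notin> P" "g2 \<notin> P" "g3 \<notin> P" using PE gE by auto
            have IE: "?I \<subseteq> E" by (auto simp: inner_def)
            show "e \<in> {e\<in>E. col e = i} \<longleftrightarrow> e \<in> (if i = \<kappa> g1 then insert g1 A else if i = \<kappa> g2 then insert g2 B else if i = \<kappa> g3 then C else {})"
            proof (cases "e \<in> E")
              case False
              then show ?thesis using gE ABE IE by (auto simp: C_def)
            next
              case eE: True
              then have "e \<in> A \<or> e \<in> B \<or> e \<in> ?I - P \<or> e = g1 \<or> e = g2 \<or> e = g3"
                using at_M[OF eE True ve] g(1) by (auto simp: B_def)
              then show ?thesis
                using eE g(2-4) gE gP A(1) PE(2) by (elim disjE) (auto simp: B_def C_def col_def)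
            qed
          qed
          then show "zero_or_odd (dg G {e\<in>E. col e = i} v)" using z by (simp add: zero_or_odd_def)
        qed
      qed
      moreover have "col e < 3" if "e \<in> E" for e
        using that \<kappa>(1)[of e] \<kappa>(1)[of g1] \<kappa>(1)[of g2] \<kappa>(1)[of g3] g(1) cutG(1) by (auto simp: col_def)
      ultimately show ?thesis unfolding colorable_iff by blast
    qed
    have "\<phi> u1 = \<phi> u2 \<or> \<phi> u1 = \<phi> u3 \<or> \<phi> u2 = \<phi> u3" by blast
    then show ?thesis
    proof (elim disjE)
      assume "\<phi> u1 = \<phi> u2" then show ?thesis using main[of f1 f2 f3 u1 u2] dist f(1) u by blast
    next
      assume "\<phi> u1 = \<phi> u3" then show ?thesis using main[of f1 f3 f2 u1 u3] dist f(1) u by (auto simp: insert_commute)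
    next
      assume "\<phi> u2 = \<phi> u3" then show ?thesis using main[of f2 f3 f1 u2 u3] dist f(1) u by (auto simp: insert_commute)
    qed
  qed
qed

end

section \<open>Flows\<close>

context lgraph
begin

text \<open>A flow uses each edge of \<open>F\<close> once, in the direction of its end \<open>t e\<close>; \<open>net\<close> is then the inflow
  minus the outflow.\<close>

definition is_flow :: "'e set \<Rightarrow> ('e \<Rightarrow> 'v) \<Rightarrow> bool" where
  "is_flow F t \<longleftrightarrow> F \<subseteq> E \<and> (\<forall>e\<in>F. t e \<in> set_uprod (ends G e))"

definition net :: "'e set \<Rightarrow> ('e \<Rightarrow> 'v) \<Rightarrow> 'v \<Rightarrow> int" where
  "net F t v = 2 * int (card {e\<in>F. t e = v}) - int (dg G F v)"

definition residual :: "'e set \<Rightarrow> ('e \<Rightarrow> 'v) \<Rightarrow> ('v \<times> 'v) set" where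
  "residual F t = {(x, y). \<exists>e\<in>E. ends G e = Upair x y \<and> (e \<notin> F \<or> t e = x)}"

lemma push:
  assumes "is_flow F t" "e \<in> E" "ends G e = Upair x y" "e \<notin> F \<or> t e = x"
  shows "\<exists>F' t'. is_flow F' t' \<and> (\<forall>v. net F' t' v = net F t v + of_bool (v = y) - of_bool (v = x)) \<and>
    (\<forall>e'. e' \<noteq> e \<longrightarrow> (e' \<in> F' \<longleftrightarrow> e' \<in> F) \<and> t' e' = t e')"
proof -
  have FE: "F \<subseteq> E" using assms(1) by (simp add: is_flow_def)
  then have fF: "finite F" by blast
  have xy: "x \<noteq> y" using ends_in_V[OF assms(2,3)] by blast
  show ?thesis
  proof (cases "e \<in> F")
    case False
    let ?F = "insert e F" and ?t = "t(e := y)"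
    have "net ?F ?t v = net F t v + of_bool (v = y) - of_bool (v = x)" for v
    proof -
      have "{e'\<in>?F. ?t e' = v} = (if v = y then insert e {e\<in>F. t e = v} else {e\<in>F. t e = v})" using False by auto
      then have "card {e'\<in>?F. ?t e' = v} = card {e\<in>F. t e = v} + of_bool (v = y)" using False fF by auto
      moreover have "dg G ?F v = dg G F v + of_bool (v = x \<or> v = y)" using dg_insert[OF FE assms(2) False] assms(3) by auto
      ultimately show ?thesis using xy by (auto simp: net_def)
    qed
    moreover have "is_flow ?F ?t" using assms(1,2,3) False by (auto simp: is_flow_def)
    ultimately show ?thesis by (intro exI[of _ ?F] exI[of _ ?t]) auto
  next
    case True
    let ?F = "F - {e}"
    have te: "t e = x" using assms(4) True by simp
    have "net ?F t v = net F t v + of_bool (v = y) - of_bool (v = x)" for v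
    proof -
      have "{e\<in>F. t e = v} = (if v = x then insert e {e\<in>?F. t e = v} else {e\<in>?F. t e = v})" using True te by auto
      then have "card {e\<in>F. t e = v} = card {e\<in>?F. t e = v} + of_bool (v = x)" using fF by auto
      moreover have "dg G F v = dg G ?F v + of_bool (v = x \<or> v = y)"
      proof -
        have "?F \<subseteq> E" using FE by blast
        then show ?thesis using dg_insert[of ?F e v] assms(2,3) True by (auto simp: insert_absorb)
      qed
      ultimately show ?thesis using xy by (auto simp: net_def)
    qed
    moreover have "is_flow ?F t" using assms(1) by (auto simp: is_flow_def)
    ultimately show ?thesis by (intro exI[of _ ?F] exI[of _ t]) auto
  qed
qed

text \<open>On a simple path the pushes do not interfere: the edge just changed contains
  \<open>x\<close>, which does not occur later on the path, so the remaining arcs stay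
  residual.\<close>

lemma augment:
  assumes "is_flow F t" "xs \<noteq> []" "distinct xs" "successively (\<lambda>a b. (a, b) \<in> residual F t) xs"
  shows "\<exists>F' t'. is_flow F' t' \<and> (\<forall>v. net F' t' v = net F t v + of_bool (v = last xs) - of_bool (v = hd xs))"
  using assms
proof (induction xs arbitrary: F t rule: induct_list012)
  case (2 x)
  then show ?case by (intro exI[of _ F] exI[of _ t]) auto
next
  case (3 x y zs)
  obtain e where e: "e \<in> E" "ends G e = Upair x y" "e \<notin> F \<or> t e = x" using 3(6) by (auto simp: residual_def)
  obtain F1 t1 where F1: "is_flow F1 t1" "\<And>v. net F1 t1 v = net F t v + of_bool (v = y) - of_bool (v = x)"
    "\<And>e'. e' \<noteq> e \<Longrightarrow> (e' \<in> F1 \<longleftrightarrow> e' \<in> F) \<and> t1 e' = t e'"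
    using push[OF 3(3) e] by blast
  have "successively (\<lambda>a b. (a, b) \<in> residual F t) (y # zs)" using 3(6) by simp
  then have "successively (\<lambda>a b. (a, b) \<in> residual F1 t1) (y # zs)"
  proof (rule successively_mono)
    fix a b assume ab: "(a, b) \<in> residual F t" "a \<in> set (y # zs)" "b \<in> set (y # zs)"
    then obtain f where f: "f \<in> E" "ends G f = Upair a b" "f \<notin> F \<or> t f = a" by (auto simp: residual_def)
    have "x \<noteq> a" "x \<noteq> b" using ab 3(5) by auto
    then have "f \<noteq> e" using f e by auto
    then show "(a, b) \<in> residual F1 t1" using f F1(3) by (auto simp: residual_def)
  qed
  then obtain F' t' where F': "is_flow F' t'"
    "\<forall>v. net F' t' v = net F1 t1 v + of_bool (v = last (y # zs)) - of_bool (v = hd (y # zs))"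
    using 3(2)[OF F1(1)] 3(5) by auto
  then show ?case using F1(2) by (intro exI[of _ F'] exI[of _ t']) (auto simp del: last.simps simp: last_ConsR)
qed simp

text \<open>An edge inside \<open>S\<close> contributes \<open>+1\<close> at one end and
  \<open>-1\<close> at the other.\<close>

lemma net_sum:
  assumes "is_flow F t" "finite S"
  shows "(\<Sum>v\<in>S. net F t v) = int (card {e\<in>cut G F S. t e \<in> S}) - int (card {e\<in>cut G F S. t e \<notin> S})"
proof -
  have "F \<subseteq> E" using assms(1) by (simp add: is_flow_def)
  then have "finite F" by blast
  then show ?thesis using assms(1)
  proof (induction F rule: finite_induct)
    case empty
    then show ?case by (simp add: net_def cut_def)
  next
    case (insert e F)
    have F: "is_flow F t" "F \<subseteq> E" "e \<in> E" "t e \<in> set_uprod (ends G e)" using insert(4) by (auto simp: is_flow_def)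
    obtain x y where xy: "ends G e = Upair x y" "x \<noteq> y" using F(3) by (rule ends_cases)
    have txy: "t e = x \<or> t e = y" using F(4) xy by auto
    have "net (insert e F) t v = net F t v + (2 * of_bool (v = t e) - of_bool (v = x) - of_bool (v = y))" for v
    proof -
      have "{e'\<in>insert e F. t e' = v} = (if v = t e then insert e {e'\<in>F. t e' = v} else {e'\<in>F. t e' = v})" by auto
      then have "card {e'\<in>insert e F. t e' = v} = card {e'\<in>F. t e' = v} + of_bool (v = t e)" using insert by auto
      then show ?thesis using dg_insert[OF F(2,3) insert(2)] xy by (auto simp: net_def)
    qed
    then have "(\<Sum>v\<in>S. net (insert e F) t v) = (\<Sum>v\<in>S. net F t v) +
      (2 * (\<Sum>v\<in>S. of_bool (v = t e)) - (\<Sum>v\<in>S. of_bool (v = x)) - (\<Sum>v\<in>S. of_bool (v = y)))"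
      by (simp add: sum.distrib sum_subtractf sum_distrib_left)
    moreover have "(\<Sum>v\<in>S. of_bool (v = u) :: int) = of_bool (u \<in> S)" for u
      using assms(2) by (simp add: of_bool_def)
    moreover have fin: "finite {e\<in>cut G F S. t e \<in> S}" "finite {e\<in>cut G F S. t e \<notin> S}" using insert by (auto simp: cut_def)
    have nin: "e \<notin> {e\<in>cut G F S. t e \<in> S}" "e \<notin> {e\<in>cut G F S. t e \<notin> S}" using insert by (auto simp: cut_def)
    have "{e'\<in>cut G (insert e F) S. t e' \<in> S} = (if (x \<in> S) \<noteq> (y \<in> S) \<and> t e \<in> S then insert e {e\<in>cut G F S. t e \<in> S} else {e\<in>cut G F S. t e \<in> S})"
      using xy by (auto simp: cut_def)
    then have "card {e'\<in>cut G (insert e F) S. t e' \<in> S} = card {e\<in>cut G F S. t e \<in> S} + of_bool ((x \<in> S) \<noteq> (y \<in> S) \<and> t e \<in> S)"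
      using fin nin by auto
    moreover have "{e'\<in>cut G (insert e F) S. t e' \<notin> S} = (if (x \<in> S) \<noteq> (y \<in> S) \<and> t e \<notin> S then insert e {e\<in>cut G F S. t e \<notin> S} else {e\<in>cut G F S. t e \<notin> S})"
      using xy by (auto simp: cut_def)
    then have "card {e'\<in>cut G (insert e F) S. t e' \<notin> S} = card {e\<in>cut G F S. t e \<notin> S} + of_bool ((x \<in> S) \<noteq> (y \<in> S) \<and> t e \<notin> S)"
      using fin nin by auto
    ultimately show ?case using insert.IH[OF F(1)] txy by auto
  qed
qed

text \<open>The demands \<open>d\<close> are all to be supplied by \<open>z\<close>. Among the flows
  that exceed no demand, one with least total shortage is taken. A vertex reachable from
  \<open>z\<close> by residual arcs lacks nothing, since the flow could be augmented. All edges
  leaving the reachable set \<open>R\<close> are used outwards, so a shortage outside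
  \<open>R\<close> would contradict the cut condition.\<close>

lemma max_flow_min_cut:
  fixes d :: "'v \<Rightarrow> nat"
  assumes z: "z \<in> V" and cuts: "\<And>X. X \<subseteq> V \<Longrightarrow> z \<in> X \<Longrightarrow> (\<Sum>v\<in>V - X. d v) \<le> card (cut G E X)"
  shows "\<exists>F t. is_flow F t \<and> (\<forall>v\<in>V - {z}. net F t v = int (d v))"
proof -
  define ok where "ok Ft \<longleftrightarrow> is_flow (fst Ft) (snd Ft) \<and> (\<forall>v\<in>V - {z}. net (fst Ft) (snd Ft) v \<le> int (d v))" for Ft
  define lack where "lack Ft = nat (\<Sum>v\<in>V - {z}. int (d v) - net (fst Ft) (snd Ft) v)" for Ft
  have "ok ({}, \<lambda>_. z)" by (simp add: ok_def is_flow_def net_def)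
  then obtain Ft where Ft: "ok Ft" "\<And>Ft'. ok Ft' \<Longrightarrow> lack Ft \<le> lack Ft'"
    using ex_has_least_nat[of ok _ lack] by blast
  obtain F t where [simp]: "Ft = (F, t)" by (cases Ft)
  have F: "is_flow F t" "\<And>v. v \<in> V - {z} \<Longrightarrow> net F t v \<le> int (d v)" using Ft(1) by (auto simp: ok_def)
  define R where "R = {v. (z, v) \<in> (residual F t)\<^sup>*}"
  have resV: "(x, y) \<in> residual F t \<Longrightarrow> x \<in> V \<and> y \<in> V" for x y using ends_in_V by (auto simp: residual_def)
  have RV: "R \<subseteq> V"
  proof
    fix v assume "v \<in> R"
    then have "(z, v) \<in> (residual F t)\<^sup>*" by (simp add: R_def)
    then show "v \<in> V" by (cases rule: rtranclE) (use z resV in auto)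
  qed
  have full: "net F t v = int (d v)" if v: "v \<in> R" "v \<noteq> z" for v
  proof (rule ccontr)
    assume n: "net F t v \<noteq> int (d v)"
    have vV: "v \<in> V - {z}" using v RV by auto
    obtain xs where xs: "xs \<noteq> []" "distinct xs" "hd xs = z" "last xs = v" "successively (\<lambda>a b. (a, b) \<in> residual F t) xs"
      using v(1) rtrancl_distinct_path[of z v "residual F t"] by (auto simp: R_def)
    obtain F' t' where F': "is_flow F' t'" "\<And>w. net F' t' w = net F t w + of_bool (w = v) - of_bool (w = z)"
      using augment[OF F(1) xs(1,2,5)] xs(3,4) by auto
    have "ok (F', t')" using F' F(2) F(2)[OF vV] n by (auto simp: ok_def of_bool_def)
    have "(\<Sum>w\<in>V - {z}. int (d w) - net F' t' w) < (\<Sum>w\<in>V - {z}. int (d w) - net F t w)"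
    proof (rule sum_strict_mono_ex1)
      show "\<forall>w\<in>V - {z}. int (d w) - net F' t' w \<le> int (d w) - net F t w" using F'(2) by (auto simp: of_bool_def)
      show "\<exists>w\<in>V - {z}. int (d w) - net F' t' w < int (d w) - net F t w" using F'(2) vV by (intro bexI[of _ v]) auto
    qed simp
    moreover have "(\<Sum>w\<in>V - {z}. int (d w) - net F t w) > 0"
    proof (rule sum_pos2[of _ v])
      show "0 < int (d v) - net F t v" using F(2)[OF vV] n by simp
    qed (use F(2) vV in auto)
    ultimately have "lack (F', t') < lack Ft" by (simp add: lack_def)
    then show False using Ft(2)[OF \<open>ok (F', t')\<close>] by simp
  qed
  have "net F t v = int (d v)" if v: "v \<in> V - {z}" for v
  proof (rule ccontr)
    assume n: "net F t v \<noteq> int (d v)"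
    then have vR: "v \<in> V - R" using full v by auto
    have zR: "z \<in> R" by (simp add: R_def)
    have all: "e \<in> F \<and> t e \<in> V - R" if e: "e \<in> cut G E R" for e
    proof -
      obtain x y where xy: "e \<in> E" "ends G e = Upair x y" "x \<in> R" "y \<notin> R" using e by (rule cutE)
      then have "(x, y) \<notin> residual F t" by (auto simp: R_def intro: rtrancl_into_rtrancl)
      then have "e \<in> F" "t e \<noteq> x" using xy by (auto simp: residual_def)
      moreover have "t e \<in> set_uprod (ends G e)" using F(1) \<open>e \<in> F\<close> by (auto simp: is_flow_def)
      ultimately show ?thesis using xy ends_in_V[OF xy(1,2)] by auto
    qed
    have FE: "F \<subseteq> E" using F(1) by (simp add: is_flow_def)
    have "cut G F (V - R) = cut G E R"
    proof -
      have "cut G F (V - R) = F \<inter> cut G E (V - R)" using FE by (auto simp: cut_def)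
      then show ?thesis using all cut_compl[of R] by auto
    qed
    then have "{e\<in>cut G F (V - R). t e \<in> V - R} = cut G E R" "{e\<in>cut G F (V - R). t e \<notin> V - R} = {}"
      using all by auto
    then have "(\<Sum>w\<in>V - R. net F t w) = int (card (cut G E R))"
      using net_sum[OF F(1), of "V - R"] by (simp only: card.empty finite_Diff finite_V)
    moreover have "(\<Sum>w\<in>V - R. net F t w) < (\<Sum>w\<in>V - R. int (d w))"
    proof (rule sum_strict_mono_ex1)
      show "\<forall>w\<in>V - R. net F t w \<le> int (d w)" using F(2) zR by auto
      show "\<exists>w\<in>V - R. net F t w < int (d w)" using F(2)[OF v] n vR by (intro bexI[of _ v]) auto
    qed simp
    moreover have "(\<Sum>w\<in>V - R. int (d w)) \<le> int (card (cut G E R))"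
      using cuts[OF RV zR] by (metis of_nat_mono of_nat_sum)
    ultimately show False by linarith
  qed
  then show ?thesis using F(1) by blast
qed

lemma cut_single: "cut G E {v} = {e\<in>E. v \<in> set_uprod (ends G e)}"
proof -
  have "e \<in> cut G E {v} \<longleftrightarrow> v \<in> set_uprod (ends G e)" if "e \<in> E" for e
  proof -
    obtain x y where xy: "ends G e = Upair x y" "x \<noteq> y" using \<open>e \<in> E\<close> by (rule ends_cases)
    show ?thesis unfolding cut_iff[OF xy(1)] using xy that by auto
  qed
  then show ?thesis by (auto simp: cut_def)
qed

lemma card_cut_single: "card (cut G E {v}) = dg G E v"
  unfolding cut_single dg_def ..

end

section \<open>3-colorings from a flow into a cubic vertex\<close>

context near_odd
begin

text \<open>The vertex \<open>w\<close> receives a color of its own on all three edges. Since the rest of the flow is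
  connected and contains \<open>c\<close>, where the parity is free, it can be split with no condition on its order.\<close>

lemma colorable_flow:
  assumes F: "is_flow F t" and w: "w \<in> V" "w \<noteq> c" "w \<noteq> p" "w \<noteq> q" "dg G E w = 3"
    and z: "z \<in> V" "z \<noteq> w" "z \<noteq> c" and nw: "net F t w = 3" and nc: "net F t c = 1"
    and n0: "\<And>v. v \<in> V \<Longrightarrow> v \<notin> {z, w, c} \<Longrightarrow> net F t v = 0"
  shows "colorable 3 G"
proof -
  have FE: "F \<subseteq> E" using F by (simp add: is_flow_def)
  then have fF: "finite F" by blast
  have par: "even (net F t v) \<longleftrightarrow> even (dg G F v)" for v by (simp add: net_def)
  have in_le: "card {e\<in>F. t e = v} \<le> dg G F v" for v
    unfolding dg_def using F fF by (intro card_mono) (auto simp: is_flow_def)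
  have dFw: "dg G F w \<le> 3" using dg_mono[OF FE order_refl, of w] w(5) by simp
  have inw: "card {e\<in>F. t e = w} = 3" "dg G F w = 3"
    using nw in_le[of w] dFw by (auto simp: net_def)
  define W where "W = {e\<in>E. w \<in> set_uprod (ends G e)}"
  have WF: "W = {e\<in>F. t e = w}"
  proof -
    have "{e\<in>F. t e = w} \<subseteq> W" using F FE by (auto simp: W_def is_flow_def)
    moreover have "card W = 3" using w(5) by (simp add: W_def dg_def)
    moreover have "finite W" by (simp add: W_def)
    ultimately show ?thesis using inw card_subset_eq[of W "{e\<in>F. t e = w}"] by auto
  qed
  have dc: "dg G F c = 1"
  proof -
    have "odd (dg G F c)" using par[of c] nc by simp
    moreover have "dg G F c \<le> 2" using dg_mono[OF FE order_refl, of c] dg_c by simp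
    ultimately show ?thesis by (auto simp: le_Suc_eq numeral_2_eq_2)
  qed
  \<comment> \<open>At \<open>z\<close> the parity follows from the sum of all degrees, as
    \<open>F\<close> has odd degree at \<open>c\<close> and at \<open>w\<close>.\<close>
  have even_F: "even (dg G F v)" if v: "v \<in> V" "v \<noteq> w" "v \<noteq> c" for v
  proof (cases "v = z")
    case False then show ?thesis using par[of v] n0[of v] v by simp
  next
    case True
    have "even (\<Sum>v\<in>V. dg G F v)"
      using multigraph FE by (intro handshake_all) (auto simp: multigraph_def)
    moreover have "(\<Sum>v\<in>V. dg G F v) = dg G F c + (dg G F w + (dg G F z + (\<Sum>v\<in>V - {c} - {w} - {z}. dg G F v)))"
      using c w z by (subst sum.remove[of V c], simp, simp, subst sum.remove[of "V - {c}" w], simp, simp,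
        subst sum.remove[of "V - {c} - {w}" z]) auto
    moreover have "even (\<Sum>v\<in>V - {c} - {w} - {z}. dg G F v)"
    proof (rule dvd_sum)
      fix v assume "v \<in> V - {c} - {w} - {z}"
      then show "even (dg G F v)" using par[of v] n0[of v] by simp
    qed
    ultimately show ?thesis using dc inw True by simp
  qed
  define F' where "F' = F - W"
  have F'E: "F' \<subseteq> E" using FE by (auto simp: F'_def)
  define K where "K r = {v. (r, v) \<in> (adj G F' V)\<^sup>*}" for r
  have Kcut: "cut G F' (K r) = {}" for r unfolding K_def using F'E by (rule reach_cut)
  have KV: "K r \<subseteq> V" if "r \<in> V" for r using adj_rtrancl_in[of r _ G F' V] that by (auto simp: K_def)
  have wK: "w \<notin> K r" if "r \<noteq> w" for r
  proof
    assume "w \<in> K r"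
    then have "(r, w) \<in> (adj G F' V)\<^sup>*" by (simp add: K_def)
    then show False
    proof (cases rule: rtranclE)
      case (step y)
      then show ?thesis using F'E by (auto simp: adj_def F'_def W_def)
    qed (use that in simp)
  qed
  \<comment> \<open>Every edge of \<open>F\<close> that leaves a component of \<open>F'\<close>
    belongs to \<open>W\<close> and is directed to \<open>w\<close>, so components have nonpositive
    total net flow.\<close>
  have netK: "(\<Sum>v\<in>K r. net F t v) = - int (card (cut G F (K r)))" if r: "r \<in> V" "r \<noteq> w" for r
  proof -
    have "cut G F (K r) \<subseteq> W" using Kcut[of r] by (auto simp: cut_def F'_def)
    then have "{e\<in>cut G F (K r). t e \<in> K r} = {}" "{e\<in>cut G F (K r). t e \<notin> K r} = cut G F (K r)"
      using WF wK[OF r(2)] by auto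
    moreover have "finite (K r)" using KV[OF r(1)] finite_subset[of "K r" V] by auto
    ultimately show ?thesis using net_sum[OF F, of "K r"] by (simp only: card.empty)
  qed
  have cK: "c \<in> K c" by (simp add: K_def)
  \<comment> \<open>The demand at \<open>c\<close> must be met inside its component, and
    \<open>z\<close> is the only source.\<close>
  have zK: "z \<in> K c"
  proof (rule ccontr)
    assume n: "z \<notin> K c"
    have "finite (K c)" using KV[OF c] finite_subset[of "K c" V] by auto
    then have "(\<Sum>v\<in>K c. net F t v) = net F t c + (\<Sum>v\<in>K c - {c}. net F t v)" using cK by (intro sum.remove)
    also have "(\<Sum>v\<in>K c - {c}. net F t v) = 0"
    proof (rule sum.neutral, rule ballI)
      fix v assume "v \<in> K c - {c}"
      then show "net F t v = 0" using n0[of v] n wK[of c] w KV[OF c] by auto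
    qed
    finally show False using netK[of c] c w nc by simp
  qed
  \<comment> \<open>A component other than those of \<open>c\<close> and \<open>w\<close> has total
    net flow zero and therefore sends no edge to \<open>w\<close>.\<close>
  have nbr: "n \<in> K c" if e: "e \<in> E" "ends G e = Upair w n" for e n
  proof (rule ccontr)
    assume nn: "n \<notin> K c"
    have n: "n \<in> V" "n \<noteq> w" using ends_in_V[OF e] by auto
    have disj: "K n \<inter> K c = {}"
    proof (rule equals0I)
      fix v assume "v \<in> K n \<inter> K c"
      then have "(c, v) \<in> (adj G F' V)\<^sup>*" "(v, n) \<in> (adj G F' V)\<^sup>*" by (auto simp: K_def intro: adj_rtrancl_sym)
      then have "(c, n) \<in> (adj G F' V)\<^sup>*" by (rule rtrancl_trans)
      then show False using nn by (simp add: K_def)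
    qed
    have "(\<Sum>v\<in>K n. net F t v) = 0"
    proof (rule sum.neutral, rule ballI)
      fix v assume "v \<in> K n"
      then show "net F t v = 0" using n0[of v] disj cK zK wK[OF n(2)] KV[OF n(1)] by auto
    qed
    then have "card (cut G F (K n)) = 0" using netK[OF n] by simp
    moreover have "finite (cut G F (K n))" using fF by (simp add: cut_def)
    moreover have "e \<in> W" using e by (auto simp: W_def)
    then have "e \<in> cut G F (K n)" using WF wK[OF n(2)] e unfolding cut_iff[OF e(2)] by (auto simp: K_def)
    ultimately show False by auto
  qed
  \<comment> \<open>Where \<open>W\<close> contributes an odd number of edges, \<open>A'\<close> has
    to be even, so that \<open>A' \<union> W\<close> is odd on the whole component except possibly
    at \<open>c\<close>.\<close>
  define \<tau> where "\<tau> = {v\<in>K c - {c}. even (dg G W v)}"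
  have fK: "finite (K c)" using KV[OF c] finite_subset[of "K c" V] by auto
  have "\<exists>A\<subseteq>inner G F' V. \<forall>v. v \<notin> {c} \<longrightarrow> (odd (dg G A v) \<longleftrightarrow> v \<in> \<tau>)"
    using fK F'E by (intro join_free) (auto simp: \<tau>_def K_def intro: adj_rtrancl_sym)
  then obtain A0 where A0: "A0 \<subseteq> F'" "\<And>v. v \<noteq> c \<Longrightarrow> odd (dg G A0 v) \<longleftrightarrow> v \<in> \<tau>" by (auto simp: inner_def)
  define L where "L = inner G F' (K c)"
  define A' where "A' = inner G A0 (K c)"
  define B where "B = L - A'"
  have sub: "A' \<subseteq> L" "L \<subseteq> F'" "L \<subseteq> E" "A' \<subseteq> E" "B \<subseteq> E" using A0(1) F'E by (auto simp: L_def A'_def B_def inner_def)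
  have dA': "dg G A' v = (if v \<in> K c then dg G A0 v else 0)" for v
    unfolding A'_def using F'E Kcut A0(1) by (rule dg_component)
  have dL: "dg G L v = (if v \<in> K c then dg G F' v else 0)" for v
    unfolding L_def using F'E Kcut by (rule dg_component) simp
  have dAB: "dg G L v = dg G B v + dg G A' v" for v unfolding B_def using sub by (intro dg_Diff)
  have WE: "W \<subseteq> E" "W \<subseteq> F" using WF by (auto simp: W_def)
  have dF: "dg G F v = dg G F' v + dg G W v" for v unfolding F'_def using WE FE by (intro dg_Diff)
  have "W \<inter> A' = {}" using sub by (auto simp: F'_def)
  then have dA: "dg G (A' \<union> W) v = dg G A' v + dg G W v" for v using sub WE by (intro dg_Un) auto
  have W0: "dg G W v = 0" if "v \<notin> K c" "v \<noteq> w" for v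
  proof -
    have "v \<notin> set_uprod (ends G e)" if e: "e \<in> W" for e
    proof -
      obtain x y where xy: "ends G e = Upair x y" by (rule uprod_ends)
      then have "ends G e = Upair y x" by auto
      then show ?thesis using nbr[of e x] nbr[of e y] xy e \<open>v \<notin> K c\<close> \<open>v \<noteq> w\<close> by (auto simp: W_def)
    qed
    then show ?thesis using dg_zero_iff[OF WE(1)] by blast
  qed
  have Wc: "dg G W c = 0"
  proof -
    have "ep \<notin> W" "eq \<notin> W" using ep eq w by (auto simp: W_def)
    then show ?thesis using dg_c_sub[OF WE(1)] by simp
  qed
  show ?thesis
  proof (rule colorable_base[of "A' \<union> W" B])
    show "(A' \<union> W) \<inter> B = {}" "A' \<union> W \<subseteq> E" "B \<subseteq> E" using sub WE by (auto simp: B_def F'_def)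
    fix v assume v: "v \<in> V"
    show "(odd (dg G E v) \<and> dg G (A' \<union> W) v = 0 \<and> dg G B v = 0) \<or>
       (odd (dg G E v) \<and> odd (dg G (A' \<union> W) v) \<and> odd (dg G B v)) \<or>
       (odd (dg G E v) \<and> dg G (A' \<union> W) v = dg G E v) \<or>
       (dg G E v = 2 \<and> dg G (A' \<union> W) v + dg G B v = 1) \<or>
       (dg G E v = 2 \<and> odd (dg G (A' \<union> W) v) \<and> odd (dg G B v))"
    proof (cases "v = c")
      case True
      have "dg G (A' \<union> W) c + dg G B c = 1" using dA[of c] dAB[of c] dL[of c] dF[of c] Wc dc cK by auto
      then show ?thesis using True dg_c by blast
    next
      case False
      note od = odd_deg[OF v False]
      show ?thesis
      proof (cases "v = w")
        case True
        have "dg G W w = dg G E w" by (intro dg_cong) (auto simp: W_def)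
        moreover have "dg G A' w = 0" using dA'[of w] wK[of c] w by auto
        ultimately show ?thesis using dA[of w] od True by simp
      next
        case vw: False
        show ?thesis
        proof (cases "v \<in> K c")
          case True
          have "odd (dg G A' v) \<longleftrightarrow> even (dg G W v)" using dA'[of v] A0(2)[OF False] True False by (auto simp: \<tau>_def)
          moreover have "even (dg G F' v + dg G W v)" using even_F[OF v vw False] dF[of v] by simp
          moreover have "dg G F' v = dg G B v + dg G A' v" using dAB[of v] dL[of v] True by simp
          ultimately have "odd (dg G (A' \<union> W) v) \<and> odd (dg G B v)" using dA[of v] by auto
          then show ?thesis using od by blast
        next
          case False
          then show ?thesis using dA'[of v] dA[of v] W0[OF False vw] dAB[of v] dL[of v] od by simp
        qed
      qed
    qed
  qed
qed

text \<open>Demand 3 at \<open>w\<close> forces all its edges to carry flow towards it, and demand 1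
  at \<open>c\<close> gives \<open>c\<close> degree one in the flow. The only cuts that could be too
  small are 3-edge cuts with \<open>w\<close> and \<open>c\<close> on the far side from
  \<open>z\<close>. Being trivial, such a cut belongs to \<open>{z}\<close>, excluded by its degree,
  or to \<open>{w, c}\<close>, excluded because \<open>w\<close> is not adjacent to
  \<open>c\<close>.\<close>

lemma colorable_hub:
  assumes cuts: "\<And>X. X \<subseteq> V \<Longrightarrow> X - {c} \<noteq> {} \<Longrightarrow> V - X - {c} \<noteq> {} \<Longrightarrow> 3 \<le> card (cut G E X)"
    and triv: "\<And>X. X \<subseteq> V - {c} \<Longrightarrow> card (cut G E X) = 3 \<Longrightarrow> card X = 1 \<or> card (V - X - {c}) = 1"
    and w: "w \<in> V" "w \<noteq> c" "w \<noteq> p" "w \<noteq> q" "dg G E w = 3" and z: "z \<in> V" "z \<noteq> c" "dg G E z \<noteq> 3"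
  shows "colorable 3 G"
proof -
  have zw: "z \<noteq> w" using w z by auto
  define d :: "'a \<Rightarrow> nat" where "d v = (if v = w then 3 else if v = c then 1 else 0)" for v
  have "(\<Sum>v\<in>V - X. d v) \<le> card (cut G E X)" if X: "X \<subseteq> V" "z \<in> X" for X
  proof -
    have "(\<Sum>v\<in>V - X. d v) = (\<Sum>v\<in>V - X. 3 * of_bool (v = w) + of_bool (v = c))"
      using w by (intro sum.cong) (auto simp: d_def)
    also have "\<dots> = 3 * of_bool (w \<notin> X) + of_bool (c \<notin> X)"
      using w c by (simp add: sum.distrib sum_distrib_left[symmetric] of_bool_def)
    finally have sum: "(\<Sum>v\<in>V - X. d v) = 3 * of_bool (w \<notin> X) + of_bool (c \<notin> X)" .
    have f: "finite (cut G E X)" by (simp add: cut_def)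
    show ?thesis
    proof (cases "w \<in> X")
      case True
      show ?thesis
      proof (cases "c \<in> X")
        case False
        have "X \<noteq> {}" "X \<noteq> V" using X False c by auto
        with conn_V X(1) obtain e x y where "e \<in> E" "ends G e = Upair x y" "x \<in> X" "y \<in> V - X" by (rule conn_cut)
        then have "e \<in> cut G E X" using cut_iff[of G e x y] by auto
        then have "card (cut G E X) > 0" using f by (auto simp: card_gt_0_iff)
        then show ?thesis using sum True False by simp
      qed (use True sum in simp)
    next
      case False
      then have c3: "3 \<le> card (cut G E X)" using X z w by (intro cuts) auto
      show ?thesis
      proof (cases "c \<in> X")
        case True then show ?thesis using c3 sum False by simp
      next
        case False2: False
        have "card (cut G E X) \<noteq> 3"
        proof
          assume cc: "card (cut G E X) = 3"
          have "card X = 1 \<or> card (V - X - {c}) = 1" using triv[OF _ cc] X False2 by blast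
          then show False
          proof
            assume "card X = 1"
            then have "X = {z}" using X(2) by (auto simp: card_1_singleton_iff)
            then show False using cc z(3) card_cut_single by simp
          next
            assume "card (V - X - {c}) = 1"
            then obtain u where u: "V - X - {c} = {u}" by (auto simp: card_1_singleton_iff)
            have "w \<in> V - X - {c}" using w False by simp
            then have "u = w" unfolding u by simp
            moreover have "V - X = insert c (V - X - {c})" using False2 c by blast
            ultimately have VX: "V - X = {w, c}" using u by auto
            \<comment> \<open>Two edges at \<open>c\<close> and three at \<open>w\<close>, all
              different and all leaving the pair.\<close>
            have cw: "e \<in> cut G E {w, c}" if "e \<in> insert ep (insert eq {e\<in>E. w \<in> set_uprod (ends G e)})" for e
            proof -
              have "e = ep \<or> e = eq \<or> e \<in> E \<and> e \<noteq> ep \<and> e \<noteq> eq \<and> w \<in> set_uprod (ends G e)" using that by auto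
              then show ?thesis
              proof (elim disjE conjE)
                assume a: "e \<in> E" "e \<noteq> ep" "e \<noteq> eq" "w \<in> set_uprod (ends G e)"
                then have "c \<notin> set_uprod (ends G e)" using c_only by blast
                moreover obtain x y where "ends G e = Upair x y" "x \<noteq> y" using a(1) by (rule ends_cases)
                ultimately show ?thesis using a by (auto simp: cut_def)
              qed (use ep eq w pq in \<open>auto simp: cut_def\<close>)
            qed
            have "ep \<notin> {e\<in>E. w \<in> set_uprod (ends G e)}" "eq \<notin> {e\<in>E. w \<in> set_uprod (ends G e)}" using ep eq w by auto
            then have "card (insert ep (insert eq {e\<in>E. w \<in> set_uprod (ends G e)})) = 5"
              using w(5) ep_eq by (simp add: dg_def)
            moreover have "card (insert ep (insert eq {e\<in>E. w \<in> set_uprod (ends G e)})) \<le> card (cut G E {w, c})"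
              using cw by (intro card_mono) (auto simp: cut_def)
            moreover have "cut G E {w, c} = cut G E X" using cut_compl[of X] VX by simp
            ultimately show False using cc by simp
          qed
        qed
        then show ?thesis using c3 sum False False2 by simp
      qed
    qed
  qed
  then obtain F t where F: "is_flow F t" "\<And>v. v \<in> V - {z} \<Longrightarrow> net F t v = int (d v)"
    using max_flow_min_cut[OF z(1), of d] by blast
  show ?thesis
    using F(2)[of w] F(2)[of c] F(2) w z zw c by (intro colorable_flow[OF F(1) w z(1) zw z(2)]) (auto simp: d_def)
qed

end

section \<open>Graphs without 2-edge cuts\<close>

text \<open>Both sides must contain something besides \<open>c\<close>, since the two edges at
  \<open>c\<close> themselves form a cut of size two.\<close>

definition cuts3 :: "('v, 'e) mgraph \<Rightarrow> 'v \<Rightarrow> bool" where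
  "cuts3 G c \<longleftrightarrow> (\<forall>X\<subseteq>verts G. X - {c} \<noteq> {} \<longrightarrow> verts G - X - {c} \<noteq> {} \<longrightarrow> 3 \<le> card (cut G (edges G) X))"

text \<open>The complement of \<open>M\<close> becomes the vertex \<open>y\<close>. The edge \<open>f\<close> is subdivided by \<open>c\<close>, keeps its name on
  the half at its end \<open>u\<close> in \<open>M\<close>, and gives the name \<open>n\<close> to the half at \<open>y\<close>.\<close>

definition contract_subdivide :: "('v, 'e) mgraph \<Rightarrow> 'v set \<Rightarrow> 'v \<Rightarrow> 'v \<Rightarrow> 'v \<Rightarrow> 'e \<Rightarrow> 'e \<Rightarrow> ('v, 'e) mgraph" where
  "contract_subdivide G M y c u f n = \<lparr>verts = M \<union> {y, c},
     edges = insert n (inner G (edges G) M \<union> cut G (edges G) M),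
     ends = \<lambda>e. if e = f then Upair u c else if e = n then Upair c y
       else map_uprod (\<lambda>v. if v \<in> M then v else y) (ends G e)\<rparr>"

lemma contract_subdivide_simps [simp]:
  "verts (contract_subdivide G M y c u f n) = M \<union> {y, c}"
  "edges (contract_subdivide G M y c u f n) = insert n (inner G (edges G) M \<union> cut G (edges G) M)"
  "ends (contract_subdivide G M y c u f n) e = (if e = f then Upair u c else if e = n then Upair c y
       else map_uprod (\<lambda>v. if v \<in> M then v else y) (ends G e))"
  by (simp_all add: contract_subdivide_def)

section \<open>Small cuts and the side of \<open>c\<close>\<close>

context near_odd
begin

text \<open>A cut on which one edge has one color and all others have a second color is exactly what
  \<open>color_around_c\<close> can continue on the side of \<open>c\<close>; the remaining color
  \<open>z\<close> serves its path.\<close>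

lemma colorable_combine:
  assumes M: "M \<subseteq> V" "c \<notin> M" "conn G E (V - M)"
    and \<kappa>: "\<And>e. e \<in> inner G E M \<union> cut G E M \<Longrightarrow> \<kappa> e < 3" "\<And>v. v \<in> M \<Longrightarrow> good_at G \<kappa> v"
    and f: "f \<in> cut G E M" "\<kappa> f \<noteq> b" "b < 3" "\<And>e. e \<in> cut G E M \<Longrightarrow> e \<noteq> f \<Longrightarrow> \<kappa> e = b"
  shows "colorable 3 G"
proof -
  have "\<kappa> f < 3" using \<kappa>(1) f(1) by blast
  have "\<exists>z. z < 3 \<and> \<kappa> f \<noteq> z \<and> b \<noteq> z"
    by (rule ccontr) (use \<open>\<kappa> f < 3\<close> f(3) in presburger)
  then obtain z where z: "z < 3" "\<kappa> f \<noteq> z" "b \<noteq> z" by blast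
  have cY: "cut G E (V - M) = cut G E M" by (rule cut_compl)
  have "\<exists>col. col f = \<kappa> f \<and> (\<forall>e\<in>cut G E (V - M) - {f}. col e = b) \<and> (\<forall>e. col e \<in> {\<kappa> f, b, z}) \<and> (\<forall>v\<in>V - M. good_at G col v)"
    using M c f(1,2) z cY by (intro color_around_c) auto
  then obtain \<mu> where \<mu>: "\<mu> f = \<kappa> f" "\<And>e. e \<in> cut G E M \<Longrightarrow> e \<noteq> f \<Longrightarrow> \<mu> e = b" "\<And>e. \<mu> e \<in> {\<kappa> f, b, z}"
    "\<And>v. v \<in> V - M \<Longrightarrow> good_at G \<mu> v" unfolding cY by blast
  define col where "col e = (if e \<in> inner G E M then \<kappa> e else \<mu> e)" for e
  have eq_cut: "\<mu> e = \<kappa> e" if "e \<in> cut G E M" for e using \<mu>(1,2) f(4) that by (cases "e = f") auto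
  have "good_at G col v" if v: "v \<in> V" for v
  proof (cases "v \<in> M")
    case True
    have "dg G {e\<in>E. col e = i} v = dg G {e\<in>E. \<kappa> e = i} v" for i
    proof (rule dg_cong)
      fix e assume "v \<in> set_uprod (ends G e)"
      then have "e \<in> inner G E M \<or> e \<in> cut G E M" if "e \<in> E" using True that by (auto simp: inner_def cut_def)
      then show "e \<in> {e\<in>E. col e = i} \<longleftrightarrow> e \<in> {e\<in>E. \<kappa> e = i}" using eq_cut by (auto simp: col_def)
    qed
    then show ?thesis using \<kappa>(2)[OF True] by (simp add: good_at_def)
  next
    case False
    have "dg G {e\<in>E. col e = i} v = dg G {e\<in>E. \<mu> e = i} v" for i
      using False by (intro dg_cong) (auto simp: col_def inner_def)
    then show ?thesis using \<mu>(4)[of v] v False by (simp add: good_at_def)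
  qed
  moreover have "col e < 3" if "e \<in> E" for e
    using \<kappa>(1)[of e] \<mu>(3)[of e] \<open>\<kappa> f < 3\<close> f(3) z(1) by (auto simp: col_def)
  ultimately show ?thesis unfolding colorable_iff by blast
qed

text \<open>If \<open>S\<close> fell apart, its boundary would contain the disjoint boundaries of a
  component \<open>K\<close> and of \<open>S - K\<close>. The first is nonempty and the second has
  at least \<open>k\<close> edges, which is too many.\<close>

lemma conn_min_cut:
  assumes ck: "\<And>X. X \<subseteq> V \<Longrightarrow> X - {c} \<noteq> {} \<Longrightarrow> V - X - {c} \<noteq> {} \<Longrightarrow> k \<le> card (cut G E X)"
    and S: "S \<subseteq> V" "V - S - {c} \<noteq> {}" "card (cut G E S) \<le> k"
  shows "conn G E S"
proof (cases "S = {}")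
  case True then show ?thesis by (simp add: conn_def)
next
  case False
  \<comment> \<open>The component is taken around \<open>c\<close> if \<open>c\<close> is in
    \<open>S\<close>; thus \<open>S - K\<close> avoids \<open>c\<close> and the lower bound applies
    to it.\<close>
  then obtain r where r: "r \<in> S" "c \<in> S \<Longrightarrow> r = c" by blast
  define K where "K = {x. (r, x) \<in> (adj G E S)\<^sup>*}"
  have KS: "K \<subseteq> S" using adj_rtrancl_in[of r _ G E S] r by (auto simp: K_def)
  have rK: "r \<in> K" by (simp add: K_def)
  have closed: "y \<in> K" if "e \<in> E" "ends G e = Upair x y" "x \<in> K" "y \<in> S" for e x y
    using adjI[OF that(1,2), of S] that KS unfolding K_def by (auto intro: rtrancl_into_rtrancl)
  have closed': "x \<in> K" if "e \<in> E" "ends G e = Upair x y" "y \<in> K" "x \<in> S" for e x y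
  proof -
    have "ends G e = Upair y x" using that(2) by auto
    then show ?thesis using closed[OF that(1)] that by blast
  qed
  show ?thesis
  proof (cases "K = S")
    case True
    then show ?thesis using reach_conn[of G E r S] by (simp add: K_def)
  next
    case False
    have sub: "cut G E K \<subseteq> cut G E S" "cut G E (S - K) \<subseteq> cut G E S" "cut G E K \<inter> cut G E (S - K) = {}"
    proof -
      have "e \<in> cut G E S \<and> e \<notin> cut G E (S - K)" if "e \<in> cut G E K" for e
      proof -
        obtain x y where xy: "e \<in> E" "ends G e = Upair x y" "x \<in> K" "y \<notin> K" using \<open>e \<in> cut G E K\<close> by (rule cutE)
        then have "y \<notin> S" using closed by blast
        then show ?thesis unfolding cut_iff[OF xy(2)] using xy KS by auto
      qed
      moreover have "e \<in> cut G E S" if "e \<in> cut G E (S - K)" for e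
      proof -
        obtain x y where xy: "e \<in> E" "ends G e = Upair x y" "x \<in> S - K" "y \<notin> S - K" using \<open>e \<in> cut G E (S - K)\<close> by (rule cutE)
        then have "y \<notin> S" using closed'[OF xy(1,2)] by blast
        then show ?thesis unfolding cut_iff[OF xy(2)] using xy by auto
      qed
      ultimately show "cut G E K \<subseteq> cut G E S" "cut G E (S - K) \<subseteq> cut G E S" "cut G E K \<inter> cut G E (S - K) = {}" by auto
    qed
    have f: "finite (cut G E X)" for X by (simp add: cut_def)
    have "K \<subseteq> V" "K \<noteq> {}" "K \<noteq> V" using KS S rK by auto
    with conn_V obtain e x y where "e \<in> E" "ends G e = Upair x y" "x \<in> K" "y \<in> V - K" by (rule conn_cut)
    then have "e \<in> cut G E K" using cut_iff[of G e x y] by auto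
    then have "card (cut G E K) > 0" using f by (auto simp: card_gt_0_iff)
    moreover have "c \<notin> S - K" using r(2) rK by auto
    then have "k \<le> card (cut G E (S - K))" using S False KS by (intro ck) auto
    moreover have "card (cut G E K) + card (cut G E (S - K)) \<le> card (cut G E S)"
      using sub f card_mono[OF f, of "cut G E K \<union> cut G E (S - K)" S] by (simp add: card_Un_disjoint)
    ultimately show ?thesis using S(3) by simp
  qed
qed

lemma conn_small_cut:
  assumes "cuts3 G c" "S \<subseteq> V" "V - S - {c} \<noteq> {}" "card (cut G E S) \<le> 3"
  shows "conn G E S"
  using assms by (intro conn_min_cut[of 3]) (auto simp: cuts3_def)

lemma cuts3_contract:
  assumes "cuts3 G c" "M \<subseteq> V" "m \<in> M" "c \<notin> M"
  shows "cuts3 (contract G M m) c"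
  unfolding cuts3_def
proof (intro allI impI)
  let ?G = "contract G M m"
  fix X assume X: "X \<subseteq> verts ?G" "X - {c} \<noteq> {}" "verts ?G - X - {c} \<noteq> {}"
  let ?X = "if m \<in> X then X \<union> M else X"
  have "?X \<subseteq> V" "?X - {c} \<noteq> {}" "V - ?X - {c} \<noteq> {}" using X assms by (auto split: if_splits)
  then have "3 \<le> card (cut G E ?X)" using assms(1) unfolding cuts3_def by blast
  then show "3 \<le> card (cut ?G (edges ?G) X)" using contract_cut[OF assms(2,3) X(1)] by simp
qed

end

text \<open>A 3-edge cut around a set \<open>M\<close> that avoids \<open>c\<close>. The new vertex
  and the new edge of the smaller graph borrow the names of a vertex \<open>y\<close> and an edge
  \<open>n\<close> of the other side, which disappears, so the types do not change.\<close>

locale cut_side = near_odd +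
  fixes M y u f f' n g h
  assumes M: "M \<subseteq> V - {c}" "conn G E M" and y: "y \<in> V" "y \<notin> M" "y \<noteq> c"
    and f: "ends G f = Upair u f'" "u \<in> M" "f' \<notin> M" and n: "n \<in> inner G E (V - M)"
    and fgh: "cut G E M = {f, g, h}" "f \<noteq> g" "f \<noteq> h" "g \<noteq> h" and card_M: "card M \<ge> 2"
begin

abbreviation "G2 \<equiv> contract_subdivide G M y c u f n"

lemma fgh_E: "f \<in> E" "g \<in> E" "h \<in> E"
  using fgh(1) by (auto simp: cut_def)

lemma n_not: "n \<notin> inner G E M" "n \<notin> cut G E M" "n \<noteq> f" "n \<in> E"
proof -
  have "set_uprod (ends G n) \<subseteq> V - M" "n \<in> E" using n by (auto simp: inner_def)
  moreover obtain x y where "ends G n = Upair x y" by (rule uprod_ends)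
  ultimately show "n \<notin> inner G E M" "n \<notin> cut G E M" "n \<in> E" by (auto simp: inner_def cut_def)
  then show "n \<noteq> f" using fgh by auto
qed

lemma ends_inner: "e \<in> inner G E M \<Longrightarrow> ends G2 e = ends G e"
proof -
  assume e: "e \<in> inner G E M"
  then have "e \<noteq> f" "e \<noteq> n" using fgh n_not by (auto simp: cut_def inner_def)
  moreover obtain x y where "ends G e = Upair x y" by (rule uprod_ends)
  ultimately show ?thesis using e by (auto simp: inner_def)
qed

lemma ends_cut: "e \<in> cut G E M \<Longrightarrow> e \<noteq> f \<Longrightarrow> \<exists>x\<in>M. \<exists>x'. x' \<notin> M \<and> ends G e = Upair x x' \<and> ends G2 e = Upair x y"
proof -
  assume e: "e \<in> cut G E M" "e \<noteq> f"
  then obtain x x' where x: "ends G e = Upair x x'" "x \<in> M" "x' \<notin> M" by (elim cutE)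
  moreover have "e \<noteq> n" using e n_not by auto
  ultimately show ?thesis using e by auto
qed

lemma inc_G2:
  assumes "v \<in> M" "e \<in> edges G2"
  shows "v \<in> set_uprod (ends G2 e) \<longleftrightarrow> v \<in> set_uprod (ends G e)"
proof -
  have "e = n \<or> e \<in> inner G E M \<or> e = f \<or> (e \<in> cut G E M \<and> e \<noteq> f)" using assms(2) by auto
  then show ?thesis
  proof (elim disjE)
    assume "e = n"
    then show ?thesis using n n_not M y assms(1) by (auto simp: inner_def)
  next
    assume "e \<in> inner G E M" then show ?thesis using ends_inner by simp
  next
    assume "e = f" then show ?thesis using f M y assms(1) by auto
  next
    assume "e \<in> cut G E M \<and> e \<noteq> f"
    then obtain x x' where "x' \<notin> M" "ends G e = Upair x x'" "ends G2 e = Upair x y" using ends_cut by blast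
    then show ?thesis using assms(1) y by auto
  qed
qed

lemma dg_G2:
  assumes "v \<in> M" "F \<subseteq> edges G2"
  shows "dg G2 F v = dg G F v"
proof -
  have "{e\<in>F. v \<in> set_uprod (ends G2 e)} = {e\<in>F. v \<in> set_uprod (ends G e)}" using inc_G2[OF assms(1)] assms(2) by blast
  then show ?thesis unfolding dg_def by simp
qed

lemma inc_y: "e \<in> edges G2 \<Longrightarrow> y \<in> set_uprod (ends G2 e) \<longleftrightarrow> e \<in> {n, g, h}"
proof -
  assume "e \<in> edges G2"
  then have "e = n \<or> e \<in> inner G E M \<or> e = f \<or> (e \<in> cut G E M \<and> e \<noteq> f)" by auto
  then show ?thesis
  proof (elim disjE)
    assume "e = n" then show ?thesis using n_not by simp
  next
    assume e: "e \<in> inner G E M"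
    then have "e \<notin> {n, g, h}" using n_not fgh(1) by (auto simp: inner_def cut_def)
    then show ?thesis using ends_inner[OF e] e y by (auto simp: inner_def)
  next
    assume "e = f" then show ?thesis using f y fgh n_not by auto
  next
    assume e: "e \<in> cut G E M \<and> e \<noteq> f"
    then obtain x x' where "ends G2 e = Upair x y" using ends_cut by blast
    moreover have "e \<in> {g, h}" using e fgh(1) by auto
    ultimately show ?thesis by auto
  qed
qed

lemma inc_c2: "e \<in> edges G2 \<Longrightarrow> c \<in> set_uprod (ends G2 e) \<longleftrightarrow> e \<in> {f, n}"
proof -
  assume "e \<in> edges G2"
  then have "e = n \<or> e \<in> inner G E M \<or> e = f \<or> (e \<in> cut G E M \<and> e \<noteq> f)" by auto
  then show ?thesis
  proof (elim disjE)
    assume "e = n" then show ?thesis using n_not by simp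
  next
    assume e: "e \<in> inner G E M"
    then have "e \<notin> {f, n}" using n_not fgh(1) by (auto simp: inner_def cut_def)
    then show ?thesis using ends_inner[OF e] e M by (auto simp: inner_def)
  next
    assume "e = f" then show ?thesis by simp
  next
    assume e: "e \<in> cut G E M \<and> e \<noteq> f"
    then obtain x where "x \<in> M" "ends G2 e = Upair x y" using ends_cut by blast
    then show ?thesis using e n_not M y by auto
  qed
qed

lemma dg_y: "F \<subseteq> edges G2 \<Longrightarrow> dg G2 F y = card (F \<inter> {n, g, h})"
proof -
  assume "F \<subseteq> edges G2"
  then have "{e\<in>F. y \<in> set_uprod (ends G2 e)} = F \<inter> {n, g, h}" using inc_y by blast
  then show ?thesis unfolding dg_def by simp
qed

text \<open>The vertex \<open>y\<close> has the three edges \<open>n\<close>, \<open>g\<close> and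
  \<open>h\<close>, and the vertices of \<open>M\<close> keep all their edges.\<close>

lemma near_odd_G2: "near_odd G2 c f n u y"
proof -
  have M': "M \<subseteq> V" "c \<notin> M" using M by auto
  have E2: "edges G2 \<subseteq> E" using n_not by (auto simp: inner_def cut_def)
  interpret G2: lgraph G2
  proof
    have "finite M" using M' finite_V finite_subset by blast
    moreover have "finite (edges G2)" using E2 by auto
    moreover have "set_uprod (ends G2 e) \<subseteq> verts G2" if "e \<in> edges G2" for e
    proof -
      have "v \<in> M \<or> v = y \<or> v = c" if "v \<in> set_uprod (ends G2 e)" for v
        using that f(2) by (auto simp: uprod.set_map split: if_splits)
      then show ?thesis unfolding contract_subdivide_simps(1) by blast
    qed
    ultimately show "Defs.multigraph G2" by (simp add: multigraph_def)
    show "Defs.loopless G2" unfolding loopless_def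
    proof (intro ballI allI)
      fix e v assume "e \<in> edges G2"
      then have "e = n \<or> e \<in> inner G E M \<or> e = f \<or> (e \<in> cut G E M \<and> e \<noteq> f)" by auto
      then show "ends G2 e \<noteq> Upair v v"
      proof (elim disjE)
        assume "e = n" then show ?thesis using n_not y by auto
      next
        assume e: "e \<in> inner G E M"
        then have "ends G e \<noteq> Upair v v" using loopless by (auto simp: inner_def loopless_def)
        then show ?thesis using ends_inner[OF e] by simp
      next
        assume "e = f" then show ?thesis using f M' by auto
      next
        assume "e \<in> cut G E M \<and> e \<noteq> f"
        then obtain x where "x \<in> M" "ends G2 e = Upair x y" using ends_cut by blast
        then show ?thesis using y by auto
      qed
    qed
  qed
  have fin: "f \<in> edges G2" "n \<in> edges G2" "g \<in> edges G2" using fgh by auto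
  have cM: "conn G2 (edges G2) M"
  proof (rule conn_image[OF M(2), where h = id])
    fix x x' e assume e: "x \<in> M" "x' \<in> M" "e \<in> E" "ends G e = Upair x x'"
    then have "e \<in> inner G E M" by (auto simp: inner_def)
    then have "(x, x') \<in> adj G2 (edges G2) M" using ends_inner[of e] e by (intro adjI[of e]) auto
    then show "(id x, id x') \<in> (adj G2 (edges G2) M)\<^sup>*" by auto
  qed auto
  obtain ug where ug: "ug \<in> M" "ends G2 g = Upair ug y" using ends_cut[of g] fgh by auto
  have conn2: "conn G2 (edges G2) (verts G2 - {v})" if v: "v \<in> verts G2" for v
  proof -
    consider "v = y" | "v = c" | "v \<in> M" using v by auto
    then show ?thesis
    proof cases
      case 1
      have "ends G2 f = Upair u c" by simp
      from conn_insert[OF cM f(2) fin(1) this] have "conn G2 (edges G2) (insert c M)" .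
      moreover have "verts G2 - {v} = insert c M" using 1 y M' by auto
      ultimately show ?thesis by simp
    next
      case 2
      from conn_insert[OF cM ug(1) fin(3) ug(2)] have "conn G2 (edges G2) (insert y M)" .
      moreover have "verts G2 - {v} = insert y M" using 2 y M' by auto
      ultimately show ?thesis by simp
    next
      case 3
      \<comment> \<open>The new edge \<open>n\<close> survives the removal of \<open>v\<close>, so
        the path over \<open>c\<close> still replaces the edge \<open>f\<close> whenever
        \<open>u\<close> survives.\<close>
      have yc: "(y, c) \<in> adj G2 (edges G2) (verts G2 - {v})" "(c, y) \<in> adj G2 (edges G2) (verts G2 - {v})"
        using fin 3 y M' n_not by (auto intro!: adjI[of n] adjI'[of n])
      have "conn G E (V - {v})" using 3 M' del_conn by auto
      then show ?thesis
      proof (rule conn_image[where h = "\<lambda>x. if x \<in> M then x else y"])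
        fix x x' e assume e: "x \<in> V - {v}" "x' \<in> V - {v}" "e \<in> E" "ends G e = Upair x x'"
        have cr: "(a, y) \<in> (adj G2 (edges G2) (verts G2 - {v}))\<^sup>*"
          if "e \<in> cut G E M" "a \<in> M" "a \<noteq> v" "b \<notin> M" "ends G e = Upair a b" for a b
        proof (cases "e = f")
          case True
          then have "a = u" using that f by auto
          then have "(a, c) \<in> adj G2 (edges G2) (verts G2 - {v})" using fin that(2,3) 3 M' by (intro adjI[of f]) auto
          then show ?thesis using yc by (meson r_into_rtrancl rtrancl_trans)
        next
          case False
          then obtain x x' where "x \<in> M" "x' \<notin> M" "ends G e = Upair x x'" "ends G2 e = Upair x y" using ends_cut[OF \<open>e \<in> cut G E M\<close> False] by blast
          then have "ends G2 e = Upair a y" using that by auto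
          then have "(a, y) \<in> adj G2 (edges G2) (verts G2 - {v})" using that 3 y by (intro adjI[of e]) auto
          then show ?thesis by blast
        qed
        have e': "ends G e = Upair x' x" using e by auto
        consider "x \<in> M" "x' \<in> M" | "x \<in> M" "x' \<notin> M" | "x \<notin> M" "x' \<in> M" | "x \<notin> M" "x' \<notin> M" by blast
        then show "(if x \<in> M then x else y, if x' \<in> M then x' else y) \<in> (adj G2 (edges G2) (verts G2 - {v}))\<^sup>*"
        proof cases
          case 1
          then have "e \<in> inner G E M" using e by (auto simp: inner_def)
          then have "(x, x') \<in> adj G2 (edges G2) (verts G2 - {v})" using ends_inner[of e] e 1 by (intro adjI[of e]) auto
          then show ?thesis using 1 by auto
        next
          case 2
          then have "e \<in> cut G E M" using cut_iff[OF e(4)] e(3) by auto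
          then show ?thesis using cr[of x x'] 2 e by auto
        next
          case 3
          then have "e \<in> cut G E M" using cut_iff[OF e(4)] e(3) by auto
          then have "(x', y) \<in> (adj G2 (edges G2) (verts G2 - {v}))\<^sup>*" using cr[of x' x] 3 e e' by auto
          then show ?thesis using 3 adj_rtrancl_sym by auto
        qed auto
      next
        fix z assume z: "z \<in> verts G2 - {v}"
        have yV: "y \<in> V - {v}" using y 3 by auto
        consider "z \<in> M" | "z = y" | "z = c" using z by auto
        then show "\<exists>x\<in>V - {v}. (z, if x \<in> M then x else y) \<in> (adj G2 (edges G2) (verts G2 - {v}))\<^sup>*"
        proof cases
          case 1 then show ?thesis using z M' by (intro bexI[of _ z]) auto
        next
          case 2 then show ?thesis using y yV by (intro bexI[of _ y]) auto
        next
          case 3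
          then have "(z, if y \<in> M then y else y) \<in> (adj G2 (edges G2) (verts G2 - {v}))\<^sup>*" using yc by auto
          then show ?thesis using yV by blast
        qed
      qed
    qed
  qed
  show ?thesis
  proof
    have "finite M" using M' finite_V finite_subset by blast
    then have "card (verts G2) = card M + 2" using M' y by auto
    then show "card (verts G2) \<ge> 3" using card_M by simp
    show "conn G2 (edges G2) (verts G2 - {v})" if "v \<in> verts G2" for v using conn2 that .
    show "ends G2 f = Upair c u" by (simp add: Upair_inject)
    show "ends G2 n = Upair c y" using n_not by simp
    show "e = f \<or> e = n" if "e \<in> edges G2" "c \<in> set_uprod (ends G2 e)" for e using inc_c2 that by blast
    fix v assume v: "v \<in> verts G2" "v \<noteq> c"
    show "odd (dg G2 (edges G2) v)"
    proof (cases "v = y")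
      case True
      have "edges G2 \<inter> {n, g, h} = {n, g, h}" using fgh by auto
      moreover have "card {n, g, h} = 3" using fgh n_not by (auto simp: card_insert_if)
      ultimately show ?thesis using dg_y[OF order_refl] True by simp
    next
      case False
      then have vM: "v \<in> M" using v by auto
      have "dg G (edges G2) v = dg G E v"
        using vM E2 by (intro dg_cong) (auto simp: inner_def cut_def)
      then show ?thesis using dg_G2[OF vM order_refl] odd_deg[of v] vM M by auto
    qed
  qed (use fin n_not in auto)
qed

text \<open>At \<open>c\<close> the colors of \<open>f\<close> and \<open>n\<close> differ, and at
  \<open>y\<close> the colors of \<open>n\<close>, \<open>g\<close>, \<open>h\<close> agree or are
  all different. In either case exactly two of \<open>f\<close>, \<open>g\<close>, \<open>h\<close>
  have the same color, which is the pattern required by \<open>colorable_combine\<close>.\<close>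

lemma colorable_G2:
  assumes "colorable 3 G2" "conn G E (V - M)"
  shows "colorable 3 G"
proof -
  interpret G2: near_odd G2 c f n u y by (rule near_odd_G2)
  obtain \<kappa> where \<kappa>: "\<And>e. e \<in> edges G2 \<Longrightarrow> \<kappa> e < 3" "\<And>v. v \<in> verts G2 \<Longrightarrow> good_at G2 \<kappa> v"
    using assms(1) unfolding colorable_iff by blast
  have E2: "f \<in> edges G2" "g \<in> edges G2" "h \<in> edges G2" "n \<in> edges G2" using fgh by auto
  have lt: "\<kappa> f < 3" "\<kappa> g < 3" "\<kappa> h < 3" "\<kappa> n < 3" using \<kappa>(1) E2 by auto
  have fn: "\<kappa> f \<noteq> \<kappa> n"
  proof
    assume eq: "\<kappa> f = \<kappa> n"
    define F where "F = {e\<in>edges G2. \<kappa> e = \<kappa> f}"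
    have F: "F \<subseteq> edges G2" unfolding F_def by blast
    have "f \<in> F" "n \<in> F" unfolding F_def using E2 eq by (simp_all only: mem_Collect_eq)
    then have "dg G2 F c = 2" using G2.dg_c_sub[OF F] by simp
    moreover have "zero_or_odd (dg G2 F c)" using \<kappa>(2)[of c] unfolding good_at_def F_def by simp
    ultimately show False by (simp add: zero_or_odd_def)
  qed
  have num: "zero_or_odd (card {e\<in>{n, g, h}. \<kappa> e = i})" for i
  proof -
    have "{e\<in>edges G2. \<kappa> e = i} \<inter> {n, g, h} = {e\<in>{n, g, h}. \<kappa> e = i}" using E2 by auto
    moreover have "dg G2 {e\<in>edges G2. \<kappa> e = i} y = card ({e\<in>edges G2. \<kappa> e = i} \<inter> {n, g, h})" by (rule dg_y) blast
    moreover have "zero_or_odd (dg G2 {e\<in>edges G2. \<kappa> e = i} y)" using \<kappa>(2)[of y] by (simp add: good_at_def)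
    ultimately show ?thesis by simp
  qed
  have ngh: "n \<noteq> g" "n \<noteq> h" "g \<noteq> h" using n_not fgh by auto
  have tri: "\<kappa> n = \<kappa> g \<and> \<kappa> n = \<kappa> h \<or> \<kappa> n \<noteq> \<kappa> g \<and> \<kappa> n \<noteq> \<kappa> h \<and> \<kappa> g \<noteq> \<kappa> h"
  proof (rule ccontr)
    assume nt: "\<not> ?thesis"
    have *: False if "\<kappa> a = \<kappa> b" "\<kappa> a \<noteq> \<kappa> d" "{n, g, h} = {a, b, d}" "a \<noteq> b" for a b d
    proof -
      have "{e\<in>{n, g, h}. \<kappa> e = \<kappa> a} = {a, b}" unfolding that(3) using that by auto
      then show False using num[of "\<kappa> a"] that(4) by (simp add: zero_or_odd_def)
    qed
    show False using nt *[of n g h] *[of n h g] *[of g h n] ngh by (auto simp: insert_commute)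
  qed
  have main: "colorable 3 G" if "cut G E M = {a, b, d}" "\<kappa> b = \<kappa> d" "\<kappa> a \<noteq> \<kappa> b" for a b d
  proof (rule colorable_combine[of M \<kappa> a "\<kappa> b"])
    show "\<kappa> e < 3" if "e \<in> inner G E M \<union> cut G E M" for e using \<kappa>(1)[of e] that by auto
    show "good_at G \<kappa> v" if v: "v \<in> M" for v
      unfolding good_at_def
    proof
      fix i
      have "dg G {e\<in>E. \<kappa> e = i} v = dg G {e\<in>edges G2. \<kappa> e = i} v"
        using v n_not by (intro dg_cong) (auto simp: inner_def cut_def)
      also have "\<dots> = dg G2 {e\<in>edges G2. \<kappa> e = i} v" using dg_G2[OF v] by (metis (no_types, lifting) mem_Collect_eq subsetI)
      finally show "zero_or_odd (dg G {e\<in>E. \<kappa> e = i} v)" using \<kappa>(2)[of v] v by (simp add: good_at_def)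
    qed
    show "\<kappa> b < 3" using \<kappa>(1)[of b] that by auto
  qed (use M assms(2) that in auto)
  show ?thesis
  proof (cases "\<kappa> n = \<kappa> g \<and> \<kappa> n = \<kappa> h")
    case True
    then show ?thesis using main[of f g h] fgh(1) fn by auto
  next
    case False
    then have d: "\<kappa> n \<noteq> \<kappa> g" "\<kappa> n \<noteq> \<kappa> h" "\<kappa> g \<noteq> \<kappa> h" using tri by auto
    then have "\<kappa> f = \<kappa> g \<or> \<kappa> f = \<kappa> h" using fn lt by linarith
    then show ?thesis using main[of h f g] main[of g f h] fgh(1) d by (auto simp: insert_commute)
  qed
qed

text \<open>A set of vertices of \<open>G2\<close> is translated by letting \<open>y\<close> stand
  for \<open>V - M\<close>. Only \<open>f\<close> needs care: it became the path from
  \<open>u\<close> over \<open>c\<close> to \<open>y\<close>, and if \<open>u\<close> and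
  \<open>y\<close> are separated then one of its halves \<open>f\<close> and \<open>n\<close> is
  cut.\<close>

lemma cuts3_G2:
  assumes "cuts3 G c"
  shows "cuts3 G2 c"
  unfolding cuts3_def
proof (intro allI impI)
  fix X assume X: "X \<subseteq> verts G2" "X - {c} \<noteq> {}" "verts G2 - X - {c} \<noteq> {}"
  define X' where "X' = (X \<inter> M) \<union> (if y \<in> X then V - M else {})"
  have "X' \<subseteq> V" "X' - {c} \<noteq> {}" "V - X' - {c} \<noteq> {}"
    using X M y by (auto simp: X'_def split: if_splits)
  then have "3 \<le> card (cut G E X')" using assms unfolding cuts3_def by blast
  also have "card (cut G E X') \<le> card (cut G2 (edges G2) X)"
  proof -
    have X'M: "v \<in> X' \<longleftrightarrow> v \<in> X" if "v \<in> M" for v using that by (auto simp: X'_def)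
    have X'Y: "v \<in> X' \<longleftrightarrow> y \<in> X" if "v \<in> V - M" for v using that by (auto simp: X'_def)
    have fin: "finite (cut G2 (edges G2) X)"
    proof -
      have "finite (edges G2)" by (auto simp: inner_def cut_def)
      then show ?thesis by (auto simp: cut_def)
    qed
    have other: "e \<in> cut G2 (edges G2) X" if e: "e \<in> cut G E X'" "e \<noteq> f" for e
    proof -
      obtain a b where ab: "e \<in> E" "ends G e = Upair a b" "a \<in> X'" "b \<notin> X'" using e(1) by (rule cutE)
      have V: "a \<in> V" "b \<in> V" using ends_in_V[OF ab(1,2)] by auto
      have ba: "ends G e = Upair b a" using ab by auto
      consider "a \<in> M" "b \<in> M" | "e \<in> cut G E M" | "a \<notin> M" "b \<notin> M" unfolding cut_iff[OF ab(2)] using ab(1) by blast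
      then show ?thesis
      proof cases
        case 1
        then have i: "e \<in> inner G E M" using ab by (auto simp: inner_def)
        then have "ends G2 e = Upair a b" using ends_inner ab by simp
        from cut_iff[OF this] show ?thesis using i X'M 1 ab by auto
      next
        case 2
        then obtain x x' where x: "x \<in> M" "x' \<notin> M" "ends G e = Upair x x'" "ends G2 e = Upair x y" using ends_cut e(2) by blast
        have "x' \<in> V" using x(3) ab V by auto
        have "(x \<in> X') \<noteq> (x' \<in> X')" using cut_iff[OF x(3)] e(1) by blast
        then have "(x \<in> X) \<noteq> (y \<in> X)" using X'M x X'Y[of x'] \<open>x' \<in> V\<close> by auto
        then show ?thesis using cut_iff[OF x(4)] 2 by auto
      next
        case 3
        then show ?thesis using X'Y V ab by blast
      qed
    qed
    show ?thesis
    proof (cases "f \<in> cut G E X' \<and> f \<notin> cut G2 (edges G2) X")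
      case False
      then have "cut G E X' \<subseteq> cut G2 (edges G2) X" using other by blast
      then show ?thesis using fin by (rule card_mono[rotated])
    next
      case True
      have ef: "ends G2 f = Upair u c" "ends G2 n = Upair c y" using n_not by auto
      have f'V: "f' \<in> V" using ends_in_V[OF fgh_E(1) f(1)] by simp
      have "(u \<in> X') \<noteq> (f' \<in> X')" using True cut_iff[OF f(1)] by blast
      then have "(u \<in> X) \<noteq> (y \<in> X)" using X'M f X'Y[of f'] f'V by auto
      moreover have "(u \<in> X) = (c \<in> X)" using True cut_iff[OF ef(1)] fgh by auto
      ultimately have nX: "n \<in> cut G2 (edges G2) X" using cut_iff[OF ef(2)] by auto
      have "n \<notin> cut G E X'"
      proof
        assume "n \<in> cut G E X'"
        then obtain a b where "ends G n = Upair a b" "a \<in> X'" "b \<notin> X'" by (rule cutE)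
        moreover from this have "a \<in> V - M" "b \<in> V - M" using n by (auto simp: inner_def)
        ultimately show False using X'Y by blast
      qed
      have fG: "finite (cut G E X')" by (simp add: cut_def)
      have "card (cut G E X') = card (insert n (cut G E X' - {f}))"
        using True fG \<open>n \<notin> cut G E X'\<close> by (metis DiffD1 card.remove card_insert_disjoint finite_Diff)
      also have "\<dots> \<le> card (cut G2 (edges G2) X)"
        using nX other fin by (intro card_mono) auto
      finally show ?thesis .
    qed
  qed
  finally show "3 \<le> card (cut G2 (edges G2) X)" .
qed

end

section \<open>Rerouting paths from \<open>p\<close> to \<open>q\<close>\<close>

lemma pth_mid: "pth G F S (as @ bs @ cs) \<Longrightarrow> bs \<noteq> [] \<Longrightarrow> set bs \<subseteq> S' \<Longrightarrow> pth G F S' bs"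
  unfolding pth_def by (auto simp: successively_append_iff)

lemma pth_edge: "pth G F S (as @ x # y # bs) \<Longrightarrow> \<exists>e\<in>F. ends G e = Upair x y"
  unfolding pth_def by (auto simp: successively_append_iff)

lemma pth_replace:
  assumes "pth G F S (as @ [a])" "pth G F S ps" "pth G F S (b # bs)"
    "set (as @ [a]) \<inter> set ps = {}" "set ps \<inter> set (b # bs) = {}" "set (as @ [a]) \<inter> set (b # bs) = {}"
    "e \<in> F" "ends G e = Upair a (hd ps)" "e' \<in> F" "ends G e' = Upair (last ps) b"
  shows "pth G F S (as @ [a] @ ps @ b # bs)"
proof -
  have "pth G F S (ps @ b # bs)"
    by (rule pth_append[OF assms(2,3,5), of e']) (use assms in simp_all)
  moreover have "ps \<noteq> []" using assms(2) by (simp add: pth_def)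
  ultimately have "pth G F S ((as @ [a]) @ (ps @ b # bs))"
    by (intro pth_append[OF assms(1) _ _ assms(7)]) (use assms in auto)
  then show ?thesis by simp
qed

lemma split_three:
  assumes "distinct xs" "3 \<le> card (N \<inter> set xs)"
  obtains as u1 bs u2 cs u3 ds where "xs = as @ u1 # bs @ u2 # cs @ u3 # ds"
    "u1 \<in> N" "u2 \<in> N" "u3 \<in> N" "set bs \<inter> N = {}" "set cs \<inter> N = {}"
proof -
  have "length (filter (\<lambda>v. v \<in> N) xs) = card (N \<inter> set xs)"
    using distinct_card[of "filter (\<lambda>v. v \<in> N) xs"] assms(1) by (simp add: Int_def conj_commute)
  then have "3 \<le> length (filter (\<lambda>v. v \<in> N) xs)" using assms(2) by simp
  then obtain u1 u2 u3 r where "filter (\<lambda>v. v \<in> N) xs = u1 # u2 # u3 # r"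
    by (auto simp: numeral_3_eq_3 Suc_le_length_iff)
  then obtain as vs where 1: "xs = as @ u1 # vs" "u1 \<in> N" "u2 # u3 # r = filter (\<lambda>v. v \<in> N) vs"
    unfolding filter_eq_Cons_iff by blast
  obtain bs ws where 2: "vs = bs @ u2 # ws" "u2 \<in> N" "\<forall>u\<in>set bs. u \<notin> N" "u3 # r = filter (\<lambda>v. v \<in> N) ws"
    using 1(3)[symmetric] unfolding filter_eq_Cons_iff by blast
  obtain cs ds where 3: "ws = cs @ u3 # ds" "u3 \<in> N" "\<forall>u\<in>set cs. u \<notin> N"
    using 2(4)[symmetric] unfolding filter_eq_Cons_iff by blast
  show ?thesis
    by (rule that[of as u1 bs u2 cs u3 ds]) (use 1 2 3 in auto)
qed

context near_odd
begin

definition pq_path :: "'a list \<Rightarrow> bool" where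
  "pq_path xs \<longleftrightarrow> pth G E (V - {c}) xs \<and> hd xs = p \<and> last xs = q"

lemma pq_path_D: "pq_path xs \<Longrightarrow> set xs \<subseteq> V - {c} \<and> p \<in> set xs \<and> q \<in> set xs \<and> distinct xs \<and> xs \<noteq> []"
  by (auto simp: pq_path_def pth_def)

lemma c_nbr: "e \<in> E \<Longrightarrow> ends G e = Upair x c \<Longrightarrow> x = p \<or> x = q"
  using c_only[of e] ep eq by auto

lemma conn_same_side: "conn G E S \<Longrightarrow> S \<subseteq> S' \<Longrightarrow> x \<in> S \<Longrightarrow> y \<in> S \<Longrightarrow> (x, y) \<in> (adj G E S')\<^sup>*"
  using adj_rtrancl_mono[of x y G E S E S'] unfolding conn_def by blast

lemma pth_conn: "pth G E S xs \<Longrightarrow> conn G E (set xs)"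
proof -
  assume "pth G E S xs"
  from pth_edges[OF this order_refl] obtain P where "P \<subseteq> inner G E (set xs)" "conn G P (set xs)" by blast
  then show ?thesis by (elim conn_mono) (auto simp: inner_def)
qed

lemma one_edge:
  assumes "\<not> colorable 3 G" "proper2 \<phi>" "pq_path xs" "D \<subseteq> V - {c} - set xs" "conn G E D" "v \<in> set xs"
  shows "card {e\<in>E. \<exists>d\<in>D. ends G e = Upair v d} \<le> 1"
proof (rule ccontr)
  assume "\<not> ?thesis"
  moreover have "finite {e\<in>E. \<exists>d\<in>D. ends G e = Upair v d}" by simp
  ultimately obtain f1 f2 where f: "f1 \<in> {e\<in>E. \<exists>d\<in>D. ends G e = Upair v d}"
    "f2 \<in> {e\<in>E. \<exists>d\<in>D. ends G e = Upair v d}" "f1 \<noteq> f2"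
    unfolding One_nat_def by (auto simp only: card_le_Suc0_iff_eq)
  then obtain d1 d2 where "f1 \<in> E" "d1 \<in> D" "ends G f1 = Upair v d1" "f2 \<in> E" "d2 \<in> D" "ends G f2 = Upair v d2" by auto
  moreover have "pth G E (V - {c}) xs" "hd xs = p" "last xs = q" using assms(3) by (simp_all add: pq_path_def)
  ultimately show False using colorable_two_edges[OF assms(2), of xs D v f1 f2 d1 d2] assms(1,4-6) f(3) by blast
qed

text \<open>The situation where all cubic vertices except the neighbors of \<open>c\<close> are excluded. Take a path
  \<open>xs\<close> from \<open>p\<close> to \<open>q\<close> that leaves the largest possible connected set \<open>B\<close>. For three consecutive
  attachments \<open>u1\<close>, \<open>u2\<close>, \<open>u3\<close> of \<open>B\<close> the part \<open>U\<close> hanging at the segment between \<open>u1\<close> and \<open>u3\<close>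
  is separated by a cut of size three: any further edge would allow to reroute \<open>xs\<close> and free
  \<open>u1\<close> or \<open>u3\<close>.\<close>

lemma colorable_off_path:
  assumes n: "\<not> colorable 3 G" and \<phi>: "proper2 \<phi>" and c3: "cuts3 G c"
    and triv: "\<And>X. X \<subseteq> V - {c} \<Longrightarrow> card (cut G E X) = 3 \<Longrightarrow> card X = 1 \<or> card (V - X - {c}) = 1"
    and big: "\<And>v. v \<in> V \<Longrightarrow> v \<notin> {c, p, q} \<Longrightarrow> dg G E v \<noteq> 3"
    and xs: "pq_path xs" and B: "B \<subseteq> V - {c} - set xs" "B \<noteq> {}" "conn G E B"
    and max: "\<And>xs' B'. pq_path xs' \<Longrightarrow> B' \<subseteq> V - {c} - set xs' \<Longrightarrow> conn G E B' \<Longrightarrow> card B' \<le> card B"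
  shows False
proof -
  note xsD = pq_path_D[OF xs]
  have fB: "finite B" using B(1) finite_subset[of B V] by auto
  \<comment> \<open>A path that avoids \<open>B\<close> together with a neighbor \<open>x\<close> of
    \<open>B\<close> would leave room for a larger connected set.\<close>
  have bigger: False if "pq_path xs'" "insert x B \<subseteq> V - {c} - set xs'" "x \<notin> B" "e \<in> E" "ends G e = Upair x b" "b \<in> B" for xs' x e b
  proof -
    have "ends G e = Upair b x" using that(5) by auto
    then have "conn G E (insert x B)" using conn_insert[OF B(3) that(6,4)] by blast
    then show False using max[OF that(1,2)] that(3) fB by simp
  qed
  have att: "x \<in> set xs" if e: "e \<in> E" "ends G e = Upair x b" "b \<in> B" "x \<notin> B" for e x b
  proof (rule ccontr)
    assume nx: "x \<notin> set xs"
    have "x \<in> V" using ends_in_V[OF e(1,2)] by simp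
    moreover have "x \<noteq> c"
    proof
      assume "x = c"
      then have "ends G e = Upair b c" using e by auto
      then show False using c_nbr[OF e(1)] e(3) B(1) xsD by blast
    qed
    ultimately show False using bigger[OF xs _ e(4,1,2,3)] nx B(1) by auto
  qed
  define N where "N = {v\<in>set xs. \<exists>e\<in>E. \<exists>b\<in>B. ends G e = Upair v b}"
  have "\<forall>e\<in>cut G E B. \<exists>v\<in>N. \<exists>b\<in>B. ends G e = Upair v b"
  proof
    fix e assume "e \<in> cut G E B"
    then obtain b x where e: "e \<in> E" "ends G e = Upair b x" "b \<in> B" "x \<notin> B" by (rule cutE)
    then have "ends G e = Upair x b" by auto
    then show "\<exists>v\<in>N. \<exists>b\<in>B. ends G e = Upair v b" using att[OF e(1) _ e(3,4)] e unfolding N_def by blast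
  qed
  then obtain g where g: "\<And>e. e \<in> cut G E B \<Longrightarrow> g e \<in> N \<and> (\<exists>b\<in>B. ends G e = Upair (g e) b)" by metis
  \<comment> \<open>By \<open>one_edge\<close> every attachment sends a single edge to
    \<open>B\<close>, so there are at least as many attachments as edges in the boundary of
    \<open>B\<close>, that is, at least three.\<close>
  have "inj_on g (cut G E B)"
  proof (rule inj_onI)
    fix e1 e2 assume e: "e1 \<in> cut G E B" "e2 \<in> cut G E B" "g e1 = g e2"
    let ?D = "{e\<in>E. \<exists>d\<in>B. ends G e = Upair (g e1) d}"
    have "e1 \<in> ?D" "e2 \<in> ?D" using g[OF e(1)] g[OF e(2)] e by (auto simp: cut_def)
    moreover have "card ?D \<le> 1" using g[OF e(1)] one_edge[OF n \<phi> xs B(1,3)] by (auto simp: N_def)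
    moreover have "finite ?D" by simp
    ultimately show "e1 = e2" unfolding One_nat_def by (auto simp only: card_le_Suc0_iff_eq)
  qed
  moreover have "g ` cut G E B \<subseteq> N" using g by blast
  moreover have "finite N" by (simp add: N_def)
  ultimately have "card (cut G E B) \<le> card N" by (rule card_inj_on_le)
  moreover have "3 \<le> card (cut G E B)"
  proof -
    have "B - {c} \<noteq> {}" "V - B - {c} \<noteq> {}" "B \<subseteq> V" using B xsD by auto
    then show ?thesis using c3 unfolding cuts3_def by blast
  qed
  moreover have "N \<inter> set xs = N" by (auto simp: N_def)
  ultimately have "3 \<le> card (N \<inter> set xs)" by simp
  with xsD obtain as u1 bs u2 cs u3 ds where split: "xs = as @ u1 # bs @ u2 # cs @ u3 # ds"
    and uN: "u1 \<in> N" "u2 \<in> N" "u3 \<in> N" and no: "set bs \<inter> N = {}" "set cs \<inter> N = {}"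
    using split_three[of xs N] by metis
  have pxs: "pth G E (V - {c}) xs" using xs by (simp add: pq_path_def)
  have dist: "distinct (as @ u1 # bs @ u2 # cs @ u3 # ds)" using xsD split by simp
  have pA: "p \<in> set (as @ [u1])" using xs split by (cases as) (auto simp: pq_path_def)
  have qD: "q \<in> set (u3 # ds)" using xs split by (cases ds rule: rev_cases) (auto simp: pq_path_def)
  have hdA: "hd (as @ [u1]) = p" using xs split by (cases as) (auto simp: pq_path_def)
  have lastD: "last (u3 # ds) = q" using xs split by (cases ds rule: rev_cases) (auto simp: pq_path_def)
  let ?Z = "bs @ u2 # cs"
  \<comment> \<open>What remains available for a detour around \<open>u2\<close>: neither
    \<open>B\<close> nor the parts of \<open>xs\<close> up to \<open>u1\<close> and from
    \<open>u3\<close> on.\<close>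
  define S where "S = V - {c} - B - set (as @ [u1]) - set (u3 # ds)"
  define U where "U = {v. (u2, v) \<in> (adj G E S)\<^sup>*}"
  have setxs: "set xs = set (as @ [u1]) \<union> set ?Z \<union> set (u3 # ds)" unfolding split by auto
  have dj: "set ?Z \<inter> set (as @ [u1]) = {}" "set ?Z \<inter> set (u3 # ds) = {}" "set (as @ [u1]) \<inter> set (u3 # ds) = {}"
    using dist by auto
  have "set xs \<subseteq> V - {c}" "set xs \<inter> B = {}" using xsD B(1) by blast+
  then have ZS: "set ?Z \<subseteq> S" using dj setxs unfolding S_def by blast
  then have u2S: "u2 \<in> S" by simp
  have US: "U \<subseteq> S" using adj_rtrancl_in[of u2 _ G E S] u2S by (auto simp: U_def)
  have cU: "conn G E U" unfolding U_def by (rule reach_conn)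
  have "pth G E S ?Z"
    using pxs pth_mid[of G E "V - {c}" "as @ [u1]" ?Z "u3 # ds" S] ZS unfolding split by simp
  then have "conn G E (set ?Z)" by (rule pth_conn)
  then have ZU: "set ?Z \<subseteq> U" using conn_same_side[OF _ ZS, of u2] by (auto simp: U_def)
  have closed: "y \<in> U" if "e \<in> E" "ends G e = Upair x y" "x \<in> U" "y \<in> S" for e x y
  proof -
    have "(x, y) \<in> adj G E S" using that US by (intro adjI[OF that(1,2)]) auto
    then show ?thesis using that(3) unfolding U_def by (auto intro: rtrancl_into_rtrancl)
  qed
  have pA1: "pth G E (V - {c}) (as @ [u1])" using pxs pth_take[of G E "V - {c}" as u1] unfolding split by simp
  have pD1: "pth G E (V - {c}) (u3 # ds)" using pxs pth_drop[of G E "V - {c}" "as @ u1 # ?Z" u3 ds] unfolding split by simp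
  have UV: "U \<subseteq> V - {c}" "U \<inter> B = {}" "U \<inter> set (as @ [u1]) = {}" "U \<inter> set (u3 # ds) = {}" using US by (auto simp: S_def)
  have BV: "B \<subseteq> V - {c}" "B \<inter> set xs = {}" using B by auto
  obtain e1 b1 where e1: "e1 \<in> E" "b1 \<in> B" "ends G e1 = Upair u1 b1" using uN(1) by (auto simp: N_def)
  obtain e3 b3 where e3: "e3 \<in> E" "b3 \<in> B" "ends G e3 = Upair u3 b3" using uN(3) by (auto simp: N_def)
  have e3': "ends G e3 = Upair b3 u3" using e3 by auto
  obtain rs where rs: "pth G E B rs" "hd rs = b1" "last rs = b3" using conn_pth[OF B(3) e1(2) e3(2)] by blast
  have rsB: "set rs \<subseteq> B" using rs(1) by (simp add: pth_def)
  \<comment> \<open>Leading the path through \<open>B\<close> instead of its middle segment sets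
    \<open>U\<close> free, so \<open>one_edge\<close> bounds the edges from \<open>u1\<close> and
    from \<open>u3\<close> to \<open>U\<close>.\<close>
  define xs1 where "xs1 = as @ [u1] @ rs @ u3 # ds"
  have "pq_path xs1"
  proof -
    have "pth G E (V - {c}) rs" using rs(1) by (rule pth_mono) (use rsB BV in auto)
    then have "pth G E (V - {c}) xs1" unfolding xs1_def
      using pA1 pD1 e1 e3 e3' rs BV rsB dist split by (intro pth_replace[of _ _ _ _ _ _ _ _ e1 e3]) auto
    moreover have "hd xs1 = p" using hdA by (cases as) (auto simp: xs1_def)
    moreover have "last xs1 = q" using lastD by (simp add: xs1_def)
    ultimately show ?thesis by (simp add: pq_path_def)
  qed
  have U1: "U \<subseteq> V - {c} - set xs1" using UV rsB by (auto simp: xs1_def)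
  define C1 where "C1 = {e\<in>E. \<exists>d\<in>U. ends G e = Upair u1 d}"
  define C2 where "C2 = {e\<in>E. \<exists>d\<in>B. ends G e = Upair u2 d}"
  define C3 where "C3 = {e\<in>E. \<exists>d\<in>U. ends G e = Upair u3 d}"
  have C: "card C1 \<le> 1" "card C2 \<le> 1" "card C3 \<le> 1"
    unfolding C1_def C2_def C3_def
    using one_edge[OF n \<phi> \<open>pq_path xs1\<close> U1 cU, of u1] one_edge[OF n \<phi> \<open>pq_path xs1\<close> U1 cU, of u3]
      one_edge[OF n \<phi> xs B(1,3), of u2] by (auto simp: xs1_def split)
  have "cut G E U \<subseteq> C1 \<union> C2 \<union> C3"
  proof
    fix e assume "e \<in> cut G E U"
    then obtain x y where e: "e \<in> E" "ends G e = Upair x y" "x \<in> U" "y \<notin> U" by (rule cutE)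
    have e': "ends G e = Upair y x" using e by auto
    have yV: "y \<in> V" using ends_in_V[OF e(1,2)] by simp
    have "y \<notin> S" using closed[OF e(1-3)] e(4) by blast
    then consider "y = c" | "y \<in> B" | "y \<in> set as" | "y = u1" | "y = u3" | "y \<in> set ds" using yV by (auto simp: S_def)
    then show "e \<in> C1 \<union> C2 \<union> C3"
    proof cases
      case 1
      then have "x = p \<or> x = q" using c_nbr[OF e(1)] e(2) by blast
      then show ?thesis using e(3) UV pA qD by blast
    next
      case 2
      have "x \<notin> B" using e(3) UV by blast
      then have "x \<in> set xs" using att[OF e(1,2) 2] by blast
      then have "x \<in> N" using e 2 by (auto simp: N_def)
      moreover have "x \<in> set ?Z" using \<open>x \<in> set xs\<close> e(3) UV unfolding split by auto
      ultimately have "x = u2" using no by auto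
      then show ?thesis using e 2 by (auto simp: C2_def)
    next
      \<comment> \<open>A detour from \<open>y\<close> through \<open>U\<close> to \<open>u3\<close>
        skips \<open>u1\<close>, which could then be added to \<open>B\<close>. The last case is the
        mirror image with \<open>u3\<close>.\<close>
      case 3
      then obtain as1 as2 where as: "as = as1 @ y # as2" by (meson split_list)
      have lU: "last ?Z \<in> U" using ZU last_in_set[of ?Z] by auto
      obtain ps where ps: "pth G E U ps" "hd ps = x" "last ps = last ?Z" using conn_pth[OF cU e(3) lU] by blast
      have psU: "set ps \<subseteq> U" using ps(1) by (simp add: pth_def)
      have "\<exists>e'\<in>E. ends G e' = Upair (last ?Z) u3"
      proof -
        have "?Z = butlast ?Z @ [last ?Z]" by (rule append_butlast_last_id[symmetric]) simp
        then have "as @ u1 # ?Z @ u3 # ds = as @ u1 # (butlast ?Z @ [last ?Z]) @ u3 # ds" by metis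
        then have "xs = (as @ u1 # butlast ?Z) @ last ?Z # u3 # ds" unfolding split by simp
        then show ?thesis using pxs pth_edge by metis
      qed
      then obtain e'' where e'': "e'' \<in> E" "ends G e'' = Upair (last ps) u3" using ps by auto
      let ?xs = "as1 @ [y] @ ps @ u3 # ds"
      have "pth G E (V - {c}) (as1 @ [y])" using pxs pth_take[of G E "V - {c}" as1 y] unfolding split as by simp
      moreover have "pth G E (V - {c}) ps" using ps(1) by (rule pth_mono) (use psU UV in auto)
      ultimately have "pth G E (V - {c}) ?xs"
        using pD1 e e' e'' ps psU UV dist as by (intro pth_replace[of _ _ _ _ _ _ _ _ e e'']) auto
      moreover have "hd ?xs = p" using hdA as by (cases as1) auto
      moreover have "last ?xs = q" using lastD by simp
      ultimately have "pq_path ?xs" by (simp add: pq_path_def)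
      moreover have "insert u1 B \<subseteq> V - {c} - set ?xs"
      proof -
        have "set ?xs \<subseteq> set as \<union> U \<union> set (u3 # ds)" using psU as by auto
        moreover have "u1 \<notin> set as" "u1 \<notin> set (u3 # ds)" using dist by auto
        moreover have "u1 \<notin> U" using UV(3) by auto
        moreover have "set as \<subseteq> set xs" "set (u3 # ds) \<subseteq> set xs" "u1 \<in> set xs" unfolding split by auto
        ultimately show ?thesis using BV UV(2) \<open>set xs \<subseteq> V - {c}\<close> by blast
      qed
      moreover have "u1 \<notin> B" using BV split by auto
      ultimately show ?thesis using bigger[OF _ _ _ e1(1,3,2)] by blast
    next
      case 4
      then show ?thesis using e e' by (auto simp: C1_def)
    next
      case 5
      then show ?thesis using e e' by (auto simp: C3_def)
    next
      case 6
      then obtain ds1 ds2 where ds: "ds = ds1 @ y # ds2" by (meson split_list)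
      have hU: "hd ?Z \<in> U" using ZU hd_in_set[of ?Z] by auto
      obtain ps where ps: "pth G E U ps" "hd ps = hd ?Z" "last ps = x" using conn_pth[OF cU hU e(3)] by blast
      have psU: "set ps \<subseteq> U" using ps(1) by (simp add: pth_def)
      have "\<exists>e'\<in>E. ends G e' = Upair u1 (hd ?Z)"
      proof -
        have "xs = as @ u1 # hd ?Z # (tl ?Z @ u3 # ds)" unfolding split by (cases bs) auto
        then show ?thesis using pxs pth_edge by metis
      qed
      then obtain e'' where e'': "e'' \<in> E" "ends G e'' = Upair u1 (hd ps)" using ps by auto
      let ?xs = "as @ [u1] @ ps @ y # ds2"
      have "pth G E (V - {c}) (y # ds2)" using pxs pth_drop[of G E "V - {c}" "as @ u1 # ?Z @ u3 # ds1" y ds2] unfolding split ds by simp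
      moreover have "pth G E (V - {c}) ps" using ps(1) by (rule pth_mono) (use psU UV in auto)
      ultimately have "pth G E (V - {c}) ?xs"
        using pA1 e e' e'' ps psU UV dist ds by (intro pth_replace[of _ _ _ _ _ _ _ _ e'' e]) auto
      moreover have "hd ?xs = p" using hdA by (cases as) auto
      moreover have "last ?xs = q" using lastD ds by simp
      ultimately have "pq_path ?xs" by (simp add: pq_path_def)
      moreover have "insert u3 B \<subseteq> V - {c} - set ?xs"
      proof -
        have "set ?xs \<subseteq> set (as @ [u1]) \<union> U \<union> set ds" using psU ds by auto
        moreover have "u3 \<notin> set ds" "u3 \<notin> set (as @ [u1])" using dist by auto
        moreover have "u3 \<notin> U" using UV(4) by auto
        moreover have "set ds \<subseteq> set xs" "set (as @ [u1]) \<subseteq> set xs" "u3 \<in> set xs" unfolding split by auto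
        ultimately show ?thesis using BV UV(2) \<open>set xs \<subseteq> V - {c}\<close> by blast
      qed
      moreover have "u3 \<notin> B" using BV split by auto
      ultimately show ?thesis using bigger[OF _ _ _ e3(1,3,2)] by blast
    qed
  qed
  moreover have "finite (C1 \<union> C2 \<union> C3)" by (simp add: C1_def C2_def C3_def)
  ultimately have "card (cut G E U) \<le> card (C1 \<union> C2 \<union> C3)" by (intro card_mono)
  also have "\<dots> \<le> card C1 + card C2 + card C3" by (meson add_le_mono1 card_Un_le le_trans)
  finally have le: "card (cut G E U) \<le> 3" using C by simp
  have u13: "u1 \<in> V - U - {c}" "u3 \<in> V - U - {c}" "u1 \<noteq> u3" using UV xsD dist unfolding split by auto
  have u2U: "u2 \<in> U" by (simp add: U_def)
  then have "3 \<le> card (cut G E U)" using c3 UV u13 unfolding cuts3_def by (elim allE[of _ U]) auto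
  then have cut3: "card (cut G E U) = 3" using le by simp
  \<comment> \<open>A cut of size three is trivial, and both \<open>u1\<close> and \<open>u3\<close>
    lie on its other side. So \<open>U\<close> is the single vertex \<open>u2\<close>, which would
    be cubic.\<close>
  have "card (V - U - {c}) \<noteq> 1"
  proof
    assume "card (V - U - {c}) = 1"
    then obtain x where "V - U - {c} = {x}" by (auto simp: card_1_singleton_iff)
    then show False using u13 by auto
  qed
  then have "card U = 1" using triv[OF UV(1) cut3] by blast
  then have "U = {u2}" using u2U by (auto simp: card_1_singleton_iff)
  then have "dg G E u2 = 3" using cut3 card_cut_single by simp
  moreover have "u2 \<notin> {c, p, q}" using UV u2U pA qD by auto
  ultimately show False using big[of u2] u2U UV by blast
qed

text \<open>No path from \<open>p\<close> to \<open>q\<close> can be shortened, so \<open>p\<close>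
  is adjacent only to \<open>c\<close> and to the next vertex \<open>x2\<close>, and
  \<open>x2\<close> only to \<open>p\<close> and \<open>x3\<close>. The cut around
  \<open>{p, x2}\<close> then forces parallel edges between \<open>x2\<close> and \<open>x3\<close>.
  With all edges at \<open>p\<close> and one of the parallel edges in \<open>A\<close>, and another
  one in \<open>B\<close>, the vertex \<open>p\<close> is monochromatic while \<open>x2\<close> and
  \<open>x3\<close> are odd in all three colors.\<close>

lemma colorable_hamiltonian:
  assumes n: "\<not> colorable 3 G" and c3: "cuts3 G c" and V5: "card V \<ge> 5"
    and all: "\<And>xs. pq_path xs \<Longrightarrow> set xs = V - {c}"
  shows False
proof -
  obtain xs where xs: "pq_path xs" using conn_pth[OF del_conn[OF c], of p q] pq unfolding pq_path_def by blast
  note xsD = pq_path_D[OF xs]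
  have "length xs = card (V - {c})" using xsD all[OF xs] distinct_card by metis
  \<comment> \<open>Four vertices keep \<open>q\<close> away from \<open>x2\<close> and
    \<open>x3\<close>, so that \<open>x2\<close> is not adjacent to \<open>c\<close>.\<close>
  then have "4 \<le> length xs" using V5 c by simp
  then obtain x1 x2 x3 r x4 where s1: "xs = x1 # x2 # x3 # x4 # r"
    by (auto simp: numeral_eq_Suc Suc_le_length_iff)
  then have s: "xs = p # x2 # x3 # x4 # r" using xs by (simp add: pq_path_def)
  have pxs: "pth G E (V - {c}) xs" using xs by (simp add: pq_path_def)
  have q: "q \<in> set (x4 # r)" using xs s by (auto simp: pq_path_def)
  have dist: "distinct (p # x2 # x3 # x4 # r)" using xsD s by simp
  have short: False if y: "e \<in> E" "ends G e = Upair a y" "xs = as @ a # b # bs @ y # ds" for e a b y as bs ds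
  proof -
    have "pth G E (V - {c}) (as @ [a])" using pxs pth_take[of G E "V - {c}" as a] unfolding y(3) by simp
    moreover have "pth G E (V - {c}) (y # ds)" using pxs pth_drop[of G E "V - {c}" "as @ a # b # bs" y ds] unfolding y(3) by simp
    moreover have dis: "distinct (as @ a # b # bs @ y # ds)" using xsD unfolding y(3) by blast
    then have "set (as @ [a]) \<inter> set (y # ds) = {}" by auto
    moreover have "ends G e = Upair (last (as @ [a])) (hd (y # ds))" using y(2) by simp
    ultimately have "pth G E (V - {c}) ((as @ [a]) @ y # ds)" using y(1) by (intro pth_append[of G E _ "as @ [a]" "y # ds" e])
    moreover have "hd ((as @ [a]) @ y # ds) = p" using xs unfolding y(3) by (cases as) (auto simp: pq_path_def)
    moreover have "last ((as @ [a]) @ y # ds) = q" using xs unfolding y(3) by (simp add: pq_path_def)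
    ultimately have "pq_path ((as @ [a]) @ y # ds)" by (simp add: pq_path_def)
    then have "set ((as @ [a]) @ y # ds) = set xs" using all[OF xs] all by metis
    then have "b \<in> set ((as @ [a]) @ y # ds)" unfolding y(3) by simp
    then show False using dis by auto
  qed
  have nbr_p: "y = x2 \<or> y = c" if e: "e \<in> E" "ends G e = Upair p y" for e y
  proof (rule ccontr)
    assume ny: "\<not> ?thesis"
    have "y \<in> V" "y \<noteq> p" using ends_in_V[OF e] by auto
    then have "y \<in> set (x3 # x4 # r)" using all[OF xs] ny s by auto
    then obtain bs ds where "x3 # x4 # r = bs @ y # ds" by (meson split_list)
    then show False using short[OF e, of "[]" x2 bs ds] s by simp
  qed
  have nbr_x2: "y = p \<or> y = x3" if e: "e \<in> E" "ends G e = Upair x2 y" for e y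
  proof (rule ccontr)
    assume ny: "\<not> ?thesis"
    have "y \<in> V" "y \<noteq> x2" using ends_in_V[OF e] by auto
    moreover have "y \<noteq> c" using c_nbr[OF e(1)] e(2) dist q by auto
    ultimately have "y \<in> set (x4 # r)" using all[OF xs] ny s by auto
    then obtain bs ds where "x4 # r = bs @ y # ds" by (meson split_list)
    then show False using short[OF e, of "[p]" x3 bs ds] s by simp
  qed
  have inV: "x2 \<in> V" "x3 \<in> V" "x2 \<noteq> c" "x3 \<noteq> c" using xsD s by auto
  define D where "D = {e\<in>E. ends G e = Upair x2 x3}"
  have "cut G E {p, x2} \<subseteq> insert ep D"
  proof
    fix e assume "e \<in> cut G E {p, x2}"
    then obtain x y where e: "e \<in> E" "ends G e = Upair x y" "x \<in> {p, x2}" "y \<notin> {p, x2}" by (rule cutE)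
    show "e \<in> insert ep D"
    proof (cases "x = p")
      case True
      then have "y = c" using nbr_p[OF e(1)] e by auto
      then show ?thesis using c_only[OF e(1)] e eq True p_neq_q pq by auto
    next
      case False
      then show ?thesis using nbr_x2[OF e(1), of y] e by (auto simp: D_def)
    qed
  qed
  moreover have "finite (insert ep D)" by (simp add: D_def)
  moreover have "3 \<le> card (cut G E {p, x2})"
  proof -
    have "{p, x2} \<subseteq> V" "{p, x2} - {c} \<noteq> {}" "V - {p, x2} - {c} \<noteq> {}" using inV pq dist by auto
    then show ?thesis using c3 unfolding cuts3_def by blast
  qed
  ultimately have "3 \<le> card (insert ep D)" using card_mono le_trans by metis
  moreover have "card (insert ep D) \<le> Suc (card D)" by (rule card_insert_le_m1[of "Suc (card D)", simplified]) auto
  ultimately have "2 \<le> card D" by linarith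
  then have "\<not> card D \<le> Suc 0" by simp
  moreover have "finite D" by (simp add: D_def)
  ultimately obtain e1 e2 where e12: "e1 \<in> D" "e2 \<in> D" "e1 \<noteq> e2" by (auto simp only: card_le_Suc0_iff_eq)
  have e12': "e1 \<in> E" "e2 \<in> E" "ends G e1 = Upair x2 x3" "ends G e2 = Upair x2 x3" using e12 by (auto simp: D_def)
  define P where "P = {e\<in>E. p \<in> set_uprod (ends G e)}"
  have PE: "P \<subseteq> E" by (auto simp: P_def)
  have P_ends: "ends G e = Upair p x2" if e: "e \<in> P" "e \<noteq> ep" for e
  proof -
    obtain x y where xy: "ends G e = Upair x y" by (rule uprod_ends)
    then have "ends G e = Upair y x" by auto
    then obtain y' where y': "ends G e = Upair p y'" using xy e(1) by (auto simp: P_def)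
    then have "y' = x2 \<or> y' = c" using nbr_p e by (auto simp: P_def)
    moreover have "y' \<noteq> c"
    proof
      assume "y' = c"
      then have "e = eq" using c_only[of e] y' e by (auto simp: P_def)
      then show False using y' eq p_neq_q pq by auto
    qed
    ultimately show ?thesis using y' by simp
  qed
  have epP: "ep \<in> P" using ep by (auto simp: P_def)
  have dP: "dg G P v = (if v = p then dg G E p else if v = x2 then dg G E p - 1 else if v = c then 1 else 0)" for v
  proof -
    have "{e\<in>P. v \<in> set_uprod (ends G e)} = (if v = p then P else if v = x2 then P - {ep} else if v = c then {ep} else {})"
    proof (rule set_eqI)
      fix e
      show "e \<in> {e\<in>P. v \<in> set_uprod (ends G e)} \<longleftrightarrow> e \<in> (if v = p then P else if v = x2 then P - {ep} else if v = c then {ep} else {})"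
        using P_ends[of e] ep epP inV pq dist by (cases "e \<in> P"; cases "e = ep") (auto simp: P_def)
    qed
    moreover have "card P = dg G E p" by (simp add: P_def dg_def)
    ultimately show ?thesis unfolding dg_def[of G P v] using epP by auto
  qed
  have e1P: "e1 \<notin> P" "e2 \<notin> P" using e12' dist by (auto simp: P_def)
  have dA: "dg G (insert e1 P) v = dg G P v + of_bool (v = x2 \<or> v = x3)" for v
    using dg_insert[OF PE e12'(1) e1P(1)] e12' by auto
  have dB: "dg G {e2} v = of_bool (v = x2 \<or> v = x3)" for v
    using dg_insert[of "{}" e2 v] e12' by auto
  have op: "odd (dg G E p)" "dg G E p > 0" using odd_deg[of p] pq by (auto intro: odd_pos)
  have "colorable 3 G"
  proof (rule colorable_base[of "insert e1 P" "{e2}"])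
    fix v assume v: "v \<in> V"
    have "x3 \<noteq> p" "x2 \<noteq> p" "x2 \<noteq> x3" using dist by auto
    then show "(odd (dg G E v) \<and> dg G (insert e1 P) v = 0 \<and> dg G {e2} v = 0) \<or>
       (odd (dg G E v) \<and> odd (dg G (insert e1 P) v) \<and> odd (dg G {e2} v)) \<or>
       (odd (dg G E v) \<and> dg G (insert e1 P) v = dg G E v) \<or>
       (dg G E v = 2 \<and> dg G (insert e1 P) v + dg G {e2} v = 1) \<or>
       (dg G E v = 2 \<and> odd (dg G (insert e1 P) v) \<and> odd (dg G {e2} v))"
      using dA[of v] dB[of v] dP[of v] op inV pq dg_c odd_deg[OF v] by (cases "v = c") auto
  qed (use PE e12' e12(3) e1P in auto)
  then show False using n by simp
qed

end

text \<open>Order five excludes the triangles, where \<open>p\<close> and \<open>q\<close> may have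
  any odd degree from three on. The induction goes through because both sides of a nontrivial 3-edge
  cut have odd order at least three when \<open>c\<close> is not counted, so both derived graphs are
  smaller and still have at least five vertices.\<close>

lemma cubic_of_cuts3:
  assumes "near_odd G c ep eq p q" "cuts3 G c" "\<not> colorable 3 G" "card (verts G) \<ge> 5" "v \<in> verts G" "v \<noteq> c"
  shows "dg G (edges G) v = 3"
  using assms
proof (induction "card (verts G)" arbitrary: G c ep eq p q v rule: less_induct)
  case less
  interpret near_odd G c ep eq p q by (rule less.prems(1))
  note c3 = less.prems(2) and n = less.prems(3) and V5 = less.prems(4)
  obtain \<phi> where \<phi>: "proper2 \<phi>" using ex_proper2[OF n] by blast
  show ?case
  proof (cases "\<exists>M\<subseteq>V - {c}. card (cut G E M) = 3 \<and> card M \<noteq> 1 \<and> card (V - M - {c}) \<noteq> 1")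
    case True
    then obtain M where M: "M \<subseteq> V - {c}" "card (cut G E M) = 3" "card M \<noteq> 1" "card (V - M - {c}) \<noteq> 1" by blast
    have fM: "finite M" using M(1) finite_subset[of M V] by auto
    have "odd (card M)" using odd_cut[of M] M(1,2) odd_deg by (metis Diff_iff insertI1 odd_numeral subset_Diff_insert subset_iff)
    then have M3: "card M \<ge> 3" using M(3) by (metis One_nat_def Suc_1 Suc_leI even_numeral le_neq_implies_less not_less_eq_eq numeral_3_eq_3 odd_pos)
    define Y where "Y = V - M - {c}"
    have YY: "V - M = insert c Y" "c \<notin> Y" "finite Y" using M(1) c by (auto simp: Y_def)
    have "card (V - {c}) = card M + card Y"
    proof -
      have "V - {c} = M \<union> Y" "M \<inter> Y = {}" using M(1) by (auto simp: Y_def)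
      then show ?thesis using fM YY(3) by (simp add: card_Un_disjoint)
    qed
    moreover have "card V = Suc (card (V - {c}))" using c by (metis card.remove finite_V)
    ultimately have cV: "card V = Suc (card M + card Y)" "card (V - {c}) = card M + card Y" by simp_all
    have "odd (card Y)" using card_even cV(2) \<open>odd (card M)\<close> by simp
    then have Y3: "card Y \<ge> 3" using M(4) by (metis Y_def One_nat_def Suc_1 Suc_leI even_numeral le_neq_implies_less not_less_eq_eq numeral_3_eq_3 odd_pos)
    have "M \<noteq> {}" "Y \<noteq> {}" using M3 Y3 by auto
    have conM: "conn G E M" using \<open>Y \<noteq> {}\<close> M by (intro conn_small_cut[OF c3]) (auto simp: Y_def)
    have conY: "conn G E (V - M)"
      using \<open>M \<noteq> {}\<close> M(1,2) cut_compl[of M] by (intro conn_small_cut[OF c3]) auto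
    obtain m where m: "m \<in> M" using \<open>M \<noteq> {}\<close> by blast
    have M': "M \<subseteq> V" "c \<notin> M" using M(1) by auto
    let ?G1 = "contract G M m"
    have cY: "card (V - M) = Suc (card Y)" using YY by simp
    have near1: "near_odd ?G1 c ep eq (if p \<in> M then m else p) (if q \<in> M then m else q)"
      using M' m conY cY Y3 M(2) by (intro contract_near_odd) auto
    have n1: "\<not> colorable 3 ?G1" using colorable_uncontract[OF \<phi> M'(1) m conM M'(2) M(2)] n by blast
    have card1: "card (verts ?G1) = Suc (Suc (card Y))" using cY m by simp
    have deg1: "dg G E v = 3" if v: "v \<in> Y" for v
    proof -
      have "dg ?G1 (edges ?G1) v = 3"
        using v cV M3 Y3 card1 cuts3_contract[OF c3 M'(1) m M'(2)] n1 near1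
        by (intro less.hyps[OF _ near1]) (auto simp: Y_def)
      moreover have "dg ?G1 (edges ?G1) v = dg G (edges ?G1) v" using v m by (intro contract_dg) (auto simp: Y_def)
      moreover have "dg G (edges ?G1) v = dg G E v" using v by (intro dg_cong) (auto simp: Y_def inner_def)
      ultimately show ?thesis by simp
    qed
    obtain f g h where fgh: "cut G E M = {f, g, h}" "f \<noteq> g" "f \<noteq> h" "g \<noteq> h" using M(2) by (auto simp: card_3_iff)
    obtain u f' where u: "f \<in> E" "ends G f = Upair u f'" "u \<in> M" "f' \<notin> M" using fgh(1) by (metis cutE insertI1)
    obtain y where y: "y \<in> Y" using \<open>Y \<noteq> {}\<close> by blast
    have "{c} \<subseteq> V - M" "{c} \<noteq> {}" "{c} \<noteq> V - M" using YY y by auto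
    \<comment> \<open>Some edge at \<open>c\<close> stays inside \<open>V - M\<close>, as that set
      is connected; its name is reused for the new edge.\<close>
    with conY obtain nn a b where nn: "nn \<in> E" "ends G nn = Upair a b" "a \<in> {c}" "b \<in> V - M - {c}" by (rule conn_cut)
    have "nn \<in> inner G E (V - M)" using nn YY by (auto simp: inner_def)
    then interpret side: cut_side G c ep eq p q M y u f f' nn g h
      using M(1) conM y u fgh M3 by unfold_locales (auto simp: Y_def)
    have near2: "near_odd side.G2 c f nn u y" by (rule side.near_odd_G2)
    have n2: "\<not> colorable 3 side.G2" using side.colorable_G2 conY n by blast
    have card2: "card (verts side.G2) = Suc (Suc (card M))" using side.y M' fM by auto
    have deg2: "dg G E v = 3" if v: "v \<in> M" for v
    proof -
      have "dg side.G2 (edges side.G2) v = 3"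
        using v cV M3 Y3 card2 side.cuts3_G2[OF c3] n2 M'
        by (intro less.hyps[OF _ near2]) auto
      moreover have "dg side.G2 (edges side.G2) v = dg G (edges side.G2) v" using v by (intro side.dg_G2) auto
      moreover have "dg G (edges side.G2) v = dg G E v"
        using v side.n_not by (intro dg_cong) (auto simp: inner_def cut_def)
      ultimately show ?thesis by simp
    qed
    show ?thesis using deg1[of v] deg2[of v] less.prems(5,6) by (auto simp: Y_def)
  next
    case False
    then have triv: "\<And>X. X \<subseteq> V - {c} \<Longrightarrow> card (cut G E X) = 3 \<Longrightarrow> card X = 1 \<or> card (V - X - {c}) = 1" by blast
    show ?thesis
    proof (rule ccontr)
      assume v3: "dg G E v \<noteq> 3"
      show False
      proof (cases "\<exists>w\<in>V. w \<notin> {c, p, q} \<and> dg G E w = 3")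
        case True
        then obtain w where w: "w \<in> V" "w \<noteq> c" "w \<noteq> p" "w \<noteq> q" "dg G E w = 3" by blast
        have "\<And>X. X \<subseteq> V \<Longrightarrow> X - {c} \<noteq> {} \<Longrightarrow> V - X - {c} \<noteq> {} \<Longrightarrow> 3 \<le> card (cut G E X)"
          using c3 unfolding cuts3_def by blast
        then show False using colorable_hub[OF _ triv w less.prems(5,6) v3] n by blast
      next
        case False
        then have big: "\<And>v. v \<in> V \<Longrightarrow> v \<notin> {c, p, q} \<Longrightarrow> dg G E v \<noteq> 3" by blast
        \<comment> \<open>The path and the connected set are chosen together, with the set as large
          as possible; a single vertex off some path shows that it is nonempty.\<close>
        define Q where "Q xB \<longleftrightarrow> pq_path (fst xB) \<and> snd xB \<subseteq> V - {c} - set (fst xB) \<and> conn G E (snd xB)" for xB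
        show False
        proof (cases "\<exists>xs. pq_path xs \<and> set xs \<noteq> V - {c}")
          case True
          then obtain xs x where xs: "pq_path xs" "x \<in> V - {c} - set xs" using pq_path_D by blast
          have Q0: "Q (xs, {x})" using xs by (auto simp: Q_def conn_singleton)
          have "\<forall>y. Q y \<longrightarrow> card (snd y) < Suc (card V)"
          proof (intro allI impI)
            fix y assume "Q y"
            then have "snd y \<subseteq> V" by (auto simp: Q_def)
            then show "card (snd y) < Suc (card V)" using card_mono[of V "snd y"] by simp
          qed
          then have "\<exists>xB. Q xB \<and> (\<forall>y. Q y \<longrightarrow> card (snd y) \<le> card (snd xB))"
            using ex_has_greatest_nat[of Q "(xs, {x})" "\<lambda>xB. card (snd xB)" "Suc (card V)"] Q0 by blast
          then obtain xB where xB: "Q xB" "\<And>y. Q y \<Longrightarrow> card (snd y) \<le> card (snd xB)" by blast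
          have "snd xB \<noteq> {}" using xB(2)[OF Q0] by auto
          moreover have "card B' \<le> card (snd xB)" if "pq_path xs'" "B' \<subseteq> V - {c} - set xs'" "conn G E B'" for xs' B'
            using xB(2)[of "(xs', B')"] that by (simp add: Q_def)
          ultimately show False
            using colorable_off_path[OF n \<phi> c3 triv big, of "fst xB" "snd xB"] xB(1) unfolding Q_def by blast
        next
          case False
          then show False using colorable_hamiltonian[OF n c3 V5] by blast
        qed
      qed
    qed
  qed
qed

section \<open>The odd chromatic index and subdivisions\<close>

text \<open>A loop has two ends at its vertex. The odd graph that gets subdivided may have loops, so
  \<open>dg\<close> does not give its degrees.\<close>

definition ends_at :: "'v uprod \<Rightarrow> 'v \<Rightarrow> nat" where
  "ends_at u v = of_bool (v \<in> set_uprod u) + of_bool (u = Upair v v)"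

lemma ends_at_Upair [simp]: "ends_at (Upair x y) v = of_bool (x = v) + of_bool (y = v)"
  by (auto simp: ends_at_def)

lemma ends_at_map:
  assumes "inj_on f S" "set_uprod u \<subseteq> S" "v \<in> S"
  shows "ends_at (map_uprod f u) (f v) = ends_at u v"
proof -
  obtain x y where u: "u = Upair x y" by (rule uprod_exhaust)
  then have "f x = f v \<longleftrightarrow> x = v" "f y = f v \<longleftrightarrow> y = v" using assms by (auto simp: inj_on_def)
  then show ?thesis using u by simp
qed

lemma ends_at_map_other: "v \<notin> f ` set_uprod u \<Longrightarrow> ends_at (map_uprod f u) v = 0"
  by (cases u rule: uprod_exhaust) (auto simp: ends_at_Upair)

lemma degree_sum: "finite (edges G) \<Longrightarrow> degree G v = (\<Sum>e\<in>edges G. ends_at (ends G e) v)"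
  by (simp add: degree_def degree_on_def ends_at_def sum.distrib sum_of_bool_eq Int_def)

section \<open>Isomorphisms and the effect of the graph operations on degrees\<close>

lemma isomorphicE:
  assumes "isomorphic H G"
  obtains f g where "bij_betw f (verts H) (verts G)" "bij_betw g (edges H) (edges G)"
    "\<And>e. e \<in> edges H \<Longrightarrow> ends G (g e) = map_uprod f (ends H e)"
  using assms unfolding isomorphic_def by blast

lemma multigraph_iso: "isomorphic H G \<Longrightarrow> multigraph H \<Longrightarrow> multigraph G"
proof (elim isomorphicE)
  fix f g
  assume H: "multigraph H" and f: "bij_betw f (verts H) (verts G)" and g: "bij_betw g (edges H) (edges G)"
    and e: "\<And>e. e \<in> edges H \<Longrightarrow> ends G (g e) = map_uprod f (ends H e)"
  have "set_uprod (ends G e') \<subseteq> verts G" if e': "e' \<in> edges G" for e'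
  proof -
    obtain e0 where e0: "e0 \<in> edges H" "e' = g e0" using e' g by (auto simp: bij_betw_def)
    then have "set_uprod (ends G e') = f ` set_uprod (ends H e0)" using e by (simp add: uprod.set_map)
    moreover have "set_uprod (ends H e0) \<subseteq> verts H" using H e0 by (simp add: multigraph_def)
    ultimately show ?thesis using f by (auto simp: bij_betw_def)
  qed
  then show "multigraph G" using H f g by (auto simp: multigraph_def bij_betw_finite)
qed

lemma loopless_iso: "isomorphic H G \<Longrightarrow> multigraph H \<Longrightarrow> loopless H \<Longrightarrow> loopless G"
proof (elim isomorphicE)
  fix f g
  assume H: "multigraph H" "loopless H" and f: "bij_betw f (verts H) (verts G)" and g: "bij_betw g (edges H) (edges G)"
    and e: "\<And>e. e \<in> edges H \<Longrightarrow> ends G (g e) = map_uprod f (ends H e)"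
  show "loopless G" unfolding loopless_def
  proof (intro ballI allI)
    fix e' v assume e': "e' \<in> edges G"
    obtain e0 where e0: "e0 \<in> edges H" "e' = g e0" using e' g by (auto simp: bij_betw_def)
    obtain x y where xy: "ends H e0 = Upair x y" by (rule uprod_ends)
    have "x \<noteq> y" using H(2) e0 xy by (auto simp: loopless_def)
    moreover have "x \<in> verts H" "y \<in> verts H" using H(1) e0 xy by (auto simp: multigraph_def)
    ultimately have "f x \<noteq> f y" using f by (auto simp: bij_betw_def inj_on_def)
    then show "ends G e' \<noteq> Upair v v" using e e0 xy by auto
  qed
qed

lemma degree_iso:
  assumes "multigraph H" and f: "bij_betw f (verts H) (verts G)" and g: "bij_betw g (edges H) (edges G)"
    and e: "\<And>e. e \<in> edges H \<Longrightarrow> ends G (g e) = map_uprod f (ends H e)" and v: "v \<in> verts H"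
  shows "degree G (f v) = degree H v"
proof -
  have fin: "finite (edges H)" "finite (edges G)" using assms(1) g by (auto simp: multigraph_def bij_betw_finite)
  have "degree G (f v) = (\<Sum>e\<in>edges H. ends_at (ends G (g e)) (f v))"
    unfolding degree_sum[OF fin(2)] by (rule sum.reindex_bij_betw[OF g, symmetric])
  also have "\<dots> = (\<Sum>e\<in>edges H. ends_at (ends H e) v)"
  proof (rule sum.cong)
    fix e0 assume e0: "e0 \<in> edges H"
    then have "set_uprod (ends H e0) \<subseteq> verts H" using assms(1) by (auto simp: multigraph_def)
    then show "ends_at (ends G (g e0)) (f v) = ends_at (ends H e0) v"
      using e[OF e0] ends_at_map[of f "verts H"] f v by (simp add: bij_betw_def)
  qed simp
  finally show ?thesis using degree_sum[OF fin(1)] by simp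
qed

lemma colorable_iso:
  assumes "isomorphic H G" "multigraph H" "colorable k G"
  shows "colorable k H"
proof -
  obtain f g where f: "bij_betw f (verts H) (verts G)" and g: "bij_betw g (edges H) (edges G)"
    and e: "\<And>e. e \<in> edges H \<Longrightarrow> ends G (g e) = map_uprod f (ends H e)" using assms(1) by (rule isomorphicE) blast
  obtain col where col: "\<And>e. e \<in> edges G \<Longrightarrow> col e < k" "\<And>v i. v \<in> verts G \<Longrightarrow> zero_or_odd (dg G {e\<in>edges G. col e = i} v)"
    using assms(3) unfolding colorable_def by blast
  have "zero_or_odd (dg H {e\<in>edges H. col (g e) = i} v)" if v: "v \<in> verts H" for v i
  proof -
    have inc: "f v \<in> set_uprod (ends G (g e0)) \<longleftrightarrow> v \<in> set_uprod (ends H e0)" if e0: "e0 \<in> edges H" for e0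
    proof -
      have "set_uprod (ends H e0) \<subseteq> verts H" using assms(2) e0 by (auto simp: multigraph_def)
      moreover have "inj_on f (verts H)" using f by (simp add: bij_betw_def)
      ultimately show ?thesis unfolding e[OF e0] uprod.set_map using v by (simp add: inj_on_image_mem_iff)
    qed
    let ?S = "{e\<in>{e\<in>edges H. col (g e) = i}. v \<in> set_uprod (ends H e)}"
    have "g ` ?S = {e\<in>{e\<in>edges G. col e = i}. f v \<in> set_uprod (ends G e)}"
    proof -
      have *: "edges G = g ` edges H" using g by (auto simp: bij_betw_def)
      show ?thesis unfolding * using inc by blast
    qed
    moreover have "inj_on g ?S" using g by (auto simp: bij_betw_def inj_on_def)
    then have "card (g ` ?S) = card ?S" by (rule card_image)
    ultimately have "dg G {e\<in>edges G. col e = i} (f v) = dg H {e\<in>edges H. col (g e) = i} v"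
      unfolding dg_def by simp
    then show ?thesis using col(2)[of "f v" i] f v by (auto simp: bij_betw_def)
  qed
  moreover have "col (g e0) < k" if "e0 \<in> edges H" for e0 using col(1) g that by (auto simp: bij_betw_def)
  ultimately show ?thesis unfolding colorable_def by (intro exI[of _ "col \<circ> g"]) auto
qed

lemma add_edge_simps [simp]:
  "verts (add_edge G x y) = verts G"
  "edges (add_edge G x y) = insert None (Some ` edges G)"
  "ends (add_edge G x y) None = Upair x y"
  "ends (add_edge G x y) (Some e) = ends G e"
  by (simp_all add: add_edge_def)

lemma del_edge_simps [simp]:
  "verts (del_edge G e) = verts G" "edges (del_edge G e) = edges G - {e}" "ends (del_edge G e) = ends G"
  by (simp_all add: del_edge_def)

lemma add_vert_simps [simp]:
  "verts (add_vert G) = insert None (Some ` verts G)" "edges (add_vert G) = edges G"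
  "ends (add_vert G) e = map_uprod Some (ends G e)"
  by (simp_all add: add_vert_def)

lemma del_vert_simps [simp]:
  "verts (del_vert G v) = verts G - {v}" "edges (del_vert G v) = {e\<in>edges G. v \<notin> set_uprod (ends G e)}"
  "ends (del_vert G v) = ends G"
  by (simp_all add: del_vert_def)

lemma disjoint_union_simps [simp]:
  "verts (disjoint_union G H) = verts G <+> verts H" "edges (disjoint_union G H) = edges G <+> edges H"
  "ends (disjoint_union G H) (Inl e) = map_uprod Inl (ends G e)"
  "ends (disjoint_union G H) (Inr e') = map_uprod Inr (ends H e')"
  by (simp_all add: disjoint_union_def)

lemma subdivide_simps [simp]:
  "verts (subdivide H e x y) = insert None (Some ` verts H)"
  "edges (subdivide H e x y) = insert None (insert (Some None) ((Some \<circ> Some) ` (edges H - {e})))"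
  "ends (subdivide H e x y) None = Upair None (Some y)"
  "ends (subdivide H e x y) (Some None) = Upair (Some x) None"
  "ends (subdivide H e x y) (Some (Some e')) = map_uprod Some (ends H e')"
  by (auto simp: subdivide_def image_image)

lemma multigraph_subdivide:
  assumes "multigraph H" "e \<in> edges H" "ends H e = Upair x y"
  shows "multigraph (subdivide H e x y)"
proof -
  have "x \<in> verts H" "y \<in> verts H" using assms by (auto simp: multigraph_def)
  then show ?thesis using assms(1) by (auto simp: multigraph_def uprod.set_map)
qed

lemma degree_subdivide:
  assumes H: "multigraph H" "e \<in> edges H" "ends H e = Upair x y"
  shows "degree (subdivide H e x y) (Some v) = degree H v" "degree (subdivide H e x y) None = 2"
proof -
  let ?K = "subdivide H e x y"
  let ?J = "(Some \<circ> Some) ` (edges H - {e})"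
  have fin: "finite (edges H)" "finite (edges ?K)" "finite ?J"
    using H(1) multigraph_subdivide[OF H] by (auto simp: multigraph_def)
  have nin: "None \<notin> insert (Some None) ?J" "Some None \<notin> ?J" by auto
  have "degree ?K w = ends_at (ends ?K None) w + (ends_at (ends ?K (Some None)) w + (\<Sum>e'\<in>?J. ends_at (ends ?K e') w))" for w
    unfolding degree_sum[OF fin(2)] subdivide_simps(2)
    by (subst sum.insert[OF _ nin(1)], use fin in simp, subst sum.insert[OF fin(3) nin(2)]) (rule refl)
  moreover have "(\<Sum>e'\<in>?J. ends_at (ends ?K e') w) = (\<Sum>e'\<in>edges H - {e}. ends_at (map_uprod Some (ends H e')) w)" for w
    by (subst sum.reindex) (auto simp: inj_on_def)
  ultimately have *: "degree ?K w = ends_at (ends ?K None) w + (ends_at (ends ?K (Some None)) w + (\<Sum>e'\<in>edges H - {e}. ends_at (map_uprod Some (ends H e')) w))" for w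
    by metis
  have "(\<Sum>e'\<in>edges H - {e}. ends_at (map_uprod Some (ends H e')) None) = 0"
    by (intro sum.neutral ballI ends_at_map_other) auto
  then show "degree ?K None = 2" using *[of None] by simp
  have "(\<Sum>e'\<in>edges H - {e}. ends_at (map_uprod Some (ends H e')) (Some v)) = (\<Sum>e'\<in>edges H - {e}. ends_at (ends H e') v)"
    by (intro sum.cong ends_at_map[of Some UNIV]) auto
  moreover have "degree H v = ends_at (ends H e) v + (\<Sum>e'\<in>edges H - {e}. ends_at (ends H e') v)"
    unfolding degree_sum[OF fin(1)] using fin(1) H(2) by (rule sum.remove)
  ultimately show "degree ?K (Some v) = degree H v" using *[of "Some v"] H(3) by simp
qed

text \<open>Old vertices keep their degree under a subdivision and the new one gets degree two.
  Membership in \<open>class_S\<close> is used in this form.\<close>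

lemma subdivision_of_degrees:
  assumes "subdivision_of H G" "multigraph H" "odd_graph H"
  shows "multigraph G \<and> (\<forall>v\<in>verts G. odd (degree G v) \<or> degree G v = 2)"
  using assms(1)
proof (induction rule: subdivision_of.induct)
  case (base G)
  obtain f g where f: "bij_betw f (verts H) (verts G)" "bij_betw g (edges H) (edges G)"
    "\<And>e. e \<in> edges H \<Longrightarrow> ends G (g e) = map_uprod f (ends H e)" using base by (rule isomorphicE) blast
  have "odd (degree G w)" if "w \<in> verts G" for w
  proof -
    obtain v where "v \<in> verts H" "w = f v" using \<open>w \<in> verts G\<close> f(1) by (auto simp: bij_betw_def)
    then show ?thesis using degree_iso[OF assms(2) f] assms(3) by (auto simp: odd_graph_def)
  qed
  then show ?case using multigraph_iso[OF base assms(2)] by blast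
next
  case (step K e x y G)
  let ?K = "subdivide K e x y"
  have mK: "multigraph ?K" using step by (intro multigraph_subdivide) auto
  obtain f g where f: "bij_betw f (verts ?K) (verts G)" "bij_betw g (edges ?K) (edges G)"
    "\<And>e. e \<in> edges ?K \<Longrightarrow> ends G (g e) = map_uprod f (ends ?K e)" using step.hyps(4) by (rule isomorphicE) blast
  have "odd (degree G w) \<or> degree G w = 2" if "w \<in> verts G" for w
  proof -
    obtain v where v: "v \<in> verts ?K" "w = f v" using \<open>w \<in> verts G\<close> f(1) unfolding bij_betw_def by blast
    have dK: "multigraph K" using step by blast
    have "odd (degree ?K v) \<or> degree ?K v = 2"
      using v(1) degree_subdivide[OF dK step.hyps(2,3)] step.IH by auto
    then show ?thesis using degree_iso[OF mK f v(1)] v(2) by simp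
  qed
  then show ?case using multigraph_iso[OF step.hyps(4) mK] by blast
qed

lemma class_S_degrees: "G \<in> class_S \<Longrightarrow> v \<in> verts G \<Longrightarrow> odd (degree G v) \<or> degree G v = 2"
  using subdivision_of_degrees unfolding class_S_def by blast

section \<open>Colorability and the odd chromatic index\<close>

context lgraph
begin

lemma odd_edge_coloring_iff:
  "odd_edge_coloring G col \<longleftrightarrow> (\<forall>v\<in>V. \<forall>i. zero_or_odd (dg G {e\<in>E. col e = i} v))"
proof -
  have loops: "{e\<in>{e\<in>E. col e = i}. ends G e = Upair v v} = {}" for i v
    using loopless by (auto simp: loopless_def)
  have deg: "degree_on G {e\<in>E. col e = i} v = dg G {e\<in>E. col e = i} v" for i v
    unfolding degree_on_def dg_def loops by simp
  have inc: "(\<exists>e\<in>E. col e = i \<and> v \<in> set_uprod (ends G e)) \<longleftrightarrow> dg G {e\<in>E. col e = i} v \<noteq> 0" for i v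
    by (subst dg_zero_iff) auto
  define R where "R i v \<longleftrightarrow> zero_or_odd (dg G {e\<in>E. col e = i} v)" for i v
  have "((\<exists>e\<in>E. col e = i \<and> v \<in> set_uprod (ends G e)) \<longrightarrow> odd (degree_on G {e\<in>E. col e = i} v)) \<longleftrightarrow> R i v" for i v
    unfolding R_def zero_or_odd_def deg inc by (cases "dg G {e\<in>E. col e = i} v = 0") simp_all
  then show ?thesis unfolding odd_edge_coloring_def R_def[symmetric] by auto
qed

lemma colorable_iff_card: "colorable k G \<longleftrightarrow> (\<exists>col. odd_edge_coloring G col \<and> card (col ` E) \<le> k)"
proof
  assume "colorable k G"
  then obtain col where col: "\<forall>e\<in>E. col e < k" "\<forall>v\<in>V. \<forall>i. zero_or_odd (dg G {e\<in>E. col e = i} v)"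
    unfolding colorable_def by blast
  then have "col ` E \<subseteq> {..<k}" by auto
  then have "card (col ` E) \<le> card {..<k}" by (intro card_mono) auto
  then show "\<exists>col. odd_edge_coloring G col \<and> card (col ` E) \<le> k"
    using col(2) odd_edge_coloring_iff by auto
next
  assume "\<exists>col. odd_edge_coloring G col \<and> card (col ` E) \<le> k"
  then obtain col where col: "odd_edge_coloring G col" "card (col ` E) \<le> k" by blast
  obtain h where h: "bij_betw h (col ` E) {0..<card (col ` E)}"
    using ex_bij_betw_finite_nat[of "col ` E"] by auto
  have "zero_or_odd (dg G {e\<in>E. h (col e) = i} v)" if v: "v \<in> V" for v i
  proof (cases "\<exists>e0\<in>E. h (col e0) = i")
    case True
    then obtain e0 where e0: "e0 \<in> E" "h (col e0) = i" by blast
    have "{e\<in>E. h (col e) = i} = {e\<in>E. col e = col e0}"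
      using h e0 by (auto simp: bij_betw_def inj_on_def)
    then show ?thesis using col(1) odd_edge_coloring_iff v by auto
  next
    case False
    then have *: "{e\<in>E. h (col e) = i} = {}" by blast
    show ?thesis unfolding * by (simp add: zero_or_odd_def)
  qed
  moreover have "h (col e) < k" if "e \<in> E" for e
  proof -
    have "h (col e) \<in> {0..<card (col ` E)}" using h that by (auto simp: bij_betw_def)
    then show ?thesis using col(2) by simp
  qed
  ultimately show "colorable k G" unfolding colorable_def by (intro exI[of _ "h \<circ> col"]) auto
qed

lemma odd_chromatic_index_le_iff: "odd_chromatic_index G \<le> enat k \<longleftrightarrow> colorable k G"
proof
  assume "colorable k G"
  then obtain col where "odd_edge_coloring G col" "card (col ` E) \<le> k" unfolding colorable_iff_card by blast
  then show "odd_chromatic_index G \<le> enat k"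
    unfolding odd_chromatic_index_def by (intro INF_lower2[of col]) auto
next
  assume le: "odd_chromatic_index G \<le> enat k"
  show "colorable k G"
  proof (rule ccontr)
    assume n: "\<not> colorable k G"
    have "enat (Suc k) \<le> odd_chromatic_index G"
      unfolding odd_chromatic_index_def
    proof (rule INF_greatest)
      fix col assume "col \<in> {col. odd_edge_coloring G col}"
      then have "\<not> card (col ` E) \<le> k" using n unfolding colorable_iff_card by blast
      then show "enat (Suc k) \<le> enat (card (col ` E))" by simp
    qed
    then have "enat (Suc k) \<le> enat k" using le by (rule order_trans)
    then show False by simp
  qed
qed

lemma odd_chromatic_index_eq_4: "odd_chromatic_index G = 4 \<longleftrightarrow> colorable 4 G \<and> \<not> colorable 3 G"
proof -
  have "odd_chromatic_index G = 4 \<longleftrightarrow> odd_chromatic_index G \<le> enat 4 \<and> \<not> odd_chromatic_index G \<le> enat 3"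
  proof (cases "odd_chromatic_index G")
    case (enat n)
    have "enat n = 4 \<longleftrightarrow> n = 4" by (metis enat.inject numeral_eq_enat)
    moreover have "n = 4 \<longleftrightarrow> n \<le> 4 \<and> \<not> n \<le> 3" by auto
    ultimately show ?thesis unfolding enat by (simp only: enat_ord_simps)
  next
    case infinity
    have "(4 :: enat) = enat 4" by (simp add: numeral_eq_enat)
    then show ?thesis unfolding infinity by simp
  qed
  then show ?thesis by (simp only: odd_chromatic_index_le_iff)
qed

end

lemma conn_del_vert: "connected (del_vert G v) \<longleftrightarrow> conn G (edges G) (verts G - {v}) \<and> verts G - {v} \<noteq> {}"
  if "multigraph G"
proof -
  have "adj_rel (del_vert G v) = adj G (edges G) (verts G - {v})"
    using that by (fastforce simp: adj_rel_def adj_def multigraph_def)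
  then show ?thesis by (auto simp: connected_def conn_def)
qed

text \<open>Both directions pass through \<open>cut_vertex_iff_del_vert\<close>, which is about
  loopless graphs; from \<open>two_connected\<close> this comes by
  \<open>two_connected_loopless\<close>.\<close>

lemma tgraph_iff:
  assumes "multigraph G"
  shows "tgraph G \<longleftrightarrow> two_connected G"
proof
  assume "two_connected G"
  then have *: "connected G" "card (verts G) \<ge> 3" "\<And>v. \<not> cut_vertex G v" by (auto simp: two_connected_def)
  have ll: "loopless G" using two_connected_loopless assms \<open>two_connected G\<close> by blast
  show "tgraph G"
  proof
    show "conn G (edges G) (verts G - {v})" if "v \<in> verts G" for v
      using cut_vertex_iff_del_vert[OF assms *(1) _ ll that] * conn_del_vert[OF assms] by auto
  qed (use assms ll * in auto)
next
  assume "tgraph G"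
  then interpret tgraph G .
  have con: "connected G"
  proof -
    have "adj_rel G = adj G E V" using assms by (fastforce simp: adj_rel_def adj_def multigraph_def)
    moreover have "V \<noteq> {}" using card_V by auto
    ultimately show ?thesis using conn_V by (simp add: connected_def conn_def)
  qed
  have "\<not> cut_vertex G v" for v
  proof
    assume cv: "cut_vertex G v"
    then obtain e where "e \<in> E" "v \<in> set_uprod (ends G e)" unfolding cut_vertex_def by blast
    then have v: "v \<in> V" using assms by (auto simp: multigraph_def)
    have "card V \<ge> 2" using card_V by simp
    then have "\<not> connected (del_vert G v)" using cut_vertex_iff_del_vert[OF assms con _ loopless v] cv by blast
    moreover have "V - {v} \<noteq> {}" using other_vertex[of v v] by auto
    ultimately show False using conn_del_vert[OF assms] del_conn[OF v] by blast
  qed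
  then show "two_connected G" using con card_V by (simp add: two_connected_def)
qed

section \<open>Members of the family need four colors\<close>

text \<open>The numbers are 3, 0, 0 in some order or all equal to 1.\<close>

lemma zero_or_odd_sum_3:
  assumes "x + y + z = 3" "zero_or_odd x" "zero_or_odd y" "zero_or_odd z"
  shows "x mod 3 = y mod 3 \<and> x mod 3 = z mod 3"
proof -
  have "x = 0 \<or> x = 1 \<or> x = 2 \<or> x = 3" "y = 0 \<or> y = 1 \<or> y = 2 \<or> y = 3" using assms(1) by linarith+
  moreover have "z = 3 - x - y" using assms(1) by linarith
  ultimately show ?thesis using assms(1) by (elim disjE) (use assms(2-4) in \<open>auto simp: zero_or_odd_def\<close>)
qed

context lgraph
begin

lemma dg_split:
  assumes "finite I" "\<And>e. e \<in> E \<Longrightarrow> col e \<in> I"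
  shows "dg G E v = (\<Sum>i\<in>I. dg G {e\<in>E. col e = i} v)"
proof -
  have "{e\<in>E. v \<in> set_uprod (ends G e)} = (\<Union>i\<in>I. {e\<in>{e\<in>E. col e = i}. v \<in> set_uprod (ends G e)})"
    using assms(2) by auto
  then show ?thesis unfolding dg_def by (simp only:) (subst card_UN_disjoint, use assms(1) in auto)
qed

text \<open>Double counting of incidences: among the edges of \<open>F\<close>, those in
  \<open>F'\<close> have one end in \<open>A\<close> and the others have none.\<close>

lemma sum_dg_class:
  assumes "F \<subseteq> E" "finite A" "\<And>e. e \<in> F \<Longrightarrow> card (A \<inter> set_uprod (ends G e)) = of_bool (e \<in> F')"
  shows "(\<Sum>v\<in>A. dg G F v) = card (F \<inter> F')"
proof -
  have fF: "finite F" using assms(1) by blast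
  have "(\<Sum>v\<in>A. dg G F v) = (\<Sum>v\<in>A. \<Sum>e\<in>F. of_bool (v \<in> set_uprod (ends G e)))"
    using fF by (simp add: dg_def Int_def)
  also have "\<dots> = (\<Sum>e\<in>F. \<Sum>v\<in>A. of_bool (v \<in> set_uprod (ends G e)))" by (rule sum.swap)
  also have "\<dots> = (\<Sum>e\<in>F. of_bool (e \<in> F'))"
    using assms(2,3) by (intro sum.cong) (auto simp: Int_def)
  also have "\<dots> = card (F \<inter> F')" using fF by (simp add: Int_def)
  finally show ?thesis .
qed

lemma two_edges_distinct_colors:
  assumes "good_at G col c" "{e\<in>E. c \<in> set_uprod (ends G e)} = {e1, e2}" "e1 \<noteq> e2"
  shows "col e1 \<noteq> col e2"
proof
  assume eq: "col e1 = col e2"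
  have "{e\<in>{e\<in>E. col e = col e1}. c \<in> set_uprod (ends G e)} = {e1, e2}" using assms(2) eq by auto
  then have "dg G {e\<in>E. col e = col e1} c = 2" using assms(3) by (simp add: dg_def)
  then show False using assms(1) unfolding good_at_def by (auto simp: zero_or_odd_def dest!: spec[of _ "col e1"])
qed

text \<open>Modulo 3 all colors have the same degree at a cubic vertex. Counted from \<open>A\<close>, the color of
  \<open>ep\<close> occurs once more than from \<open>B\<close>, the color of \<open>eq\<close> once less.\<close>

lemma not_colorable_cubic_bipartite:
  assumes c: "{e\<in>E. c \<in> set_uprod (ends G e)} = {ep, eq}" "ep \<noteq> eq" "c \<in> V"
    and AB: "A \<inter> B = {}" "A \<union> B = V - {c}" "ends G ep = Upair c p" "p \<in> A" "ends G eq = Upair c q" "q \<in> B"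
    and cross: "\<And>e. e \<in> E \<Longrightarrow> e \<noteq> ep \<Longrightarrow> e \<noteq> eq \<Longrightarrow> \<exists>a\<in>A. \<exists>b\<in>B. ends G e = Upair a b"
    and cubic: "\<And>v. v \<in> V - {c} \<Longrightarrow> dg G E v = 3"
  shows "\<not> colorable 3 G"
proof
  assume "colorable 3 G"
  then obtain col where col: "\<And>e. e \<in> E \<Longrightarrow> col e < 3" "\<And>v. v \<in> V \<Longrightarrow> good_at G col v"
    unfolding colorable_iff by blast
  have ee: "ep \<in> E" "eq \<in> E" using c(1) by auto
  have ne: "col ep \<noteq> col eq" using two_edges_distinct_colors[OF col(2)[OF c(3)] c(1,2)] .
  define cl where "cl i = {e\<in>E. col e = i}" for i
  have clE: "cl i \<subseteq> E" "finite (cl i)" for i by (auto simp: cl_def)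
  have "A \<union> B \<subseteq> V - {c}" using AB(2) by simp
  then have fAB': "A \<subseteq> V - {c}" "B \<subseteq> V - {c}" by blast+
  moreover have "finite (V - {c})" by simp
  ultimately have fAB: "finite A" "finite B" "A \<subseteq> V - {c}" "B \<subseteq> V - {c}" by (blast intro: finite_subset)+
  define t :: "'v \<Rightarrow> nat" where "t v = dg G (cl 0) v mod 3" for v
  have t: "dg G (cl i) v mod 3 = t v" if "i < 3" "v \<in> V - {c}" for i v
  proof -
    have "col e \<in> {0, 1, 2}" if "e \<in> E" for e
    proof -
      have "col e = 0 \<or> col e = 1 \<or> col e = 2" using col(1)[OF that] by linarith
      then show ?thesis by simp
    qed
    then have "dg G E v = (\<Sum>i\<in>{0, 1, 2}. dg G (cl i) v)"
      unfolding cl_def by (intro dg_split) simp_all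
    then have s: "dg G (cl 0) v + dg G (cl 1) v + dg G (cl 2) v = 3" using cubic[OF that(2)] by simp
    have z: "zero_or_odd (dg G (cl j) v)" for j using col(2)[of v] that(2) by (simp add: good_at_def cl_def)
    have "dg G (cl 0) v mod 3 = dg G (cl 1) v mod 3 \<and> dg G (cl 0) v mod 3 = dg G (cl 2) v mod 3"
      by (rule zero_or_odd_sum_3[OF s z z z])
    moreover have "i = 0 \<or> i = 1 \<or> i = 2" using that(1) by auto
    ultimately show ?thesis by (auto simp: t_def)
  qed
  have sumt: "(\<Sum>v\<in>S. dg G (cl i) v) mod 3 = (\<Sum>v\<in>S. t v) mod 3" if "i < 3" "S \<subseteq> V - {c}" for i S
  proof -
    have "(\<Sum>v\<in>S. dg G (cl i) v) mod 3 = (\<Sum>v\<in>S. dg G (cl i) v mod 3) mod 3" by (rule mod_sum_eq[symmetric])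
    also have "(\<Sum>v\<in>S. dg G (cl i) v mod 3) = (\<Sum>v\<in>S. t v)" using t[OF that(1)] that(2) by (intro sum.cong) auto
    finally show ?thesis .
  qed
  \<comment> \<open>\<open>eq\<close> runs from \<open>c\<close> to \<open>B\<close> and so has no
    end in \<open>A\<close>; likewise \<open>ep\<close> has none in \<open>B\<close>.\<close>
  have cnt: "card (A \<inter> set_uprod (ends G e)) = of_bool (e \<in> - {eq}) \<and> card (B \<inter> set_uprod (ends G e)) = of_bool (e \<in> - {ep})"
    if e: "e \<in> E" for e
  proof (cases "e = ep \<or> e = eq")
    case True
    have cn: "c \<notin> A" "c \<notin> B" using fAB by auto
    have "p \<notin> B" "q \<notin> A" using AB by auto
    then show ?thesis using True AB cn c(2) by auto
  next
    case False
    then obtain a b where ab: "a \<in> A" "b \<in> B" "ends G e = Upair a b" using cross e by blast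
    then have "A \<inter> set_uprod (ends G e) = {a}" "B \<inter> set_uprod (ends G e) = {b}" using AB(1) by auto
    then show ?thesis using False by simp
  qed
  have sA: "(\<Sum>v\<in>A. dg G (cl i) v) = card (cl i - {eq})" and sB: "(\<Sum>v\<in>B. dg G (cl i) v) = card (cl i - {ep})" for i
    using sum_dg_class[OF clE(1) fAB(1), of i "- {eq}"] sum_dg_class[OF clE(1) fAB(2), of i "- {ep}"] cnt clE(1)
    by (auto simp: Diff_eq)
  define a where "a = col ep"
  define b where "b = col eq"
  have ab: "a < 3" "b < 3" "ep \<in> cl a" "ep \<notin> cl b" "eq \<in> cl b" "eq \<notin> cl a"
    using col(1) ee ne by (auto simp: a_def b_def cl_def)
  \<comment> \<open>Both numbers leave out the edge at \<open>c\<close>. That edge adds one to its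
    class when counted from its own side, and nothing from the other side.\<close>
  define na where "na = card (cl a - {ep})"
  define nb where "nb = card (cl b - {eq})"
  have c1: "card (cl a - {eq}) = Suc na" and c2: "card (cl b - {ep}) = Suc nb"
    using card.remove[OF clE(2) ab(3)] card.remove[OF clE(2) ab(5)] ab(4,6) by (simp_all add: na_def nb_def)
  define tA where "tA = (\<Sum>v\<in>A. t v)"
  define tB where "tB = (\<Sum>v\<in>B. t v)"
  have "Suc na mod 3 = tA mod 3" using sumt[OF ab(1) fAB(3)] unfolding sA c1 tA_def .
  moreover have "nb mod 3 = tA mod 3" using sumt[OF ab(2) fAB(3)] unfolding sA nb_def tA_def .
  moreover have "na mod 3 = tB mod 3" using sumt[OF ab(1) fAB(4)] unfolding sB na_def tB_def .
  moreover have "Suc nb mod 3 = tB mod 3" using sumt[OF ab(2) fAB(4)] unfolding sB c2 tB_def .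
  \<comment> \<open>The two sides give \<open>na + 1 = nb\<close> and \<open>nb + 1 = na\<close>
    modulo 3, hence 2 would be 0 modulo 3.\<close>
  ultimately have "Suc na mod 3 = nb mod 3" "Suc nb mod 3 = na mod 3" by simp_all
  then have "Suc (Suc na) mod 3 = na mod 3" by (metis mod_Suc_eq)
  then show False by presburger
qed

end

text \<open>Degree two can only occur at \<open>z\<close>, as \<open>x\<close> and \<open>y\<close>
  have odd degree. The two edges at \<open>z\<close> have different colors, and neither color can
  occur between \<open>x\<close> and \<open>y\<close>, because its numbers at \<open>x\<close> and
  at \<open>y\<close> would differ by one. So the even bouquet has a single color, which is even and
  positive at \<open>x\<close>.\<close>

lemma not_colorable_triangle:
  assumes sh: "shannon_triangle G" and ty: "type_211 G" and md: "min_degree G = 2"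
  shows "\<not> colorable 3 G"
proof
  interpret lgraph G using sh by unfold_locales (auto simp: shannon_triangle_def)
  obtain x y z where xyz: "V = {x, y, z}" "distinct [x, y, z]" "even (card (bouquet G x y))"
    "odd (card (bouquet G y z))" "odd (card (bouquet G x z))" using ty unfolding type_211_def by blast
  let ?xy = "bouquet G x y" and ?yz = "bouquet G y z" and ?xz = "bouquet G x z"
  have fin: "finite ?xy" "finite ?yz" "finite ?xz" by (auto simp: bouquet_def)
  have "?xy \<noteq> {}" using sh xyz unfolding shannon_triangle_def by auto
  have E: "e \<in> ?xy \<or> e \<in> ?yz \<or> e \<in> ?xz" if "e \<in> E" for e
  proof -
    obtain u v where "ends G e = Upair u v" "u \<noteq> v" "u \<in> V" "v \<in> V" using \<open>e \<in> E\<close> by (rule ends_cases)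
    then show ?thesis using that unfolding bouquet_def xyz(1) by auto
  qed
  have inc: "{e\<in>E. x \<in> set_uprod (ends G e)} = ?xy \<union> ?xz" "{e\<in>E. y \<in> set_uprod (ends G e)} = ?xy \<union> ?yz"
    "{e\<in>E. z \<in> set_uprod (ends G e)} = ?yz \<union> ?xz"
  proof -
    have "x \<in> set_uprod (ends G e) \<longleftrightarrow> e \<in> ?xy \<union> ?xz" "y \<in> set_uprod (ends G e) \<longleftrightarrow> e \<in> ?xy \<union> ?yz"
      "z \<in> set_uprod (ends G e) \<longleftrightarrow> e \<in> ?yz \<union> ?xz" if "e \<in> E" for e
      using E[OF that] xyz(2) by (auto simp: bouquet_def)
    moreover have "?xy \<subseteq> E" "?yz \<subseteq> E" "?xz \<subseteq> E" by (auto simp: bouquet_def)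
    ultimately show "{e\<in>E. x \<in> set_uprod (ends G e)} = ?xy \<union> ?xz" "{e\<in>E. y \<in> set_uprod (ends G e)} = ?xy \<union> ?yz"
      "{e\<in>E. z \<in> set_uprod (ends G e)} = ?yz \<union> ?xz" by blast+
  qed
  have dj: "?xy \<inter> ?xz = {}" "?xy \<inter> ?yz = {}" "?yz \<inter> ?xz = {}" using xyz(2) by (auto simp: bouquet_def)
  have deg: "degree G x = card ?xy + card ?xz" "degree G y = card ?xy + card ?yz" "degree G z = card ?yz + card ?xz"
    unfolding degree_eq_dg dg_def inc using fin dj by (simp_all add: card_Un_disjoint)
  have "min_degree G \<in> degree G ` V" unfolding min_degree_def using xyz(1) by (intro Min_in) auto
  then have "degree G x = 2 \<or> degree G y = 2 \<or> degree G z = 2" using md xyz(1) by auto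
  then have "card ?yz + card ?xz = 2" using deg xyz(3-5) by (metis even_add even_numeral)
  moreover have "card ?yz > 0" "card ?xz > 0" using xyz(4,5) by (auto intro: odd_pos)
  ultimately have "card ?yz = 1" "card ?xz = 1" by linarith+
  then obtain e1 e2 where e12: "?yz = {e1}" "?xz = {e2}" by (auto simp: card_1_singleton_iff)
  have e12n: "e1 \<noteq> e2" "e1 \<notin> ?xy" "e2 \<notin> ?xy" using dj e12 by auto
  assume "colorable 3 G"
  then obtain col where col: "\<And>e. e \<in> E \<Longrightarrow> col e < 3" "\<And>v. v \<in> V \<Longrightarrow> good_at G col v"
    unfolding colorable_iff by blast
  have ne: "col e1 \<noteq> col e2"
    by (rule two_edges_distinct_colors[of col z]) (use col(2) xyz(1) inc(3) e12 e12n in auto)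
  have gx: "zero_or_odd (card {e\<in>?xy \<union> {e2}. col e = i})" for i
  proof -
    have *: "{e\<in>{e\<in>E. col e = i}. x \<in> set_uprod (ends G e)} = {e\<in>?xy \<union> {e2}. col e = i}" using inc(1) e12 by blast
    have "good_at G col x" using xyz(1) by (intro col(2)) simp
    then have "zero_or_odd (dg G {e\<in>E. col e = i} x)" unfolding good_at_def ..
    then show ?thesis unfolding dg_def * .
  qed
  have gy: "zero_or_odd (card {e\<in>?xy \<union> {e1}. col e = i})" for i
  proof -
    have *: "{e\<in>{e\<in>E. col e = i}. y \<in> set_uprod (ends G e)} = {e\<in>?xy \<union> {e1}. col e = i}" using inc(2) e12 by blast
    have "good_at G col y" using xyz(1) by (intro col(2)) simp
    then have "zero_or_odd (dg G {e\<in>E. col e = i} y)" unfolding good_at_def ..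
    then show ?thesis unfolding dg_def * .
  qed
  define N where "N i = {e\<in>?xy. col e = i}" for i
  have fN: "finite (N i)" for i using fin by (simp add: N_def)
  have x1: "card {e\<in>?xy \<union> {e2}. col e = i} = card (N i) + of_bool (i = col e2)" for i
  proof -
    have "{e\<in>?xy \<union> {e2}. col e = i} = (if i = col e2 then insert e2 (N i) else N i)" by (auto simp: N_def)
    then show ?thesis using e12n fN by (simp add: N_def)
  qed
  have y1: "card {e\<in>?xy \<union> {e1}. col e = i} = card (N i) + of_bool (i = col e1)" for i
  proof -
    have "{e\<in>?xy \<union> {e1}. col e = i} = (if i = col e1 then insert e1 (N i) else N i)" by (auto simp: N_def)
    then show ?thesis using e12n fN by (simp add: N_def)
  qed
  have gx': "zero_or_odd (card (N i) + of_bool (i = col e2))" for i using gx[of i] unfolding x1 .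
  have gy': "zero_or_odd (card (N i) + of_bool (i = col e1))" for i using gy[of i] unfolding y1 .
  have "card (N (col e1)) = 0" "card (N (col e2)) = 0"
    using gx'[of "col e1"] gy'[of "col e1"] gx'[of "col e2"] gy'[of "col e2"] ne
    by (auto simp: zero_or_odd_def)
  then have "N (col e1) = {}" "N (col e2) = {}" using fN by auto
  then have no: "col e \<noteq> col e1 \<and> col e \<noteq> col e2" if "e \<in> ?xy" for e using that by (auto simp: N_def)
  obtain e0 where e0: "e0 \<in> ?xy" using \<open>?xy \<noteq> {}\<close> by blast
  have "N (col e0) = ?xy"
  proof -
    have "e1 \<in> E" "e2 \<in> E" using e12 by (auto simp: bouquet_def)
    moreover have "?xy \<subseteq> E" by (auto simp: bouquet_def)
    ultimately have lt: "col e1 < 3" "col e2 < 3" "\<And>e. e \<in> ?xy \<Longrightarrow> col e < 3" using col(1) by blast+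
    have "col e = col e0" if "e \<in> ?xy" for e
      using lt(1,2) lt(3)[OF that] lt(3)[OF e0] no[OF that] no[OF e0] ne
      by (auto simp: numeral_3_eq_3 less_Suc_eq)
    then show ?thesis by (auto simp: N_def)
  qed
  then have "zero_or_odd (card ?xy)" using gx'[of "col e0"] no[OF e0] by simp
  then show False using xyz(3) \<open>?xy \<noteq> {}\<close> fin by (auto simp: zero_or_odd_def)
qed

lemma not_colorable_subdivided_cubic:
  assumes H: "multigraph H" "loopless H" "bipartite H" "cubic H" "e \<in> edges H" "ends H e = Upair x y"
  shows "lgraph (subdivide H e x y)" "\<not> colorable 3 (subdivide H e x y)"
proof -
  let ?K = "subdivide H e x y"
  have xy: "x \<noteq> y" "x \<in> verts H" "y \<in> verts H" using H by (auto simp: loopless_def multigraph_def)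
  show K: "lgraph ?K"
  proof
    show "multigraph ?K" using H by (intro multigraph_subdivide) auto
    have "map_uprod Some (ends H e') \<noteq> Upair v v" if "e' \<in> edges H" for e' v
    proof -
      obtain a b where "ends H e' = Upair a b" by (rule uprod_ends)
      moreover from this have "a \<noteq> b" using H(2) that by (auto simp: loopless_def)
      ultimately show ?thesis by auto
    qed
    then show "loopless ?K" by (auto simp: loopless_def)
  qed
  interpret K: lgraph ?K by (rule K)
  obtain A B where *: "A \<union> B = verts H \<and> A \<inter> B = {} \<and> (\<forall>e\<in>edges H. \<exists>a\<in>A. \<exists>b\<in>B. ends H e = Upair a b)"
    using H(3) unfolding bipartite_def by (elim exE)
  then have AB: "A \<union> B = verts H" "A \<inter> B = {}" "\<And>e. e \<in> edges H \<Longrightarrow> \<exists>a\<in>A. \<exists>b\<in>B. ends H e = Upair a b"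
    by simp_all
  have inc: "{e'\<in>edges ?K. None \<in> set_uprod (ends ?K e')} = {None, Some None}"
    by (auto simp: uprod.set_map)
  have deg: "dg ?K (edges ?K) v = 3" if "v \<in> verts ?K - {None}" for v
  proof -
    obtain w where w: "v = Some w" "w \<in> verts H" using \<open>v \<in> verts ?K - {None}\<close> by auto
    then show ?thesis using K.degree_eq_dg[of v] degree_subdivide(1)[OF H(1,5,6), of w] H(4) by (simp add: cubic_def)
  qed
  \<comment> \<open>The ends of \<open>e\<close> lie in different classes of the bipartition, but
    either class may contain \<open>x\<close>.\<close>
  have main: "\<not> colorable 3 ?K" if PQ: "P \<union> Q = verts H" "P \<inter> Q = {}" "x \<in> P" "y \<in> Q"
    and cr: "\<And>e. e \<in> edges H \<Longrightarrow> \<exists>a\<in>P. \<exists>b\<in>Q. ends H e = Upair a b" for P Q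
  proof (rule K.not_colorable_cubic_bipartite[of None "Some None" None "Some ` P" "Some ` Q" "Some x" "Some y"])
    show "{e'\<in>edges ?K. None \<in> set_uprod (ends ?K e')} = {Some None, None}" unfolding inc by blast
    show "Some ` P \<inter> Some ` Q = {}" using PQ(2) by auto
    show "Some ` P \<union> Some ` Q = verts ?K - {None}" unfolding image_Un[symmetric] PQ(1) by auto
    show "ends ?K (Some None) = Upair None (Some x)" by (simp add: Upair_inject)
    fix e' assume e': "e' \<in> edges ?K" "e' \<noteq> Some None" "e' \<noteq> None"
    then obtain e0 where e0: "e' = Some (Some e0)" "e0 \<in> edges H" by auto
    obtain a b where "a \<in> P" "b \<in> Q" "ends H e0 = Upair a b" using cr[OF e0(2)] by blast
    then show "\<exists>a\<in>Some ` P. \<exists>b\<in>Some ` Q. ends ?K e' = Upair a b" using e0 by auto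
  qed (use PQ(3,4) deg in simp_all)
  have "x \<in> A \<and> y \<in> B \<or> x \<in> B \<and> y \<in> A" using AB(3)[OF H(5)] H(6) by auto
  then show "\<not> colorable 3 ?K"
  proof (elim disjE conjE)
    assume "x \<in> A" "y \<in> B"
    then show ?thesis using main[OF AB(1,2)] AB(3) by blast
  next
    assume "x \<in> B" "y \<in> A"
    moreover have "\<exists>b\<in>B. \<exists>a\<in>A. ends H e' = Upair b a" if "e' \<in> edges H" for e'
      using AB(3)[OF that] by (metis Upair_inject)
    ultimately show ?thesis using main[of B A] AB(1,2) by (simp add: Un_commute Int_commute)
  qed
qed

section \<open>Colorings of gluings\<close>

definition glued :: "('u, 'd) mgraph \<Rightarrow> 'd \<Rightarrow> 'u \<Rightarrow> 'u \<Rightarrow> ('v, 'e) mgraph \<Rightarrow> 'v \<Rightarrow> 'v \<Rightarrow> 'v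
    \<Rightarrow> ('u + 'v, ('d + 'e) option option) mgraph" where
  "glued G' e x y G'' c p q = add_edge
     (add_edge (disjoint_union (del_edge G' e) (del_vert G'' c)) (Inl x) (Inr p)) (Inl y) (Inr q)"

lemma glued_simps [simp]:
  "verts (glued G' e x y G'' c p q) = verts G' <+> (verts G'' - {c})"
  "edges (glued G' e x y G'' c p q) = insert None (insert (Some None) ((Some \<circ> Some) `
     ((edges G' - {e}) <+> {d\<in>edges G''. c \<notin> set_uprod (ends G'' d)})))"
  "ends (glued G' e x y G'' c p q) None = Upair (Inl y) (Inr q)"
  "ends (glued G' e x y G'' c p q) (Some None) = Upair (Inl x) (Inr p)"
  "ends (glued G' e x y G'' c p q) (Some (Some (Inl d))) = map_uprod Inl (ends G' d)"
  "ends (glued G' e x y G'' c p q) (Some (Some (Inr d'))) = map_uprod Inr (ends G'' d')"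
  by (auto simp: glued_def image_image)

locale gluing_setup = G': lgraph G' + G'': lgraph G''
  for G' :: "('u, 'd) mgraph" and G'' :: "('v, 'e) mgraph" +
  fixes e x y c f p g q
  assumes e: "e \<in> edges G'" "ends G' e = Upair x y"
    and c: "c \<in> verts G''" "dg G'' (edges G'') c = 2"
    and fg: "f \<in> edges G''" "g \<in> edges G''" "f \<noteq> g" "ends G'' f = Upair c p" "ends G'' g = Upair c q"
begin

abbreviation "U \<equiv> glued G' e x y G'' c p q"

lemma xy: "x \<noteq> y" "x \<in> verts G'" "y \<in> verts G'"
  using G'.ends_in_V[OF e] by auto

lemma pq: "p \<noteq> c" "q \<noteq> c" "p \<in> verts G''" "q \<in> verts G''"
  using G''.ends_in_V[OF fg(1,4)] G''.ends_in_V[OF fg(2,5)] by auto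

lemma inc_c: "{d\<in>edges G''. c \<in> set_uprod (ends G'' d)} = {f, g}"
proof -
  have "card {d\<in>edges G''. c \<in> set_uprod (ends G'' d)} = 2" using c(2) by (simp add: dg_def)
  moreover have "{f, g} \<subseteq> {d\<in>edges G''. c \<in> set_uprod (ends G'' d)}" using fg by auto
  moreover have "card {f, g} = 2" using fg(3) by simp
  ultimately show ?thesis using card_subset_eq[of "{d\<in>edges G''. c \<in> set_uprod (ends G'' d)}" "{f, g}"] by simp
qed

lemma lgraph_U: "lgraph U"
proof
  have "set_uprod (ends U d) \<subseteq> verts U" if "d \<in> edges U" for d
  proof -
    consider "d = None" | "d = Some None" | d' where "d = Some (Some (Inl d'))" "d' \<in> edges G'"
      | d' where "d = Some (Some (Inr d'))" "d' \<in> edges G''" "c \<notin> set_uprod (ends G'' d')" using \<open>d \<in> edges U\<close> by auto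
    then show ?thesis
    proof cases
      case 3
      then have "set_uprod (ends G' d') \<subseteq> verts G'" using G'.multigraph by (simp add: multigraph_def)
      then show ?thesis using 3 by (auto simp: uprod.set_map)
    next
      case 4
      then have "set_uprod (ends G'' d') \<subseteq> verts G''" using G''.multigraph by (simp add: multigraph_def)
      then show ?thesis using 4 by (auto simp: uprod.set_map)
    qed (use xy pq in auto)
  qed
  then show "multigraph U" using G'.finite_V G'.finite_E G''.finite_V G''.finite_E by (simp add: multigraph_def)
  show "loopless U" unfolding loopless_def
  proof (intro ballI allI)
    fix d v assume "d \<in> edges U"
    then consider "d = None" | "d = Some None" | d' where "d = Some (Some (Inl d'))" "d' \<in> edges G'"
      | d' where "d = Some (Some (Inr d'))" "d' \<in> edges G''" by auto
    then show "ends U d \<noteq> Upair v v"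
    proof cases
      case 3
      obtain a b where "ends G' d' = Upair a b" "a \<noteq> b" using 3(2) by (rule G'.ends_cases)
      then show ?thesis using 3 by auto
    next
      case 4
      obtain a b where "ends G'' d' = Upair a b" "a \<noteq> b" using 4(2) by (rule G''.ends_cases)
      then show ?thesis using 4 by auto
    qed auto
  qed
qed

lemma dg_Inl:
  "dg U {d\<in>edges U. col d = i} (Inl v) = dg G' {d\<in>edges G' - {e}. col (Some (Some (Inl d))) = i} v
     + of_bool (col (Some None) = i \<and> v = x) + of_bool (col None = i \<and> v = y)"
proof -
  let ?S = "{d\<in>{d\<in>edges G' - {e}. col (Some (Some (Inl d))) = i}. v \<in> set_uprod (ends G' d)}"
  define SS where "SS = ((Some \<circ> Some \<circ> Inl) ` ?S :: ('d + 'e) option option set)"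
  define A where "A = (if col (Some None) = i \<and> v = x then {Some None} else {} :: ('d + 'e) option option set)"
  define B where "B = (if col None = i \<and> v = y then {None} else {} :: ('d + 'e) option option set)"
  have "{d\<in>{d\<in>edges U. col d = i}. Inl v \<in> set_uprod (ends U d)} = SS \<union> (A \<union> B)"
    by (auto simp: SS_def A_def B_def uprod.set_map image_iff split: if_splits)
  moreover have "card (SS \<union> (A \<union> B)) = card SS + card (A \<union> B)"
    by (intro card_Un_disjoint) (auto simp: SS_def A_def B_def)
  moreover have "card SS = card ?S" unfolding SS_def by (intro card_image) (auto simp: inj_on_def)
  moreover have "card (A \<union> B) = of_bool (col (Some None) = i \<and> v = x) + of_bool (col None = i \<and> v = y)"
    by (auto simp: A_def B_def card_insert_if)
  ultimately show ?thesis unfolding dg_def by simp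
qed

lemma dg_Inr:
  assumes "v \<noteq> c"
  shows "dg U {d\<in>edges U. col d = i} (Inr v) = dg G'' {d\<in>edges G'' - {f, g}. col (Some (Some (Inr d))) = i} v
     + of_bool (col (Some None) = i \<and> v = p) + of_bool (col None = i \<and> v = q)"
proof -
  let ?S = "{d\<in>{d\<in>edges G'' - {f, g}. col (Some (Some (Inr d))) = i}. v \<in> set_uprod (ends G'' d)}"
  define SS where "SS = ((Some \<circ> Some \<circ> Inr) ` ?S :: ('d + 'e) option option set)"
  define A where "A = (if col (Some None) = i \<and> v = p then {Some None} else {} :: ('d + 'e) option option set)"
  define B where "B = (if col None = i \<and> v = q then {None} else {} :: ('d + 'e) option option set)"
  have *: "{d\<in>edges G''. c \<notin> set_uprod (ends G'' d)} = edges G'' - {f, g}" using inc_c by blast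
  have "{d\<in>{d\<in>edges U. col d = i}. Inr v \<in> set_uprod (ends U d)} = SS \<union> (A \<union> B)"
    unfolding glued_simps(2) * by (auto simp: SS_def A_def B_def uprod.set_map image_iff split: if_splits)
  moreover have "card (SS \<union> (A \<union> B)) = card SS + card (A \<union> B)"
    by (intro card_Un_disjoint) (auto simp: SS_def A_def B_def)
  moreover have "card SS = card ?S" unfolding SS_def by (intro card_image) (auto simp: inj_on_def)
  moreover have "card (A \<union> B) = of_bool (col (Some None) = i \<and> v = p) + of_bool (col None = i \<and> v = q)"
    by (auto simp: A_def B_def card_insert_if)
  ultimately show ?thesis unfolding dg_def by simp
qed

text \<open>If the two connecting edges have the same color, it can be given to \<open>e\<close> in
  \<open>G'\<close>; if not, the two colors can be given to the edges at \<open>c\<close> in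
  \<open>G''\<close>.\<close>

lemma colorable_U:
  assumes "colorable k U"
  shows "colorable k G' \<or> colorable k G''"
proof -
  obtain col where col: "\<And>d. d \<in> edges U \<Longrightarrow> col d < k" "\<And>v. v \<in> verts U \<Longrightarrow> good_at U col v"
    using assms unfolding colorable_iff by blast
  define a where "a = col (Some None)"
  define b where "b = col None"
  have abk: "a < k" "b < k" using col(1) by (auto simp: a_def b_def)
  show ?thesis
  proof (cases "a = b")
    case True
    define col' where "col' d = (if d = e then a else col (Some (Some (Inl d))))" for d
    have "good_at G' col' v" if v: "v \<in> verts G'" for v
      unfolding good_at_def
    proof
      fix i
      let ?F = "{d\<in>edges G' - {e}. col (Some (Some (Inl d))) = i}"
      have "{d\<in>edges G'. col' d = i} = (if i = a then insert e ?F else ?F)" using e by (auto simp: col'_def)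
      moreover have "dg G' (insert e ?F) v = dg G' ?F v + of_bool (v = x \<or> v = y)"
        using G'.dg_insert[of ?F e v] e by auto
      ultimately have eqU: "dg G' {d\<in>edges G'. col' d = i} v = dg U {d\<in>edges U. col d = i} (Inl v)"
        unfolding dg_Inl using True xy by (auto simp: a_def b_def)
      have "good_at U col (Inl v)" using v by (intro col(2)) auto
      then show "zero_or_odd (dg G' {d\<in>edges G'. col' d = i} v)" unfolding eqU good_at_def ..
    qed
    moreover have "col' d < k" if "d \<in> edges G'" for d using col(1)[of "Some (Some (Inl d))"] that abk by (auto simp: col'_def)
    ultimately show ?thesis unfolding colorable_iff by blast
  next
    case False
    define col' where "col' d = (if d = f then a else if d = g then b else col (Some (Some (Inr d))))" for d
    have "good_at G'' col' v" if v: "v \<in> verts G''" for v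
      unfolding good_at_def
    proof
      fix i
      define F where "F = {d\<in>edges G'' - {f, g}. col (Some (Some (Inr d))) = i}"
      have F: "F \<subseteq> edges G''" "f \<notin> F" "g \<notin> F" by (auto simp: F_def)
      have eq: "{d\<in>edges G''. col' d = i} = (if i = a then insert f F else if i = b then insert g F else F)"
        using fg False by (auto simp: col'_def F_def)
      have df: "dg G'' (insert f F) v = dg G'' F v + of_bool (v = c \<or> v = p)"
        using G''.dg_insert[OF F(1) fg(1) F(2)] fg by auto
      have dgg: "dg G'' (insert g F) v = dg G'' F v + of_bool (v = c \<or> v = q)"
        using G''.dg_insert[OF F(1) fg(2) F(3)] fg by auto
      show "zero_or_odd (dg G'' {d\<in>edges G''. col' d = i} v)"
      proof (cases "v = c")
        case True
        have "dg G'' F c = 0" using inc_c F by (subst G''.dg_zero_iff) (auto simp: F_def)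
        then show ?thesis unfolding eq using df dgg True by (simp add: zero_or_odd_def)
      next
        case vc: False
        have eqU: "dg G'' {d\<in>edges G''. col' d = i} v = dg U {d\<in>edges U. col d = i} (Inr v)"
          unfolding dg_Inr[OF vc] eq F_def[symmetric] using df dgg vc False by (auto simp: a_def b_def)
        have "good_at U col (Inr v)" using v vc by (intro col(2)) auto
        then show ?thesis unfolding eqU good_at_def ..
      qed
    qed
    moreover have "col' d < k" if "d \<in> edges G''" for d
    proof (cases "d = f \<or> d = g")
      case False
      then have "c \<notin> set_uprod (ends G'' d)" using inc_c that by blast
      then show ?thesis using col(1)[of "Some (Some (Inr d))"] that False by (auto simp: col'_def)
    qed (use abk in \<open>auto simp: col'_def\<close>)
    ultimately show ?thesis unfolding colorable_iff by blast
  qed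
qed

end

lemma family_F_not_colorable:
  assumes "G \<in> family_F"
  shows "lgraph G \<and> \<not> colorable 3 G"
  using assms
proof (induction rule: family_F.induct)
  case (triangle G)
  then have "lgraph G" by unfold_locales (auto simp: shannon_triangle_def)
  then show ?case using not_colorable_triangle triangle by blast
next
  case (cubic H e x y G)
  have ll: "loopless H" using two_connected_loopless cubic by blast
  note K = not_colorable_subdivided_cubic[OF cubic(1) ll cubic(3-6)]
  interpret K: lgraph "subdivide H e x y" by (rule K(1))
  have "lgraph G"
    using multigraph_iso[OF cubic(7) K.multigraph] loopless_iso[OF cubic(7) K.multigraph K.loopless] by unfold_locales
  then show ?case using colorable_iso[OF cubic(7) K.multigraph] K(2) by blast
next
  case (glue G' G'' G)
  then obtain e x y c f p g q where gl: "e \<in> edges G'" "ends G' e = Upair x y"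
     "{v\<in>verts G''. degree G'' v = 2} = {c}"
     "f \<in> edges G''" "g \<in> edges G''" "f \<noteq> g" "ends G'' f = Upair c p" "ends G'' g = Upair c q"
     "isomorphic (glued G' e x y G'' c p q) G"
    unfolding gluing_def glued_def by blast
  interpret G': lgraph G' using glue by blast
  interpret G'': lgraph G'' using glue by blast
  have "c \<in> verts G''" "degree G'' c = 2" using gl(3) by blast+
  then interpret gluing_setup G' G'' e x y c f p g q
    using gl by unfold_locales (auto simp: G''.degree_eq_dg)
  interpret U: lgraph U by (rule lgraph_U)
  have "lgraph G"
    using multigraph_iso[OF gl(9) U.multigraph] loopless_iso[OF gl(9) U.multigraph U.loopless] by unfold_locales
  then show ?case using colorable_iso[OF gl(9) U.multigraph] colorable_U[of 3] glue by blast
qed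

section \<open>Graphs without a 3-coloring are members of the family\<close>

text \<open>The graph \<open>G - c + pq\<close>. The new edge takes the name \<open>ep\<close>, so
  that subdividing \<open>ep\<close> gives \<open>G\<close> back.\<close>

definition suppress :: "('v, 'e) mgraph \<Rightarrow> 'v \<Rightarrow> 'e \<Rightarrow> 'e \<Rightarrow> 'v \<Rightarrow> 'v \<Rightarrow> ('v, 'e) mgraph" where
  "suppress G c ep eq p q = \<lparr>verts = verts G - {c}, edges = edges G - {eq}, ends = (ends G)(ep := Upair p q)\<rparr>"

text \<open>The new edge stands for everything outside \<open>Y\<close>; as its name
  \<open>f\<close>, that of an edge leaving \<open>Y\<close> is intended.\<close>

definition replace_by_edge :: "('v, 'e) mgraph \<Rightarrow> 'v set \<Rightarrow> 'e \<Rightarrow> 'v \<Rightarrow> 'v \<Rightarrow> ('v, 'e) mgraph" where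
  "replace_by_edge G Y f x y = \<lparr>verts = Y, edges = insert f (inner G (edges G) Y), ends = (ends G)(f := Upair x y)\<rparr>"

lemma suppress_simps [simp]:
  "verts (suppress G c ep eq p q) = verts G - {c}" "edges (suppress G c ep eq p q) = edges G - {eq}"
  "ends (suppress G c ep eq p q) = (ends G)(ep := Upair p q)"
  by (simp_all add: suppress_def)

lemma replace_by_edge_simps [simp]:
  "verts (replace_by_edge G Y f x y) = Y" "edges (replace_by_edge G Y f x y) = insert f (inner G (edges G) Y)"
  "ends (replace_by_edge G Y f x y) = (ends G)(f := Upair x y)"
  by (simp_all add: replace_by_edge_def)

context tgraph
begin

lemma near_oddI:
  assumes "c \<in> V" "dg G E c = 2" "\<And>v. v \<in> V \<Longrightarrow> v \<noteq> c \<Longrightarrow> odd (dg G E v)"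
  shows "\<exists>ep eq p q. near_odd G c ep eq p q"
proof -
  obtain ep eq where e: "{e\<in>E. c \<in> set_uprod (ends G e)} = {ep, eq}" "ep \<noteq> eq"
    using assms(2) unfolding dg_def by (auto simp: card_2_iff)
  have "\<exists>u. ends G d = Upair c u" if "c \<in> set_uprod (ends G d)" for d
  proof -
    obtain x y where "ends G d = Upair x y" by (rule uprod_ends)
    moreover from this have "ends G d = Upair y x" by auto
    ultimately show ?thesis using that by auto
  qed
  moreover have ce: "ep \<in> {e\<in>E. c \<in> set_uprod (ends G e)}" "eq \<in> {e\<in>E. c \<in> set_uprod (ends G e)}"
    unfolding e by simp_all
  ultimately obtain p q where pq: "ends G ep = Upair c p" "ends G eq = Upair c q" by (metis (no_types, lifting) mem_Collect_eq)
  have "near_odd G c ep eq p q"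
  proof
    show "ep \<in> E" "eq \<in> E" using ce by simp_all
    show "e = ep \<or> e = eq" if "e \<in> E" "c \<in> set_uprod (ends G e)" for e
    proof -
      have "e \<in> {ep, eq}" unfolding e(1)[symmetric] using that by simp
      then show ?thesis by simp
    qed
  qed (use assms e(2) pq in auto)
  then show ?thesis by blast
qed

text \<open>If the cut were a single edge, its end outside \<open>X\<close> would be a cut-vertex,
  since \<open>V - X\<close> contains \<open>c\<close> and at least one further vertex.\<close>

lemma no_bridge:
  assumes X: "X \<subseteq> V" "X - {c} \<noteq> {}" "V - X - {c} \<noteq> {}" "c \<in> V" "c \<notin> X"
  shows "2 \<le> card (cut G E X)"
proof (rule ccontr)
  assume n: "\<not> ?thesis"
  have f: "finite (cut G E X)" by (simp add: cut_def)
  have "X \<noteq> {}" "X \<noteq> V" using X by auto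
  with conn_V X(1) obtain e a b where e: "e \<in> E" "ends G e = Upair a b" "a \<in> X" "b \<in> V - X" by (rule conn_cut)
  have ec: "e \<in> cut G E X" using cut_iff[OF e(2)] e by auto
  have only: "d = e" if "d \<in> cut G E X" for d
    using n f ec that card_le_Suc0_iff_eq[OF f] by auto
  have "b \<in> V" using e by simp
  moreover have "X \<subseteq> V - {b}" "X \<noteq> {}" using X e by auto
  moreover have "X \<noteq> V - {b}" using X e(4) by auto
  ultimately obtain d x y where d: "d \<in> E" "ends G d = Upair x y" "x \<in> X" "y \<in> V - {b} - X"
    using conn_cut[OF del_conn] by metis
  have "d \<in> cut G E X" using cut_iff[OF d(2)] d by auto
  then have "d = e" by (rule only)
  then have "Upair x y = Upair a b" using d(2) unfolding e(2)[symmetric] by simp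
  then show False using d(3,4) e(3,4) by auto
qed

end

section \<open>Basic members: suppressing the 2-vertex, and graphs of order three\<close>

context near_odd
begin

lemma suppress_tgraph:
  assumes "card V \<ge> 4"
  shows "tgraph (suppress G c ep eq p q)"
proof -
  let ?H = "suppress G c ep eq p q"
  have eH: "ends ?H e = ends G e \<and> c \<notin> set_uprod (ends G e)" if "e \<in> E - {ep, eq}" for e
    using that c_only[of e] by auto
  show ?thesis
  proof
    have "set_uprod (ends ?H e) \<subseteq> V - {c}" if "e \<in> edges ?H" for e
    proof (cases "e = ep")
      case False
      have "set_uprod (ends G e) \<subseteq> V" using that multigraph by (auto simp: multigraph_def)
      then show ?thesis using eH[of e] that False by auto
    qed (use pq in auto)
    then show "Defs.multigraph ?H" by (simp add: multigraph_def)
    show "Defs.loopless ?H" using loopless p_neq_q by (auto simp: loopless_def)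
    show "card (verts ?H) \<ge> 3" using assms c by simp
    fix v assume v: "v \<in> verts ?H"
    \<comment> \<open>\<open>c\<close> is sent to a neighbor that survives the removal of
      \<open>v\<close>; if both neighbors survive, the edge \<open>pq\<close> replaces the path
      through \<open>c\<close>.\<close>
    define u where "u = (if v = p then q else p)"
    have u: "u \<in> V - {v} - {c}" using p_neq_q pq by (auto simp: u_def)
    have "conn G E (V - {v})" using v by (intro del_conn) auto
    then show "conn ?H (edges ?H) (verts ?H - {v})"
    proof (rule conn_image[where h = "\<lambda>x. if x = c then u else x"])
      fix x y e assume e: "x \<in> V - {v}" "y \<in> V - {v}" "e \<in> E" "ends G e = Upair x y"
      have pqa: "(p, q) \<in> adj ?H (edges ?H) (verts ?H - {v})" "(q, p) \<in> adj ?H (edges ?H) (verts ?H - {v})" if "v \<noteq> p" "v \<noteq> q"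
        using that pq ep ep_eq by (auto intro!: adjI[of ep] adjI'[of ep])
      show "(if x = c then u else x, if y = c then u else y) \<in> (adj ?H (edges ?H) (verts ?H - {v}))\<^sup>*"
      proof (cases "e \<in> {ep, eq}")
        case False
        then have "c \<noteq> x" "c \<noteq> y" using eH[of e] e by auto
        moreover have "(x, y) \<in> adj ?H (edges ?H) (verts ?H - {v})"
          using e False eH[of e] calculation by (intro adjI[of e]) auto
        ultimately show ?thesis by auto
      next
        case True
        then have "x = c \<and> (y = p \<and> e = ep \<or> y = q \<and> e = eq) \<or> y = c \<and> (x = p \<and> e = ep \<or> x = q \<and> e = eq)"
          using e(4) ep eq by auto
        then show ?thesis using pqa e pq by (auto simp: u_def)
      qed
    next
      fix z assume z: "z \<in> verts ?H - {v}"
      then have "z \<in> V - {v} \<and> (z, if z = c then u else z) \<in> (adj ?H (edges ?H) (verts ?H - {v}))\<^sup>*" by auto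
      then show "\<exists>x\<in>V - {v}. (z, if x = c then u else x) \<in> (adj ?H (edges ?H) (verts ?H - {v}))\<^sup>*" by blast
    qed
  qed
qed

lemma dg_suppress:
  assumes "v \<in> V" "v \<noteq> c"
  shows "dg (suppress G c ep eq p q) (E - {eq}) v = dg G E v"
proof -
  let ?H = "suppress G c ep eq p q"
  let ?S = "{e\<in>E - {ep, eq}. v \<in> set_uprod (ends G e)}"
  have "{e\<in>E - {eq}. v \<in> set_uprod (ends ?H e)} = (if v = p \<or> v = q then insert ep ?S else ?S)"
    using ep ep_eq by auto
  moreover have "{e\<in>E. v \<in> set_uprod (ends G e)} = (if v = p then insert ep ?S else if v = q then insert eq ?S else ?S)"
    using ep eq p_neq_q assms by auto
  ultimately show ?thesis unfolding dg_def by auto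
qed

lemma iso_subdivide_suppress: "isomorphic (subdivide (suppress G c ep eq p q) ep p q) G"
proof -
  let ?H = "suppress G c ep eq p q"
  let ?K = "subdivide ?H ep p q"
  define f where "f = case_option c (\<lambda>v. v)"
  define g where "g = case_option eq (case_option ep (\<lambda>e. e))"
  have "bij_betw f (verts ?K) V"
    unfolding bij_betw_def
  proof
    show "inj_on f (verts ?K)" by (auto simp: inj_on_def f_def)
    show "f ` verts ?K = V" using c by (auto simp: f_def image_image)
  qed
  moreover have "bij_betw g (edges ?K) E"
    unfolding bij_betw_def
  proof
    show "inj_on g (edges ?K)" using ep_eq by (auto simp: inj_on_def g_def)
    have "g ` edges ?K = insert eq (insert ep (E - {eq} - {ep}))" by (auto simp: g_def image_image)
    then show "g ` edges ?K = E" using ep eq by auto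
  qed
  moreover have "ends G (g e) = map_uprod f (ends ?K e)" if "e \<in> edges ?K" for e
  proof -
    consider "e = None" | "e = Some None" | e' where "e = Some (Some e')" "e' \<noteq> ep" using \<open>e \<in> edges ?K\<close> by auto
    then show ?thesis
    proof cases
      case 1 then show ?thesis using eq by (simp add: g_def f_def)
    next
      case 2 then show ?thesis using ep by (simp add: g_def f_def Upair_inject)
    next
      case 3
      obtain x y where "ends G e' = Upair x y" by (rule uprod_ends)
      then show ?thesis using 3 by (simp add: g_def f_def)
    qed
  qed
  ultimately show ?thesis unfolding isomorphic_def by blast
qed

text \<open>\<open>proper2\<close> is by design a bipartition of the suppressed graph, of which
  \<open>G\<close> is a subdivision.\<close>

lemma family_F_cubic:
  assumes n: "\<not> colorable 3 G" and V: "card V \<ge> 4" and cubic: "\<And>v. v \<in> V \<Longrightarrow> v \<noteq> c \<Longrightarrow> dg G E v = 3"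
  shows "G \<in> family_F"
proof -
  let ?H = "suppress G c ep eq p q"
  interpret H: tgraph ?H using suppress_tgraph V .
  obtain \<phi> where \<phi>: "proper2 \<phi>" using ex_proper2[OF n] by blast
  have "two_connected ?H" using tgraph_iff[OF H.multigraph] H.tgraph_axioms by blast
  moreover have "bipartite ?H" unfolding bipartite_def
  proof (intro exI conjI ballI)
    show "{v\<in>V - {c}. \<phi> v} \<union> {v\<in>V - {c}. \<not> \<phi> v} = verts ?H" by auto
    show "{v\<in>V - {c}. \<phi> v} \<inter> {v\<in>V - {c}. \<not> \<phi> v} = {}" by auto
    fix e assume e: "e \<in> edges ?H"
    then obtain x y where xy: "ends ?H e = Upair x y" "x \<in> verts ?H" "y \<in> verts ?H" by (rule H.ends_cases)
    have yx: "ends ?H e = Upair y x" using xy by auto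
    have "\<phi> x \<noteq> \<phi> y"
    proof (cases "e = ep")
      case True
      then show ?thesis using xy(1) \<phi> by (auto simp: proper2_def)
    next
      case False
      then have "e \<in> E" "ends G e = Upair x y" using xy e by auto
      moreover from this have "c \<notin> set_uprod (ends G e)" using xy by auto
      ultimately show ?thesis using \<phi> unfolding proper2_def by blast
    qed
    then show "\<exists>a\<in>{v\<in>V - {c}. \<phi> v}. \<exists>b\<in>{v\<in>V - {c}. \<not> \<phi> v}. ends ?H e = Upair a b"
    proof (cases "\<phi> x")
      case True
      then show ?thesis using xy \<open>\<phi> x \<noteq> \<phi> y\<close> by (intro bexI[of _ x] bexI[of _ y]) auto
    next
      case False
      then show ?thesis using xy yx \<open>\<phi> x \<noteq> \<phi> y\<close> by (intro bexI[of _ y] bexI[of _ x]) auto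
    qed
  qed
  moreover have "Defs.cubic ?H"
    unfolding cubic_def H.degree_eq_dg using dg_suppress cubic by auto
  moreover have "ep \<in> edges ?H" "ends ?H ep = Upair p q" using ep ep_eq by auto
  ultimately show ?thesis using family_F.cubic[OF H.multigraph] iso_subdivide_suppress by blast
qed

text \<open>On three vertices all edges away from \<open>c\<close> join \<open>p\<close> and
  \<open>q\<close>, and the odd degree of \<open>p\<close> makes their number even.\<close>

lemma family_F_triangle:
  assumes V: "card V = 3"
  shows "G \<in> family_F"
proof -
  have VV: "V = {c, p, q}"
  proof -
    have "card {c, p, q} = 3" using pq p_neq_q by (simp add: card_insert_if)
    then show ?thesis using card_subset_eq[of V "{c, p, q}"] V c pq by simp
  qed
  have dist: "distinct [p, q, c]" using pq p_neq_q by auto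
  let ?pq = "bouquet G p q"
  have fin: "finite ?pq" by (simp add: bouquet_def)
  have bc: "bouquet G p c = {ep}" "bouquet G q c = {eq}"
  proof -
    have 1: "e = ep \<or> e = eq" if "e \<in> bouquet G u c" for e u using c_only[of e] that by (simp add: bouquet_def)
    have 2: "ep \<in> bouquet G p c" "eq \<in> bouquet G q c" using ep eq by (simp_all add: bouquet_def)
    have 3: "eq \<notin> bouquet G p c" "ep \<notin> bouquet G q c" using ep eq p_neq_q pq by (simp_all add: bouquet_def)
    show "bouquet G p c = {ep}" "bouquet G q c = {eq}" using 1 2 3 by blast+
  qed
  have inc: "e \<in> ?pq \<or> e = ep \<or> e = eq" if "e \<in> E" for e
  proof (cases "c \<in> set_uprod (ends G e)")
    case False
    obtain x y where "ends G e = Upair x y" "x \<noteq> y" "x \<in> V" "y \<in> V" using \<open>e \<in> E\<close> by (rule ends_cases)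
    then show ?thesis using that False unfolding VV bouquet_def by auto
  qed (use that c_only in blast)
  have eps: "ep \<notin> ?pq" "eq \<notin> ?pq" using ep eq pq by (auto simp: bouquet_def)
  have "{e\<in>E. p \<in> set_uprod (ends G e)} = insert ep ?pq" "{e\<in>E. q \<in> set_uprod (ends G e)} = insert eq ?pq"
  proof -
    have i: "e \<in> E \<and> p \<in> set_uprod (ends G e) \<and> q \<in> set_uprod (ends G e)" if "e \<in> ?pq" for e
      using that by (simp add: bouquet_def)
    have n: "p \<notin> set_uprod (ends G eq)" "q \<notin> set_uprod (ends G ep)" using ep eq pq p_neq_q by auto
    have m: "p \<in> set_uprod (ends G ep)" "q \<in> set_uprod (ends G eq)" using ep eq by auto
    have a: "e \<in> insert ep ?pq" if "e \<in> E" "p \<in> set_uprod (ends G e)" for e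
      using inc[OF that(1)] n(1) that(2) by (elim disjE) simp_all
    have b: "e \<in> insert eq ?pq" if "e \<in> E" "q \<in> set_uprod (ends G e)" for e
      using inc[OF that(1)] n(2) that(2) by (elim disjE) simp_all
    have "{e\<in>E. p \<in> set_uprod (ends G e)} \<subseteq> insert ep ?pq" "{e\<in>E. q \<in> set_uprod (ends G e)} \<subseteq> insert eq ?pq"
      using a b by blast+
    moreover have "insert ep ?pq \<subseteq> {e\<in>E. p \<in> set_uprod (ends G e)}" "insert eq ?pq \<subseteq> {e\<in>E. q \<in> set_uprod (ends G e)}"
      using m ep(1) eq(1) by (auto dest!: i)
    ultimately show "{e\<in>E. p \<in> set_uprod (ends G e)} = insert ep ?pq" "{e\<in>E. q \<in> set_uprod (ends G e)} = insert eq ?pq"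
      by (simp_all only: set_eq_subset simp_thms)
  qed
  then have dp: "dg G E p = Suc (card ?pq)" "dg G E q = Suc (card ?pq)" using eps fin by (simp_all add: dg_def)
  then have ev: "even (card ?pq)" using odd_deg[of p] pq by simp
  have ne: "?pq \<noteq> {}"
  proof -
    have "q \<in> V - {c}" using pq by simp
    then have "{p} \<noteq> V - {c}" using p_neq_q by (metis singletonD)
    moreover have "{p} \<subseteq> V - {c}" "{p} \<noteq> {}" using pq by simp_all
    moreover note del_conn[OF c]
    ultimately obtain e x y where e: "e \<in> E" "ends G e = Upair x y" "x \<in> {p}" "y \<in> V - {c} - {p}"
      using conn_cut by metis
    then have "x = p" "y = q" unfolding VV by auto
    then have "e \<in> ?pq" using e by (simp add: bouquet_def)
    then show ?thesis by blast
  qed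
  then have "card ?pq > 0" using fin by (simp add: card_gt_0_iff)
  then have "card ?pq \<ge> 2" using ev by (metis One_nat_def Suc_1 Suc_leI even_Suc even_zero le_neq_implies_less not_less_eq_eq)
  have sym: "bouquet G x y = bouquet G y x" for x y
    unfolding bouquet_def by (metis Upair_inject)
  have "shannon_triangle G"
    unfolding shannon_triangle_def
  proof (intro conjI ballI impI)
    fix x y assume "x \<in> V" "y \<in> V" "x \<noteq> y"
    then show "bouquet G x y \<noteq> {}" using VV ne bc sym[of c p] sym[of c q] sym[of q p] by auto
  qed (use multigraph loopless V in auto)
  moreover have "type_211 G"
    unfolding type_211_def using VV dist ev bc by (intro exI[of _ p] exI[of _ q] exI[of _ c]) auto
  moreover have "min_degree G = 2"
  proof -
    have "degree G ` V = {2, Suc (card ?pq)}" unfolding degree_eq_dg VV using dp dg_c by simp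
    then show ?thesis unfolding min_degree_def using \<open>card ?pq \<ge> 2\<close> by simp
  qed
  ultimately show ?thesis by (rule family_F.triangle)
qed

end

text \<open>A 2-edge cut around a side \<open>X\<close> that avoids \<open>c\<close>. In
  \<open>Ga\<close> the side \<open>X\<close> is replaced by an edge; in \<open>Gb\<close> the other
  side is replaced by a single vertex of degree two, which also goes by the name \<open>c\<close>.
  These are the two graphs of which \<open>G\<close> is a gluing.\<close>

locale two_cut = near_odd +
  fixes X f1 f2 p1 p2 x1 x2
  assumes X: "X \<subseteq> V - {c}" "X \<noteq> {}" "V - X - {c} \<noteq> {}"
    and cutX: "cut G E X = {f1, f2}" "f1 \<noteq> f2"
    and f1: "ends G f1 = Upair x1 p1" "p1 \<in> X" "x1 \<notin> X" and f2: "ends G f2 = Upair x2 p2" "p2 \<in> X" "x2 \<notin> X"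
begin

abbreviation "Y \<equiv> V - X"
abbreviation "Ga \<equiv> replace_by_edge G Y f1 x1 x2"
abbreviation "Gb \<equiv> contract G Y c"

lemma f_E: "f1 \<in> E" "f2 \<in> E"
  using cutX by (auto simp: cut_def)

lemma x_Y: "x1 \<in> Y" "x2 \<in> Y"
  using ends_in_V[OF f_E(1) f1(1)] ends_in_V[OF f_E(2) f2(1)] f1 f2 by auto

lemma c_Y: "c \<in> Y" "c \<notin> X" "X \<subseteq> V" "Y \<subseteq> V"
  using c X by auto

lemma edge_cases: "e \<in> E \<Longrightarrow> e \<in> inner G E X \<or> e \<in> inner G E Y \<or> e = f1 \<or> e = f2"
proof -
  assume e: "e \<in> E"
  then obtain x y where xy: "ends G e = Upair x y" "x \<in> V" "y \<in> V" by (rule ends_cases)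
  then show ?thesis using e cutX(1) cut_iff[OF xy(1), of E X] by (auto simp: inner_iff[OF xy(1)])
qed

lemma f_not: "f1 \<notin> inner G E X" "f1 \<notin> inner G E Y" "f2 \<notin> inner G E X" "f2 \<notin> inner G E Y"
  using f1 f2 by (auto simp: inner_def)

lemma inner_disj: "e \<in> inner G E X \<Longrightarrow> e \<notin> inner G E Y"
proof
  assume "e \<in> inner G E X" "e \<in> inner G E Y"
  moreover obtain x y where "ends G e = Upair x y" by (rule uprod_ends)
  ultimately show False by (auto simp: inner_def)
qed

lemma even_X: "even (card X)"
proof -
  have "card (cut G E X) = 2" using cutX by simp
  then show ?thesis using odd_cut[of X] X odd_deg by auto
qed

lemma card_X: "card X \<ge> 2"
proof -
  have "finite X" using c_Y finite_V finite_subset by blast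
  then have "card X \<noteq> 0" using X(2) by simp
  moreover have "card X \<noteq> 1" using even_X by auto
  ultimately show ?thesis by linarith
qed

lemma card_Y: "card Y \<ge> 3" "card V = card X + card Y"
proof -
  have fX: "finite X" "finite Y" using c_Y finite_V finite_subset by blast+
  have "V = X \<union> Y" "X \<inter> Y = {}" using c_Y by auto
  then show *: "card V = card X + card Y" using fX card_Un_disjoint by metis
  have Yc: "card Y = Suc (card (Y - {c}))" using c_Y fX(2) by (metis card.remove)
  have "card V = Suc (card (V - {c}))" using c by (metis card.remove finite_V)
  then have "even (card (Y - {c}))" using card_even even_X * Yc by (metis even_Suc even_add)
  moreover have "card (Y - {c}) \<noteq> 0" using X(3) fX by auto
  ultimately have "card (Y - {c}) \<ge> 2" by (metis One_nat_def Suc_1 Suc_leI even_Suc even_zero le_neq_implies_less not_gr_zero not_less_eq_eq)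
  then show "card Y \<ge> 3" using Yc by simp
qed

text \<open>A common end outside \<open>X\<close> would be a cut-vertex. Distinct ends are what
  keeps the new edge of \<open>Ga\<close> from being a loop.\<close>

lemma x_neq: "x1 \<noteq> x2"
proof
  assume eq: "x1 = x2"
  have x1: "x1 \<in> V" "X \<subseteq> V - {x1}" "X \<noteq> {}" using x_Y X f1 by auto
  have "Y \<noteq> {x1}" using card_Y by auto
  then have "X \<noteq> V - {x1}" using x_Y by auto
  with del_conn[OF x1(1)] x1(2,3) obtain d x y where d: "d \<in> E" "ends G d = Upair x y" "x \<in> X" "y \<in> V - {x1} - X" by (rule conn_cut)
  then have "d \<in> cut G E X" using cut_iff[OF d(2)] by auto
  then have "d = f1 \<or> d = f2" using cutX by auto
  then show False using d f1 f2 eq by auto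
qed

text \<open>Both sides have a boundary of the smallest possible size, so \<open>conn_min_cut\<close>
  applies with 2 as the bound.\<close>

lemma conn_XY: "conn G E X" "conn G E Y"
proof -
  have ge2: "2 \<le> card (cut G E Z)" if "Z \<subseteq> V" "Z - {c} \<noteq> {}" "V - Z - {c} \<noteq> {}" for Z
  proof (cases "c \<in> Z")
    case False
    then show ?thesis using no_bridge that c by blast
  next
    case True
    have "V - (V - Z) = Z" using that(1) by auto
    then have "2 \<le> card (cut G E (V - Z))" using that True c by (intro no_bridge[of _ c]) auto
    then show ?thesis by (simp add: cut_compl)
  qed
  have c2: "card (cut G E X) \<le> 2" "card (cut G E Y) \<le> 2" using cutX by (simp_all add: cut_compl)
  show "conn G E X" using X(3) c2(1) by (intro conn_min_cut[OF ge2] c_Y) auto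
  show "conn G E Y"
  proof (rule conn_min_cut[of 2])
    show "V - Y - {c} \<noteq> {}" using X by auto
  qed (use ge2 c2 in auto)
qed

lemma near_odd_Gb: "near_odd Gb c f1 f2 p1 p2"
proof -
  have VY: "V - Y = X" using c_Y by auto
  interpret Gb: tgraph Gb
    using c_Y conn_XY(1) card_X VY by (intro contract_tgraph) auto
  have fb: "f1 \<in> edges Gb" "f2 \<in> edges Gb" using f_E f_not by auto
  show ?thesis
  proof
    show "ends Gb f1 = Upair c p1" "ends Gb f2 = Upair c p2" using f1 f2 x_Y by auto
    show "e = f1 \<or> e = f2" if "e \<in> edges Gb" "c \<in> set_uprod (ends Gb e)" for e
    proof (rule ccontr)
      assume "\<not> ?thesis"
      then have "e \<in> inner G E X" using edge_cases[of e] that by auto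
      moreover obtain a b where "ends G e = Upair a b" by (rule uprod_ends)
      ultimately show False using that(2) c_Y by (auto simp: inner_def)
    qed
    fix v assume v: "v \<in> verts Gb" "v \<noteq> c"
    then have vX: "v \<in> X" using VY by auto
    have "dg Gb (edges Gb) v = dg G (edges Gb) v" using vX c_Y by (intro contract_dg) auto
    also have "\<dots> = dg G E v" using vX by (intro dg_cong) (auto simp: inner_def)
    finally show "odd (dg Gb (edges Gb) v)" using odd_deg v vX X(1) by auto
  qed (use fb cutX in auto)
qed

text \<open>The two edges at the 2-vertex of \<open>Gb\<close> have different colors, and
  \<open>colorable_combine\<close> continues such a coloring on the side of
  \<open>c\<close>.\<close>

lemma colorable_Gb:
  assumes "colorable 3 Gb"
  shows "colorable 3 G"
proof -
  interpret Gb: near_odd Gb c f1 f2 p1 p2 by (rule near_odd_Gb)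
  obtain \<kappa> where \<kappa>: "\<And>e. e \<in> edges Gb \<Longrightarrow> \<kappa> e < 3" "\<And>v. v \<in> verts Gb \<Longrightarrow> good_at Gb \<kappa> v"
    using assms unfolding colorable_iff by blast
  have ne: "\<kappa> f1 \<noteq> \<kappa> f2"
    by (rule Gb.two_edges_distinct_colors[OF \<kappa>(2) Gb.inc_c cutX(2)]) simp
  show ?thesis
  proof (rule colorable_combine[of X \<kappa> f1 "\<kappa> f2"])
    show "X \<subseteq> V" "c \<notin> X" "conn G E Y" "f1 \<in> cut G E X" "\<kappa> f1 \<noteq> \<kappa> f2" using c_Y conn_XY cutX ne by auto
    show "\<kappa> e < 3" if "e \<in> inner G E X \<union> cut G E X" for e
      using that inner_disj[of e] f_not f_E cutX(1) by (intro \<kappa>(1)) (auto simp: inner_def)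
    show "\<kappa> f2 < 3" using f_E f_not by (intro \<kappa>(1)) auto
    show "\<kappa> e = \<kappa> f2" if "e \<in> cut G E X" "e \<noteq> f1" for e using that cutX by auto
    show "good_at G \<kappa> v" if v: "v \<in> X" for v
      unfolding good_at_def
    proof
      fix i
      have "dg G {e\<in>E. \<kappa> e = i} v = dg G {e\<in>edges Gb. \<kappa> e = i} v"
        using v by (intro dg_cong) (auto simp: inner_def)
      also have "\<dots> = dg Gb {e\<in>edges Gb. \<kappa> e = i} v" using v c_Y by (intro contract_dg[symmetric]) auto
      finally have eq: "dg G {e\<in>E. \<kappa> e = i} v = dg Gb {e\<in>edges Gb. \<kappa> e = i} v" .
      have "good_at Gb \<kappa> v" using v c_Y by (intro \<kappa>(2)) auto
      then show "zero_or_odd (dg G {e\<in>E. \<kappa> e = i} v)" unfolding eq good_at_def ..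
    qed
  qed
qed

text \<open>As \<open>f1\<close> and \<open>f2\<close> are both in \<open>F\<close> or both outside,
  the one edge \<open>f1\<close> of \<open>Ga\<close> can replace the two: its ends
  \<open>x1\<close> and \<open>x2\<close> are their ends in \<open>Y\<close>.\<close>

lemma dg_Ga:
  assumes "v \<in> Y" "f1 \<in> F \<longleftrightarrow> f2 \<in> F" "F \<subseteq> E"
  shows "dg Ga (F \<inter> edges Ga) v = dg G F v"
proof -
  let ?S = "{e\<in>F \<inter> inner G E Y. v \<in> set_uprod (ends G e)}"
  have fS: "finite ?S" using assms(3) finite_sub[of F] by simp
  have i1: "v \<in> set_uprod (ends G f1) \<longleftrightarrow> v = x1" "v \<in> set_uprod (ends G f2) \<longleftrightarrow> v = x2"
    using f1 f2 assms(1) by auto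
  have "{e\<in>F. v \<in> set_uprod (ends G e)} = ?S \<union> {e\<in>{f1, f2}. e \<in> F \<and> v \<in> set_uprod (ends G e)}"
  proof -
    have "e \<in> inner G E Y \<or> e = f1 \<or> e = f2" if "e \<in> F" "v \<in> set_uprod (ends G e)" for e
      using edge_cases[of e] that assms(1,3) by (auto simp: inner_def)
    then show ?thesis using assms(3) f_E by auto
  qed
  also have "\<dots> = (if f1 \<in> F \<and> v = x1 then insert f1 ?S else if f1 \<in> F \<and> v = x2 then insert f2 ?S else ?S)"
    using i1 assms(2) x_neq by auto
  finally have 1: "{e\<in>F. v \<in> set_uprod (ends G e)} = (if f1 \<in> F \<and> v = x1 then insert f1 ?S else if f1 \<in> F \<and> v = x2 then insert f2 ?S else ?S)" .
  have 2: "{e\<in>F \<inter> edges Ga. v \<in> set_uprod (ends Ga e)} = (if f1 \<in> F \<and> (v = x1 \<or> v = x2) then insert f1 ?S else ?S)"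
    using f_not by auto
  have "f1 \<notin> ?S" "f2 \<notin> ?S" using f_not by auto
  then show ?thesis unfolding dg_def 1 2 using fS by auto
qed

lemma tgraph_Ga: "tgraph Ga"
proof
  have fY: "finite Y" by simp
  have sub: "inner G E Y \<subseteq> E" by (auto simp: inner_def)
  have "finite (edges Ga)" using finite_subset[OF sub] by simp
  moreover have "set_uprod (ends Ga e) \<subseteq> verts Ga" if "e \<in> edges Ga" for e
    using that x_Y by (auto simp: inner_def)
  ultimately show "Defs.multigraph Ga" using fY by (simp add: multigraph_def)
  show "Defs.loopless Ga" using loopless sub x_neq by (auto simp: loopless_def)
  show "card (verts Ga) \<ge> 3" using card_Y by simp
  fix v assume v: "v \<in> verts Ga"
  \<comment> \<open>All of \<open>X\<close> is sent to an end of the new edge that survives the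
    removal of \<open>v\<close>.\<close>
  define u where "u = (if v = x1 then x2 else x1)"
  have u: "u \<in> Y - {v}" using x_neq x_Y by (auto simp: u_def)
  have "conn G E (V - {v})" using v by (intro del_conn) auto
  then show "conn Ga (edges Ga) (verts Ga - {v})"
  proof (rule conn_image[where h = "\<lambda>a. if a \<in> X then u else a"])
    fix a b e assume e: "a \<in> V - {v}" "b \<in> V - {v}" "e \<in> E" "ends G e = Upair a b"
    have x12: "(x1, x2) \<in> adj Ga (edges Ga) (verts Ga - {v})" "(x2, x1) \<in> adj Ga (edges Ga) (verts Ga - {v})" if "v \<noteq> x1" "v \<noteq> x2"
      using that x_Y by (auto intro!: adjI[of f1] adjI'[of f1])
    consider "e \<in> inner G E X" | "e \<in> inner G E Y" | "e = f1" | "e = f2" using edge_cases[OF e(3)] by blast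
    then show "(if a \<in> X then u else a, if b \<in> X then u else b) \<in> (adj Ga (edges Ga) (verts Ga - {v}))\<^sup>*"
    proof cases
      case 1
      then have "a \<in> X" "b \<in> X" by (simp_all add: inner_iff[OF e(4)])
      then show ?thesis by simp
    next
      case 2
      then have "a \<notin> X" "b \<notin> X" "e \<noteq> f1" using e(4) f_not by (auto simp: inner_def)
      moreover from this have "(a, b) \<in> adj Ga (edges Ga) (verts Ga - {v})" using 2 e by (intro adjI[of e]) auto
      ultimately show ?thesis by auto
    next
      case 3
      then have "a = x1 \<and> b = p1 \<or> a = p1 \<and> b = x1" using e(4) f1(1) by auto
      then show ?thesis using f1 e(1,2) by (auto simp: u_def)
    next
      case 4
      then have "a = x2 \<and> b = p2 \<or> a = p2 \<and> b = x2" using e(4) f2(1) by auto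
      then show ?thesis using f2 e(1,2) x12 by (auto simp: u_def)
    qed
  next
    fix z assume "z \<in> verts Ga - {v}"
    then have "z \<in> V - {v} \<and> (z, if z \<in> X then u else z) \<in> (adj Ga (edges Ga) (verts Ga - {v}))\<^sup>*" by auto
    then show "\<exists>x\<in>V - {v}. (z, if x \<in> X then u else x) \<in> (adj Ga (edges Ga) (verts Ga - {v}))\<^sup>*" by blast
  qed
qed

lemma edges_Ga: "edges Ga \<subseteq> E"
  using f_E by (auto simp: inner_def)

lemma dg_Ga_all: "v \<in> Y \<Longrightarrow> dg Ga (edges Ga) v = dg G E v"
  using dg_Ga[of v E] f_E edges_Ga by (simp add: Int_absorb1 del: replace_by_edge_simps)

lemma near_odd_Ga: "\<exists>ep eq p q. near_odd Ga c ep eq p q"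
proof -
  interpret Ga: tgraph Ga by (rule tgraph_Ga)
  show ?thesis
    using dg_Ga_all c_Y dg_c odd_deg by (intro Ga.near_oddI) (auto simp del: replace_by_edge_simps(2,3))
qed

text \<open>All edges inside \<open>X\<close> and both edges of the cut get the color of the new
  edge; this is allowed because the degrees in \<open>X\<close> are odd.\<close>

lemma colorable_Ga:
  assumes "colorable 3 Ga"
  shows "colorable 3 G"
proof -
  obtain \<kappa> where \<kappa>: "\<And>e. e \<in> edges Ga \<Longrightarrow> \<kappa> e < 3" "\<And>v. v \<in> verts Ga \<Longrightarrow> good_at Ga \<kappa> v"
    using assms unfolding colorable_iff by blast
  define col where "col e = (if e \<in> inner G E Y then \<kappa> e else \<kappa> f1)" for e
  have "good_at G col v" if v: "v \<in> V" for v
  proof (cases "v \<in> X")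
    case True
    have "col e = \<kappa> f1" if "v \<in> set_uprod (ends G e)" for e using that True by (auto simp: col_def inner_def)
    then show ?thesis using odd_deg[OF v] True c_Y by (intro good_mono) auto
  next
    case False
    then have vY: "v \<in> Y" using v by auto
    show ?thesis unfolding good_at_def
    proof
      fix i
      have "dg G {e\<in>E. col e = i} v = dg Ga ({e\<in>E. col e = i} \<inter> edges Ga) v"
        using vY f_E f_not by (intro dg_Ga[symmetric]) (auto simp: col_def)
      also have "{e\<in>E. col e = i} \<inter> edges Ga = {e\<in>edges Ga. \<kappa> e = i}"
        using f_E f_not by (auto simp: col_def inner_def)
      finally have eq: "dg G {e\<in>E. col e = i} v = dg Ga {e\<in>edges Ga. \<kappa> e = i} v" .
      have "good_at Ga \<kappa> v" using vY by (intro \<kappa>(2)) simp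
      then show "zero_or_odd (dg G {e\<in>E. col e = i} v)" unfolding eq good_at_def ..
    qed
  qed
  moreover have "col e < 3" for e using \<kappa>(1) by (auto simp: col_def)
  ultimately show ?thesis unfolding colorable_iff by blast
qed

lemma gluing_Ga_Gb: "gluing Ga Gb G"
proof -
  interpret Gb: near_odd Gb c f1 f2 p1 p2 by (rule near_odd_Gb)
  let ?U = "glued Ga f1 x1 x2 Gb c p1 p2"
  have two: "{v\<in>verts Gb. degree Gb v = 2} = {c}"
    using Gb.dg_c Gb.c Gb.odd_deg unfolding Gb.degree_eq_dg by (metis (mono_tags, lifting) Collect_cong even_numeral singleton_conv)
  have left: "edges Ga - {f1} = inner G E Y" using f_not by auto
  have right: "{d\<in>edges Gb. c \<notin> set_uprod (ends Gb d)} = inner G E X"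
  proof (rule set_eqI)
    fix d
    show "d \<in> {d\<in>edges Gb. c \<notin> set_uprod (ends Gb d)} \<longleftrightarrow> d \<in> inner G E X"
    proof
      assume d: "d \<in> {d\<in>edges Gb. c \<notin> set_uprod (ends Gb d)}"
      then have "d \<noteq> f1" "d \<noteq> f2" using Gb.ep Gb.eq by auto
      then show "d \<in> inner G E X" using edge_cases[of d] d by auto
    next
      assume d: "d \<in> inner G E X"
      then have dE: "d \<in> edges Gb" using inner_disj[of d] by (auto simp: inner_def)
      moreover have "c \<notin> set_uprod (ends Gb d)"
        using Gb.c_only[OF dE] d f_not by blast
      ultimately show "d \<in> {d\<in>edges Gb. c \<notin> set_uprod (ends Gb d)}" by blast
    qed
  qed
  define h where "h = case_sum (\<lambda>v. v) (\<lambda>v. v :: 'a)"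
  define g where "g = case_option f2 (case_option f1 (case_sum (\<lambda>e. e) (\<lambda>e. e :: 'b)))"
  have vU: "verts ?U = Y <+> X" using c_Y by auto
  have eU: "edges ?U = insert None (insert (Some None) ((Some \<circ> Some) ` (inner G E Y <+> inner G E X)))"
    unfolding glued_simps left right ..
  have "bij_betw h (verts ?U) V"
    unfolding bij_betw_def vU
  proof
    show "inj_on h (Y <+> X)" by (auto simp: inj_on_def h_def)
    show "h ` (Y <+> X) = V" using c_Y by (auto simp: h_def image_Un Plus_def image_image)
  qed
  moreover have "bij_betw g (edges ?U) E"
    unfolding bij_betw_def
  proof
    have ne: "d \<noteq> f1" "d \<noteq> f2" if "d \<in> inner G E X \<or> d \<in> inner G E Y" for d using that f_not by auto
    show "inj_on g (edges ?U)"
    proof (rule inj_onI)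
      have dis: "d \<noteq> d'" "d' \<noteq> d" if "d \<in> inner G E X" "d' \<in> inner G E Y" for d d' using that inner_disj by blast+
      fix a b assume ab: "a \<in> edges ?U" "b \<in> edges ?U" "g a = g b"
      have "z = None \<or> z = Some None \<or> (\<exists>d\<in>inner G E Y. z = Some (Some (Inl d))) \<or> (\<exists>d\<in>inner G E X. z = Some (Some (Inr d)))"
        if "z \<in> edges ?U" for z using that unfolding eU by auto
      from this[OF ab(1)] this[OF ab(2)] show "a = b"
        using ab(3) by (elim disjE bexE) (simp_all add: g_def ne ne[symmetric] dis cutX(2) cutX(2)[symmetric])
    qed
    have img: "g ` edges ?U = insert f2 (insert f1 (inner G E Y \<union> inner G E X))"
      unfolding eU by (auto simp: g_def Plus_def image_image image_Un)
    have "inner G E Y \<subseteq> E" "inner G E X \<subseteq> E" by (auto simp: inner_def)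
    moreover have "E \<subseteq> insert f2 (insert f1 (inner G E Y \<union> inner G E X))" using edge_cases by blast
    ultimately show "g ` edges ?U = E" unfolding img using f_E by (intro equalityI) simp_all
  qed
  moreover have "ends G (g e) = map_uprod h (ends ?U e)" if "e \<in> edges ?U" for e
  proof -
    consider "e = None" | "e = Some None" | d where "e = Some (Some (Inl d))" "d \<in> inner G E Y"
      | d where "e = Some (Some (Inr d))" "d \<in> inner G E X" using \<open>e \<in> edges ?U\<close> unfolding eU by auto
    then show ?thesis
    proof cases
      case 1 then show ?thesis using f2 by (simp add: g_def h_def)
    next
      case 2 then show ?thesis using f1 by (simp add: g_def h_def)
    next
      case 3
      obtain a b where "ends G d = Upair a b" by (rule uprod_ends)
      moreover have "d \<noteq> f1" using 3 f_not by auto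
      ultimately show ?thesis using 3 by (simp add: g_def h_def)
    next
      case 4
      obtain a b where ab: "ends G d = Upair a b" by (rule uprod_ends)
      then have "a \<in> X" "b \<in> X" using 4 by (auto simp: inner_def)
      then show ?thesis using 4 ab by (simp add: g_def h_def)
    qed
  qed
  ultimately have iso: "isomorphic ?U G" unfolding isomorphic_def by blast
  have fa: "f1 \<in> edges Ga" "ends Ga f1 = Upair x1 x2" by simp_all
  show ?thesis unfolding gluing_def
    by (intro exI[of _ f1] exI[of _ x1] exI[of _ x2] exI[of _ c] exI[of _ f1] exI[of _ p1] exI[of _ f2] exI[of _ p2] conjI)
      (fact fa two Gb.ep Gb.eq Gb.ep_eq iso[unfolded glued_def])+
qed

end

lemma family_F_if_not_colorable:
  assumes "near_odd G c ep eq p q" "\<not> colorable 3 G"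
  shows "G \<in> family_F"
  using assms
proof (induction "card (verts G)" arbitrary: G c ep eq p q rule: less_induct)
  case less
  interpret near_odd G c ep eq p q by (rule less.prems(1))
  note n = less.prems(2)
  have cV: "card V = Suc (card (V - {c}))" using c by (metis card.remove finite_V)
  show ?case
  proof (cases "card V = 3")
    case True then show ?thesis by (rule family_F_triangle)
  next
    case False
    then have "card (V - {c}) \<ge> 3" using card_V cV by linarith
    \<comment> \<open>\<open>V\<close> without \<open>c\<close> has even order, so after order three
      the next possible order is five.\<close>
    moreover have "card (V - {c}) \<noteq> 3" using card_even by auto
    ultimately have V5: "card V \<ge> 5" using cV by linarith
    show ?thesis
    proof (cases "cuts3 G c")
      case True
      then show ?thesis
        using V5 n cubic_of_cuts3[OF less.prems(1) True n V5] by (intro family_F_cubic) auto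
    next
      case False
      then obtain X0 where X0: "X0 \<subseteq> V" "X0 - {c} \<noteq> {}" "V - X0 - {c} \<noteq> {}" "card (cut G E X0) < 3"
        unfolding cuts3_def by (auto simp: not_le)
      \<comment> \<open>The side without \<open>c\<close>; passing to the complement does not change
        the cut.\<close>
      define X where "X = (if c \<in> X0 then V - X0 else X0)"
      have X: "X \<subseteq> V - {c}" "X - {c} \<noteq> {}" "V - X - {c} \<noteq> {}" "card (cut G E X) < 3"
        using X0 c by (auto simp: X_def cut_compl)
      then have "2 \<le> card (cut G E X)" using c by (intro no_bridge[of _ c]) auto
      then have "card (cut G E X) = 2" using X(4) by linarith
      then obtain f1 f2 where f: "cut G E X = {f1, f2}" "f1 \<noteq> f2" by (auto simp: card_2_iff)
      have ex: "\<exists>x p. ends G e = Upair x p \<and> p \<in> X \<and> x \<notin> X" if "e \<in> cut G E X" for e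
      proof -
        obtain a b where "e \<in> E" "ends G e = Upair a b" "a \<in> X" "b \<notin> X" using \<open>e \<in> cut G E X\<close> by (rule cutE)
        then show ?thesis by (intro exI[of _ b] exI[of _ a]) auto
      qed
      obtain x1 p1 where 1: "ends G f1 = Upair x1 p1" "p1 \<in> X" "x1 \<notin> X" using ex[of f1] f by blast
      obtain x2 p2 where 2: "ends G f2 = Upair x2 p2" "p2 \<in> X" "x2 \<notin> X" using ex[of f2] f by blast
      interpret two_cut G c ep eq p q X f1 f2 p1 p2 x1 x2
        using X f 1 2 by unfold_locales auto
      obtain ep' eq' p' q' where Ga: "near_odd Ga c ep' eq' p' q'" using near_odd_Ga by blast
      have "Ga \<in> family_F"
        using card_X card_Y colorable_Ga n by (intro less.hyps[OF _ Ga]) auto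
      moreover have "Gb \<in> family_F"
      proof (rule less.hyps[OF _ near_odd_Gb])
        have "V - Y = X" using c_Y by auto
        moreover have "finite X" using c_Y finite_V finite_subset by blast
        ultimately have "card (verts Gb) = Suc (card X)" using c_Y by simp
        then show "card (verts Gb) < card V" using card_Y by simp
      qed (use colorable_Gb n in blast)
      ultimately show ?thesis using gluing_Ga_Gb by (rule family_F.glue)
    qed
  qed
qed

theorem theorem4p1:
  fixes G :: "('v, 'e) mgraph"
  assumes "multigraph G" and "G \<in> class_S" and "two_connected G"
  shows "G \<in> family_F \<longleftrightarrow> odd_chromatic_index G = 4"
proof -
  interpret tgraph G using tgraph_iff[OF assms(1)] assms(3) by blast
  have deg: "odd (dg G E v) \<or> dg G E v = 2" if "v \<in> V" for v
    using class_S_degrees[OF assms(2) that] degree_eq_dg by simp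
  \<comment> \<open>Both directions go through a graph without a 3-coloring, which has exactly one
    2-vertex because every other number of 2-vertices admits three colors.\<close>
  have near: "\<exists>c ep eq p q. near_odd G c ep eq p q" if n: "\<not> colorable 3 G"
  proof -
    have "card {v\<in>V. dg G E v = 2} = 1" using colorable_even[OF deg] colorable_odd[OF deg] n by blast
    then obtain c where c: "{v\<in>V. dg G E v = 2} = {c}" by (auto simp: card_1_singleton_iff)
    then have "c \<in> V" "dg G E c = 2" "\<And>v. v \<in> V \<Longrightarrow> v \<noteq> c \<Longrightarrow> odd (dg G E v)" using deg by blast+
    then show ?thesis using near_oddI by blast
  qed
  show ?thesis
  proof
    assume "G \<in> family_F"
    then have n: "\<not> colorable 3 G" using family_F_not_colorable by blast
    then obtain c ep eq p q where "near_odd G c ep eq p q" using near by blast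
    then have "colorable 4 G" by (rule near_odd.colorable_4)
    with n show "odd_chromatic_index G = 4" unfolding odd_chromatic_index_eq_4 by blast
  next
    assume "odd_chromatic_index G = 4"
    then have n: "\<not> colorable 3 G" using odd_chromatic_index_eq_4 by blast
    then obtain c ep eq p q where "near_odd G c ep eq p q" using near by blast
    then show "G \<in> family_F" using n by (rule family_F_if_not_colorable)
  qed
qed

end
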